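(* Let $\bar P=(P,P^* )\in\bar M$ and let $(x_n)$ be a sequence in $M$. Suppose that either ($P\ne\emptyset$ and $P=\lim I^-(x_n)$) or ($P^*\neq\emptyset$ and $P^*=\lim I^+(x_n)$). Then $\Phi(x_n)$ converges to $\bar P$ in $(\bar M,\bar{\mathcal T}_{alt})$.
   Context: Let $M$ be a strongly causal spacetime (a time-oriented Lorentzian manifold in which every point has a neighbourhood that no non-spacelike curve enters more than once). $I^\pm(p)$ denotes the chronological future/past of $p\in M$, and $I^\pm(S)=\bigcup_{s\in S}I^\pm(s)$. A past-set is a set $I^-(S)$ with $S\subset M$. An IP is a nonempty past-set that is not the union of two proper subsets which are past-sets. IFs are defined dually. For an IP $P$, $f(P)=I^+(\{x:P\subset I^-(x)\})$. For an IF $P^*$, $p(P^* )=I^-(\{x:P^*\subset I^+(x)\})$. $R_{pf}$ is the set of pairs $(P,Q^* )$ (with $P$ an IP and $Q^*$ an IF) such that both of the following hold: - $Q^*$ is a maximal IF (under inclusion) contained in $f(P)$; - $P$ is a maximal IP contained in $p(Q^* )$. $\bar M$ is the set of pairs $\bar P=(P,P^* )$ such that one of the following holds: - $(P,P^* )\in R_{pf}$; - $P=\emptyset$ and $P^*$ is an IF occurring in no pair of $R_{pf}$; - $P^*=\emptyset$ and $P$ is an IP occurring in no pair of $R_{pf}$. $\Phi(p)=(I^-(p),I^+(p))$ is an injection $M\to\bar M$. Limits of sets: for past-sets $P_n$ and $Q$, $Q=\lim P_n$ means both of the following: - (i) each $x\in Q$ lies in $P_n$ for all sufficiently large $n$;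 - (ii) for each $x\in M$ with $I^-(x)\not\subset Q$, one has $I^-(x)\not\subset P_n$ for all sufficiently large $n$. Limits of future-sets are defined dually, with $I^+$ in place of $I^-$. For $\bar S\subset\bar M$ define: - $L^+_{IF}(\bar S)=\{\bar Q:Q^*\ne\emptyset,\ Q^*\subset\bigcup_{\bar R\in\bar S}R^*\}$; - $L^-_{IP}(\bar S)=\{\bar Q:Q\ne\emptyset,\ Q\subset\bigcup_{\bar R\in\bar S}R\}$; - $Cl_+(\bar S)=\bar S\cup\{\bar Q:Q\ne\emptyset,\ Q=\lim R_n\text{ for some sequence }\bar R_n\in\bar S\}$; - $Cl_-(\bar S)=\bar S\cup\{\bar Q:Q^*\neq\emptyset,\ Q^*=\lim R_n^*\text{ for some sequence }\bar R_n\in\bar S\}$; - $L^+_{alt}(\bar S)=Cl_+[L^+_{IF}(\bar S)]$; - $L^-_{alt}(\bar S)=Cl_-[L^-_{IP}(\bar S)]$; - $L_{alt}(\bar S_1,\bar S_2)=Cl_+[L^-_{IP}(\bar S_1)\cap L^+_{IF}(\bar S_2)]\cup Cl_-[L^-_{IP}(\bar S_1)\cap L^+_{IF}(\bar S_2)]$. $\bar{\mathcal T}_{alt}$ is the coarsest topology on $\bar M$ in which $\bar M\setminus L^+_{alt}(\bar S)$, $\bar M\setminus L^-_{alt}(\bar S)$ and $\bar M\setminus L_{alt}(\bar S_1,\bar S_2)$ are open for all $\bar S,\bar S_1,\bar S_2\subset\bar M$. *)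

theory Defs
  imports "HOL-Analysis.Analysis"
begin

text \<open>f is C-infinity on (the open set) S: differentiable, and every directional
derivative is again C-infinity (coinductively, i.e. to all orders).\<close>

coinductive smooth_on :: "'a::real_normed_vector set \<Rightarrow> ('a \<Rightarrow> 'b::real_normed_vector) \<Rightarrow> bool" where
  "f differentiable_on S \<Longrightarrow> (\<forall>v. smooth_on S (\<lambda>x. frechet_derivative f (at x) v))
     \<Longrightarrow> smooth_on S f"

type_synonym ('a, 'n) chart = "'a set \<times> ('a \<Rightarrow> real^'n)"

definition trans_jac :: "('a, 'n::finite) chart \<Rightarrow> ('a, 'n) chart \<Rightarrow> 'a \<Rightarrow> real^'n^'n" where
  "trans_jac c d p = matrix (frechet_derivative (snd c \<circ> inv_into (fst d) (snd d)) (at (snd d p)))"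

definition smooth_manifold :: "'a topology \<Rightarrow> ('a, 'n::finite) chart set \<Rightarrow> bool" where
  "smooth_manifold X A \<longleftrightarrow>
     Hausdorff_space X \<and> second_countable X \<and> connected_space X \<and> topspace X \<noteq> {} \<and>
     (\<Union>c\<in>A. fst c) = topspace X \<and>
     (\<forall>(U,\<phi>)\<in>A. openin X U \<and> open (\<phi> ` U) \<and>
         homeomorphic_map (subtopology X U) (top_of_set (\<phi> ` U)) \<phi>) \<and>
     (\<forall>(U,\<phi>)\<in>A. \<forall>(V,\<psi>)\<in>A. smooth_on (\<psi> ` (U \<inter> V)) (\<phi> \<circ> inv_into V \<psi>))"

definition lorentzian_matrix :: "real^'n::finite^'n \<Rightarrow> bool" where
  "lorentzian_matrix G \<longleftrightarrow> transpose G = G \<and>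
     (\<exists>(P::real^'n^'n) i0. invertible P \<and>
        transpose P ** G ** P = (\<chi> i j. if i = j then (if i = i0 then -1 else 1) else 0))"

text \<open>g c x is the metric matrix in chart c at the coordinate point x;
T c x is the time-orientation vector field in chart c at x.\<close>

definition spacetime ::
  "'a topology \<Rightarrow> ('a, 'n::finite) chart set \<Rightarrow> (('a, 'n) chart \<Rightarrow> real^'n \<Rightarrow> real^'n^'n)
     \<Rightarrow> (('a, 'n) chart \<Rightarrow> real^'n \<Rightarrow> real^'n) \<Rightarrow> bool" where
  "spacetime X A g T \<longleftrightarrow> CARD('n) \<ge> 2 \<and> smooth_manifold X A \<and>
     (\<forall>c\<in>A. smooth_on (snd c ` fst c) (g c) \<and>
        (\<forall>x\<in>snd c ` fst c. lorentzian_matrix (g c x)) \<and>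
        continuous_on (snd c ` fst c) (T c) \<and>
        (\<forall>x\<in>snd c ` fst c. T c x \<bullet> (g c x *v T c x) < 0)) \<and>
     (\<forall>c\<in>A. \<forall>d\<in>A. \<forall>p\<in>fst c \<inter> fst d.
        g d (snd d p) = transpose (trans_jac c d p) ** g c (snd c p) ** trans_jac c d p \<and>
        T c (snd c p) = trans_jac c d p *v T d (snd d p))"

definition future_timelike_vec :: "real^'n^'n \<Rightarrow> real^'n \<Rightarrow> real^'n \<Rightarrow> bool" where
  "future_timelike_vec G t v \<longleftrightarrow> v \<bullet> (G *v v) < 0 \<and> v \<bullet> (G *v t) < 0"

definition future_causal_vec :: "real^'n^'n \<Rightarrow> real^'n \<Rightarrow> real^'n \<Rightarrow> bool" where
  "future_causal_vec G t v \<longleftrightarrow> v \<noteq> 0 \<and> v \<bullet> (G *v v) \<le> 0 \<and> v \<bullet> (G *v t) < 0"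

definition pw_curve ::
  "'a topology \<Rightarrow> ('a, 'n::finite) chart set \<Rightarrow> (('a, 'n) chart \<Rightarrow> real^'n \<Rightarrow> real^'n^'n)
     \<Rightarrow> (('a, 'n) chart \<Rightarrow> real^'n \<Rightarrow> real^'n)
     \<Rightarrow> (real^'n^'n \<Rightarrow> real^'n \<Rightarrow> real^'n \<Rightarrow> bool)
     \<Rightarrow> (real \<Rightarrow> 'a) \<Rightarrow> real \<Rightarrow> real \<Rightarrow> bool" where
  "pw_curve X A g T Q \<gamma> a b \<longleftrightarrow> a < b \<and>
     continuous_map (top_of_set {a..b}) X \<gamma> \<and>
     (\<exists>K. finite K \<and> a \<in> K \<and> b \<in> K \<and> K \<subseteq> {a..b} \<and>
        (\<forall>s\<in>K. \<forall>s'\<in>K. s < s' \<and> {s<..<s'} \<inter> K = {} \<longrightarrow>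
           (\<forall>c\<in>A. \<exists>D. continuous_on {t\<in>{s..s'}. \<gamma> t \<in> fst c} D \<and>
              (\<forall>t\<in>{s..s'}. \<gamma> t \<in> fst c \<longrightarrow>
                 ((snd c \<circ> \<gamma>) has_vector_derivative D t) (at t within {s..s'}) \<and>
                 Q (g c (snd c (\<gamma> t))) (T c (snd c (\<gamma> t))) (D t)))))"

definition chron ::
  "'a topology \<Rightarrow> ('a, 'n::finite) chart set \<Rightarrow> (('a, 'n) chart \<Rightarrow> real^'n \<Rightarrow> real^'n^'n)
     \<Rightarrow> (('a, 'n) chart \<Rightarrow> real^'n \<Rightarrow> real^'n) \<Rightarrow> 'a \<Rightarrow> 'a \<Rightarrow> bool" where
  "chron X A g T p q \<longleftrightarrow>
     (\<exists>\<gamma> a b. pw_curve X A g T future_timelike_vec \<gamma> a b \<and> \<gamma> a = p \<and> \<gamma> b = q)"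

text \<open>Strong causality: every neighbourhood of every point contains a neighbourhood V
which no causal (non-spacelike) curve enters more than once, i.e. the parameter set
of the curve lying in V is connected.\<close>
definition strongly_causal_spacetime ::
  "'a topology \<Rightarrow> ('a, 'n::finite) chart set \<Rightarrow> (('a, 'n) chart \<Rightarrow> real^'n \<Rightarrow> real^'n^'n)
     \<Rightarrow> (('a, 'n) chart \<Rightarrow> real^'n \<Rightarrow> real^'n) \<Rightarrow> bool" where
  "strongly_causal_spacetime X A g T \<longleftrightarrow> spacetime X A g T \<and>
     (\<forall>p\<in>topspace X. \<forall>U. openin X U \<and> p \<in> U \<longrightarrow>
        (\<exists>V. openin X V \<and> p \<in> V \<and> V \<subseteq> U \<and>
           (\<forall>\<gamma> a b. pw_curve X A g T future_causal_vec \<gamma> a b \<longrightarrow>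
              connected {t\<in>{a..b}. \<gamma> t \<in> V})))"

definition Ifut :: "'a set \<Rightarrow> ('a \<Rightarrow> 'a \<Rightarrow> bool) \<Rightarrow> 'a set \<Rightarrow> 'a set" where
  "Ifut M chr S = {y\<in>M. \<exists>s\<in>S. chr s y}"

definition Ipast :: "'a set \<Rightarrow> ('a \<Rightarrow> 'a \<Rightarrow> bool) \<Rightarrow> 'a set \<Rightarrow> 'a set" where
  "Ipast M chr S = {y\<in>M. \<exists>s\<in>S. chr y s}"

definition past_set :: "'a set \<Rightarrow> ('a \<Rightarrow> 'a \<Rightarrow> bool) \<Rightarrow> 'a set \<Rightarrow> bool" where
  "past_set M chr P \<longleftrightarrow> (\<exists>S\<subseteq>M. P = Ipast M chr S)"

definition future_set :: "'a set \<Rightarrow> ('a \<Rightarrow> 'a \<Rightarrow> bool) \<Rightarrow> 'a set \<Rightarrow> bool" where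
  "future_set M chr F \<longleftrightarrow> (\<exists>S\<subseteq>M. F = Ifut M chr S)"

definition IP :: "'a set \<Rightarrow> ('a \<Rightarrow> 'a \<Rightarrow> bool) \<Rightarrow> 'a set \<Rightarrow> bool" where
  "IP M chr P \<longleftrightarrow> P \<noteq> {} \<and> past_set M chr P \<and>
     \<not> (\<exists>B C. past_set M chr B \<and> past_set M chr C \<and> B \<subset> P \<and> C \<subset> P \<and> P = B \<union> C)"

definition IF :: "'a set \<Rightarrow> ('a \<Rightarrow> 'a \<Rightarrow> bool) \<Rightarrow> 'a set \<Rightarrow> bool" where
  "IF M chr F \<longleftrightarrow> F \<noteq> {} \<and> future_set M chr F \<and>
     \<not> (\<exists>B C. future_set M chr B \<and> future_set M chr C \<and> B \<subset> F \<and> C \<subset> F \<and> F = B \<union> C)"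

definition fP :: "'a set \<Rightarrow> ('a \<Rightarrow> 'a \<Rightarrow> bool) \<Rightarrow> 'a set \<Rightarrow> 'a set" where
  "fP M chr P = Ifut M chr {x\<in>M. P \<subseteq> Ipast M chr {x}}"

definition pF :: "'a set \<Rightarrow> ('a \<Rightarrow> 'a \<Rightarrow> bool) \<Rightarrow> 'a set \<Rightarrow> 'a set" where
  "pF M chr F = Ipast M chr {x\<in>M. F \<subseteq> Ifut M chr {x}}"

definition Rpf :: "'a set \<Rightarrow> ('a \<Rightarrow> 'a \<Rightarrow> bool) \<Rightarrow> ('a set \<times> 'a set) set" where
  "Rpf M chr = {(P, Q). IP M chr P \<and> IF M chr Q \<and>
      Q \<subseteq> fP M chr P \<and> \<not> (\<exists>Q'. IF M chr Q' \<and> Q' \<subseteq> fP M chr P \<and> Q \<subset> Q') \<and>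
      P \<subseteq> pF M chr Q \<and> \<not> (\<exists>P'. IP M chr P' \<and> P' \<subseteq> pF M chr Q \<and> P \<subset> P')}"

definition Mbar :: "'a set \<Rightarrow> ('a \<Rightarrow> 'a \<Rightarrow> bool) \<Rightarrow> ('a set \<times> 'a set) set" where
  "Mbar M chr = Rpf M chr
     \<union> {(P, F). P = {} \<and> IF M chr F \<and> \<not> (\<exists>P'. (P', F) \<in> Rpf M chr)}
     \<union> {(P, F). F = {} \<and> IP M chr P \<and> \<not> (\<exists>F'. (P, F') \<in> Rpf M chr)}"

definition Phi :: "'a set \<Rightarrow> ('a \<Rightarrow> 'a \<Rightarrow> bool) \<Rightarrow> 'a \<Rightarrow> 'a set \<times> 'a set" where
  "Phi M chr p = (Ipast M chr {p}, Ifut M chr {p})"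

definition lim_past :: "'a set \<Rightarrow> ('a \<Rightarrow> 'a \<Rightarrow> bool) \<Rightarrow> (nat \<Rightarrow> 'a set) \<Rightarrow> 'a set \<Rightarrow> bool" where
  "lim_past M chr Pn Q \<longleftrightarrow>
     (\<forall>x\<in>Q. eventually (\<lambda>n. x \<in> Pn n) sequentially) \<and>
     (\<forall>x\<in>M. \<not> Ipast M chr {x} \<subseteq> Q \<longrightarrow>
        eventually (\<lambda>n. \<not> Ipast M chr {x} \<subseteq> Pn n) sequentially)"

definition lim_fut :: "'a set \<Rightarrow> ('a \<Rightarrow> 'a \<Rightarrow> bool) \<Rightarrow> (nat \<Rightarrow> 'a set) \<Rightarrow> 'a set \<Rightarrow> bool" where
  "lim_fut M chr Fn Q \<longleftrightarrow>
     (\<forall>x\<in>Q. eventually (\<lambda>n. x \<in> Fn n) sequentially) \<and>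
     (\<forall>x\<in>M. \<not> Ifut M chr {x} \<subseteq> Q \<longrightarrow>
        eventually (\<lambda>n. \<not> Ifut M chr {x} \<subseteq> Fn n) sequentially)"

definition L_IF :: "'a set \<Rightarrow> ('a \<Rightarrow> 'a \<Rightarrow> bool) \<Rightarrow> ('a set \<times> 'a set) set \<Rightarrow> ('a set \<times> 'a set) set" where
  "L_IF M chr S = {Q\<in>Mbar M chr. snd Q \<noteq> {} \<and> snd Q \<subseteq> (\<Union>R\<in>S. snd R)}"

definition L_IP :: "'a set \<Rightarrow> ('a \<Rightarrow> 'a \<Rightarrow> bool) \<Rightarrow> ('a set \<times> 'a set) set \<Rightarrow> ('a set \<times> 'a set) set" where
  "L_IP M chr S = {Q\<in>Mbar M chr. fst Q \<noteq> {} \<and> fst Q \<subseteq> (\<Union>R\<in>S. fst R)}"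

definition Cl_plus :: "'a set \<Rightarrow> ('a \<Rightarrow> 'a \<Rightarrow> bool) \<Rightarrow> ('a set \<times> 'a set) set \<Rightarrow> ('a set \<times> 'a set) set" where
  "Cl_plus M chr S = S \<union> {Q\<in>Mbar M chr. fst Q \<noteq> {} \<and>
      (\<exists>R. (\<forall>n. R n \<in> S) \<and> lim_past M chr (\<lambda>n. fst (R n)) (fst Q))}"

definition Cl_minus :: "'a set \<Rightarrow> ('a \<Rightarrow> 'a \<Rightarrow> bool) \<Rightarrow> ('a set \<times> 'a set) set \<Rightarrow> ('a set \<times> 'a set) set" where
  "Cl_minus M chr S = S \<union> {Q\<in>Mbar M chr. snd Q \<noteq> {} \<and>
      (\<exists>R. (\<forall>n. R n \<in> S) \<and> lim_fut M chr (\<lambda>n. snd (R n)) (snd Q))}"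

definition L_plus_alt where
  "L_plus_alt M chr S = Cl_plus M chr (L_IF M chr S)"

definition L_minus_alt where
  "L_minus_alt M chr S = Cl_minus M chr (L_IP M chr S)"

definition L_alt where
  "L_alt M chr S1 S2 = Cl_plus M chr (L_IP M chr S1 \<inter> L_IF M chr S2)
                      \<union> Cl_minus M chr (L_IP M chr S1 \<inter> L_IF M chr S2)"

definition T_alt :: "'a set \<Rightarrow> ('a \<Rightarrow> 'a \<Rightarrow> bool) \<Rightarrow> ('a set \<times> 'a set) topology" where
  "T_alt M chr = topology_generated_by
     ({Mbar M chr - L_plus_alt M chr S | S. S \<subseteq> Mbar M chr}
      \<union> {Mbar M chr - L_minus_alt M chr S | S. S \<subseteq> Mbar M chr}
      \<union> {Mbar M chr - L_alt M chr S1 S2 | S1 S2. S1 \<subseteq> Mbar M chr \<and> S2 \<subseteq> Mbar M chr})"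

end

theory Submission
  imports Defs
begin

text \<open>
The point \<open>\<Phi>(x)\<close> lies in one of the generating closed sets only for trivial reasons: if
\<open>\<Phi>(x) \<in> Cl\<^sub>+(D)\<close> with \<open>D \<subseteq> L\<^sup>+\<^sub>I\<^sub>F(S)\<close>, then already \<open>\<Phi>(x) \<in> L\<^sup>+\<^sub>I\<^sub>F(S)\<close>, and dually. Hence if
\<open>\<Phi>(x\<^sub>n)\<close> meets a closed set infinitely often, a subsequence lies in \<open>L\<^sup>+\<^sub>I\<^sub>F\<close>, \<open>L\<^sup>-\<^sub>I\<^sub>P\<close> or their
intersection, and the operations \<open>Cl\<^sub>\<plusminus>\<close> were made to contain its limits.

The crux is therefore that if \<open>I\<^sup>-(x) = lim R\<^sub>n\<close> with \<open>R\<^sub>n\<close> paired with a nonempty \<open>R\<^sub>n\<^sup>*\<close>, then every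
\<open>y \<in> I\<^sup>+(x)\<close> lies in some \<open>R\<^sub>n\<^sup>*\<close>. If curves generating \<open>R\<^sub>n\<close> left a compact neighbourhood of \<open>x\<close> for
infinitely many \<open>n\<close>, their exit points would accumulate at some \<open>z \<noteq> x\<close> with \<open>I\<^sup>-(z) = I\<^sup>-(x)\<close>,
against strong causality. So \<open>R\<^sub>n = I\<^sup>-(w)\<close> with \<open>w\<close> near \<open>x\<close>, and the only partner of \<open>I\<^sup>-(w)\<close> is
\<open>I\<^sup>+(w)\<close>. The one fact needed from Lorentzian geometry is a local closedness of the chronological
relation: a limit of timelike curves between points of a small coordinate ball can be perturbed to
a timelike curve at the cost of moving its end points by a small timelike displacement.
\<close>

section \<open>Lorentzian cones and smooth functions\<close>

text \<open>Neither geodesics nor limit curves are used; the geometry rests on explicit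
  displacements in one chart. The obstacle is that an accumulation point \<open>z\<close> of exit
  points is only a limit of ends of timelike curves, and such a limit relation is causal rather than
  chronological. Displacing the curves by multiples of a fixed timelike vector restores strictness,
  and a displacement increasing along the curve at a rate proportional to its size keeps it
  timelike. The exit argument is used twice. For a limit I^-(x), the second clause of the limit
  gives I^-(z) \<subseteq> I^-(x). For the partner Q of I^-(w), the argument runs along a sequence
  descending through Q, and the maximality of I^-(w) in p(Q) takes over that role. Reversing the
  sign of \<open>T\<close> turns futures into pasts, so the geometric facts are proved in one time
  direction only.\<close>

lemma norm_matrix_vector_mult_le: "norm (A *v (x::real^'n)) \<le> norm (A::real^'n^'m) * norm x"
proof -
  have "norm (A *v x) = L2_set (\<lambda>i. norm (A $ i \<bullet> x)) UNIV"
    by (simp add: norm_vec_def matrix_mult_dot)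
  also have "\<dots> \<le> L2_set (\<lambda>i. norm x * norm (A $ i)) UNIV"
    by (rule L2_set_mono) (use Cauchy_Schwarz_ineq2[of "A $ i" x for i] in \<open>auto simp: mult.commute\<close>)
  also have "\<dots> = norm x * norm A"
    by (simp add: L2_set_right_distrib[symmetric] norm_vec_def)
  finally show ?thesis by (simp add: mult.commute)
qed

lemma bounded_bilinear_matrix_vector_mult: "bounded_bilinear ((*v) :: real^'n^'m \<Rightarrow> _)"
proof
  show "\<exists>K. \<forall>a b. norm ((a::real^'n^'m) *v b) \<le> norm a * norm b * K"
    by (intro exI[of _ 1]) (simp add: norm_matrix_vector_mult_le)
qed (auto simp: matrix_vector_mult_add_rdistrib matrix_vector_right_distrib scaleR_matrix_vector_assoc
        matrix_vector_mult_scaleR)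

lemmas continuous_on_matrix_vector_mult' [continuous_intros] =
  bounded_bilinear.continuous_on[OF bounded_bilinear_matrix_vector_mult]

lemma abs_inner_matrix_le: "\<bar>v \<bullet> (A *v w)\<bar> \<le> norm v * norm (A::real^'n^'n) * norm w"
proof -
  have "\<bar>v \<bullet> (A *v w)\<bar> \<le> norm v * norm (A *v w)" by (rule Cauchy_Schwarz_ineq2)
  also have "\<dots> \<le> norm v * (norm A * norm w)"
    by (intro mult_left_mono norm_matrix_vector_mult_le) auto
  finally show ?thesis by (simp add: mult.assoc)
qed

lemma symmetric_inner_matrix:
  assumes "transpose G = (G::real^'n^'n)" shows "v \<bullet> (G *v w) = w \<bullet> (G *v v)"
  by (metis assms dot_lmul_matrix inner_commute transpose_matrix_vector)

lemma inner_congruence: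
  "(J *v a) \<bullet> ((G::real^'n^'n) *v (J *v b)) = a \<bullet> ((transpose J ** G ** J) *v b)"
  by (simp only: matrix_vector_mul_assoc[symmetric] dot_lmul_matrix[symmetric] vector_transpose_matrix)

text \<open>The orthogonal complement of a timelike vector is spacelike. In a basis that
  diagonalises \<open>G\<close>, orthogonality equates the product of the time components with that
  of the space components, and Cauchy-Schwarz for the latter bounds the time component of
  \<open>v\<close>.\<close>

lemma lorentzian_orthogonal:
  fixes G :: "real^'n::finite^'n"
  assumes L: "lorentzian_matrix G" and e: "e \<bullet> (G *v e) < 0" and ve: "v \<bullet> (G *v e) = 0" and v: "v \<noteq> 0"
  shows "v \<bullet> (G *v v) > 0"
proof -
  obtain P :: "real^'n^'n" and i0 where P: "invertible P" and
    PG: "transpose P ** G ** P = (\<chi> i j. if i = j then (if i = i0 then -1 else 1) else 0)"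
    using L unfolding lorentzian_matrix_def by blast
  obtain Q where Q: "P ** Q = mat 1" using P unfolding invertible_def by blast
  have PQ: "P *v (Q *v u) = u" for u
    using Q by (simp add: matrix_vector_mul_assoc)
  have form: "(P *v a) \<bullet> (G *v (P *v b)) = - (a$i0 * b$i0) + (\<Sum>i\<in>UNIV-{i0}. a$i * b$i)" for a b
  proof -
    have "(P *v a) \<bullet> (G *v (P *v b)) = a \<bullet> ((transpose P ** G ** P) *v b)"
      by (rule inner_congruence)
    also have "((transpose P ** G ** P) *v b) = (\<chi> i. if i = i0 then - b$i else b$i)"
      unfolding PG by (simp add: matrix_vector_mult_def vec_eq_iff if_distrib[of "\<lambda>x. x * _"] cong: if_cong)
    also have "a \<bullet> \<dots> = (\<Sum>i\<in>UNIV. a$i * (if i = i0 then - b$i else b$i))"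
      by (simp add: inner_vec_def)
    also have "\<dots> = - (a$i0 * b$i0) + (\<Sum>i\<in>UNIV-{i0}. a$i * (if i = i0 then - b$i else b$i))"
      by (subst sum.remove[of _ i0]) auto
    finally show ?thesis by simp
  qed
  define a b where "a = Q *v v" and "b = Q *v e"
  define S where "S = UNIV - {i0}"
  define A B C where "A = (\<Sum>i\<in>S. a$i * a$i)" and "B = (\<Sum>i\<in>S. b$i * b$i)" and "C = (\<Sum>i\<in>S. a$i * b$i)"
  have fe: "e \<bullet> (G *v e) = - (b$i0)\<^sup>2 + B" using form[of b b] by (simp add: b_def PQ S_def B_def power2_eq_square)
  have fv: "v \<bullet> (G *v v) = - (a$i0)\<^sup>2 + A" using form[of a a] by (simp add: a_def PQ S_def A_def power2_eq_square)
  have fve: "v \<bullet> (G *v e) = - (a$i0 * b$i0) + C" using form[of a b] by (simp add: a_def b_def PQ S_def C_def)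
  have CS: "C\<^sup>2 \<le> A * B" unfolding A_def B_def C_def
    using Cauchy_Schwarz_ineq_sum[of "\<lambda>i. a$i" "\<lambda>i. b$i" S] by (simp add: power2_eq_square)
  have A0: "A \<ge> 0" and B0: "B \<ge> 0" unfolding A_def B_def by (auto intro: sum_nonneg)
  have b0: "(b$i0)\<^sup>2 > B" using e fe by simp
  \<comment> \<open>A positive spatial part makes the last estimate strict; \<open>A = 0\<close>
    would force the time component of \<open>v\<close> to vanish as well.\<close>
  have "A \<noteq> 0"
  proof
    assume "A = 0"
    then have z: "\<forall>i\<in>S. a$i = 0" unfolding A_def by (subst (asm) sum_nonneg_eq_0_iff) auto
    then have "C = 0" unfolding C_def by simp
    then have "a$i0 * b$i0 = 0" using fve ve by simp
    moreover have "b$i0 \<noteq> 0" using b0 B0 by auto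
    ultimately have "a$i0 = 0" by simp
    then have "a = 0" using z by (auto simp: vec_eq_iff S_def)
    then have "v = 0" using PQ[of v] by (simp add: a_def)
    then show False using v by simp
  qed
  then have A1: "A > 0" using A0 by simp
  have "(a$i0)\<^sup>2 * (b$i0)\<^sup>2 = C\<^sup>2" using fve ve by (simp add: power_mult_distrib[symmetric])
  also have "\<dots> \<le> A * B" by (rule CS)
  also have "\<dots> < A * (b$i0)\<^sup>2" using A1 b0 by simp
  finally have "(a$i0)\<^sup>2 < A" using b0 B0 by (simp add: mult_less_cancel_right) 
  then show ?thesis using fv by simp
qed

text \<open>By \<open>lorentzian_orthogonal\<close> the function \<open>h\<close> is positive on the
  unit sphere, and compactness gives a lower bound \<open>\<eta>\<close>. A unit vector that is not
  spacelike for a nearby metric has its first entry below \<open>\<eta>\<close>, so its product with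
  \<open>e\<close> is large in modulus, with the sign inherited from \<open>t1\<close>.
  \<open>G1\<close> and \<open>G2\<close> are independent because a velocity will be tested at a
  point other than the one where it is known to be timelike.\<close>

lemma lorentzian_cone_bound:
  fixes G :: "real^'n::finite^'n"
  assumes L: "lorentzian_matrix G" and e: "e \<bullet> (G *v e) < 0"
  obtains \<epsilon> \<kappa> where "\<epsilon> > 0" "\<kappa> > 0"
    "\<And>G1 t1 G2 t2 v. norm (G1 - G) < \<epsilon> \<Longrightarrow> norm (t1 - e) < \<epsilon> \<Longrightarrow> norm (G2 - G) < \<epsilon> \<Longrightarrow> norm (t2 - e) < \<epsilon> \<Longrightarrow>
       v \<bullet> (G1 *v v) \<le> 0 \<Longrightarrow> v \<bullet> (G1 *v t1) \<le> 0 \<Longrightarrow> v \<bullet> (G2 *v t2) \<le> - \<kappa> * norm v"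
proof -
  define h where "h v = max (v \<bullet> (G *v v)) \<bar>v \<bullet> (G *v e)\<bar>" for v
  have "continuous_on (sphere 0 1) h" unfolding h_def by (intro continuous_intros)
  moreover have "compact (sphere (0::real^'n) 1)" "sphere (0::real^'n) 1 \<noteq> {}" by auto
  ultimately obtain v0 where v0: "v0 \<in> sphere 0 1" "\<And>v. v \<in> sphere 0 1 \<Longrightarrow> h v0 \<le> h v"
    using continuous_attains_inf by metis
  define \<eta> where "\<eta> = h v0"
  have \<eta>: "\<eta> > 0"
  proof (cases "v0 \<bullet> (G *v e) = 0")
    case True
    have "v0 \<noteq> 0" using v0(1) by auto
    then show ?thesis using lorentzian_orthogonal[OF L e True] by (simp add: \<eta>_def h_def)
  next
    case False then show ?thesis by (simp add: \<eta>_def h_def less_max_iff_disj)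
  qed
  \<comment> \<open>For unit \<open>v\<close>, \<open>N\<close> bounds the rate of change of
    \<open>v \<bullet> (H *v t)\<close> for \<open>H\<close> and \<open>t\<close> near
    \<open>G\<close> and \<open>e\<close>, so \<open>\<epsilon>\<close> permits a change of at most
    \<open>\<eta> / 2\<close>.\<close>
  define N where "N = norm e + 1 + norm G"
  have N: "N \<ge> 1" by (simp add: N_def)
  define \<epsilon> where "\<epsilon> = min 1 (\<eta> / (2 * N))"
  have \<epsilon>: "\<epsilon> > 0" "\<epsilon> \<le> 1" "\<epsilon> * N \<le> \<eta> / 2"
  proof -
    show "\<epsilon> > 0" "\<epsilon> \<le> 1" using \<eta> N by (auto simp: \<epsilon>_def)
    have "\<epsilon> * N \<le> \<eta> / (2 * N) * N" using N by (intro mult_right_mono) (auto simp: \<epsilon>_def)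
    then show "\<epsilon> * N \<le> \<eta> / 2" using N by simp
  qed
  have \<epsilon>\<eta>: "\<epsilon> < \<eta>"
  proof -
    have "\<epsilon> * 1 \<le> \<epsilon> * N" using \<epsilon> N by (intro mult_left_mono) auto
    then show ?thesis using \<epsilon>(3) \<eta> by linarith
  qed
  have near: "\<bar>v \<bullet> (G *v e) - v \<bullet> (H *v t)\<bar> \<le> \<eta> / 2"
    if "norm v = 1" "norm (H - G) < \<epsilon>" "norm (t - e) < \<epsilon>" for v H t
  proof -
    have "v \<bullet> (H *v t) - v \<bullet> (G *v e) = v \<bullet> ((H - G) *v t) + v \<bullet> (G *v (t - e))"
      by (simp add: matrix_vector_mult_diff_rdistrib matrix_vector_mult_diff_distrib inner_diff_right)
    then have "\<bar>v \<bullet> (G *v e) - v \<bullet> (H *v t)\<bar> \<le> \<bar>v \<bullet> ((H - G) *v t)\<bar> + \<bar>v \<bullet> (G *v (t - e))\<bar>" by linarith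
    also have "\<dots> \<le> norm (H - G) * norm t + norm G * norm (t - e)"
      using abs_inner_matrix_le[of v "H - G" t] abs_inner_matrix_le[of v G "t - e"] that(1) by simp
    also have "\<dots> \<le> \<epsilon> * (norm e + 1) + norm G * \<epsilon>"
    proof (intro add_mono mult_mono)
      show "norm t \<le> norm e + 1" using that(3) \<epsilon>(2) norm_triangle_sub[of t e] by linarith
    qed (use that \<epsilon> in auto)
    also have "\<dots> = \<epsilon> * N" by (simp add: N_def algebra_simps)
    finally show ?thesis using \<epsilon>(3) by linarith
  qed
  have unit: "v \<bullet> (G2 *v t2) \<le> - (\<eta>/2)"
    if "norm (G1 - G) < \<epsilon>" "norm (t1 - e) < \<epsilon>" "norm (G2 - G) < \<epsilon>" "norm (t2 - e) < \<epsilon>"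
       "v \<bullet> (G1 *v v) \<le> 0" "v \<bullet> (G1 *v t1) \<le> 0" "norm v = 1" for G1 t1 G2 t2 v
  proof -
    have "v \<bullet> (G *v v) - v \<bullet> (G1 *v v) \<le> norm (G1 - G)"
      using abs_inner_matrix_le[of v "G1 - G" v] that(7)
      by (simp add: matrix_vector_mult_diff_rdistrib inner_diff_right abs_le_iff)
    then have "v \<bullet> (G *v v) < \<eta>" using that(1,5) \<epsilon>\<eta> by linarith
    moreover have "h v \<ge> \<eta>" using v0(2)[of v] that(7) by (simp add: \<eta>_def)
    ultimately have "\<bar>v \<bullet> (G *v e)\<bar> \<ge> \<eta>" by (auto simp: h_def)
    then show ?thesis using near[OF that(7,1,2)] near[OF that(7,3,4)] that(6) \<eta> by linarith
  qed
  show thesis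
  proof (rule that[OF \<epsilon>(1), of "\<eta>/2"])
    show "\<eta>/2 > 0" using \<eta> by simp
    fix G1 t1 G2 t2 and v :: "real^'n"
    assume *: "norm (G1 - G) < \<epsilon>" "norm (t1 - e) < \<epsilon>" "norm (G2 - G) < \<epsilon>" "norm (t2 - e) < \<epsilon>"
       "v \<bullet> (G1 *v v) \<le> 0" "v \<bullet> (G1 *v t1) \<le> 0"
    show "v \<bullet> (G2 *v t2) \<le> - (\<eta>/2) * norm v"
    proof (cases "v = 0")
      case False
      then have n: "norm v > 0" by simp
      define u where "u = v /\<^sub>R norm v"
      have v: "v = norm v *\<^sub>R u" using n by (simp add: u_def)
      have "norm u = 1" using n by (simp add: u_def)
      moreover have "u \<bullet> (G1 *v u) \<le> 0" "u \<bullet> (G1 *v t1) \<le> 0"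
        using *(5,6) n by (simp_all add: u_def matrix_vector_mult_scaleR mult_le_0_iff divide_le_0_iff zero_le_mult_iff)
      ultimately have "u \<bullet> (G2 *v t2) \<le> - (\<eta>/2)" using unit *(1-4) by blast
      then have "norm v * (u \<bullet> (G2 *v t2)) \<le> norm v * - (\<eta>/2)" using n by (intro mult_left_mono) auto
      then show ?thesis by (subst v) (simp add: mult.commute)
    qed simp
  qed
qed

lemma smooth_onD:
  assumes "smooth_on S f" "open S"
  shows "x \<in> S \<Longrightarrow> (f has_derivative frechet_derivative f (at x)) (at x)"
    "continuous_on S f" "continuous_on S (\<lambda>x. frechet_derivative f (at x) v)"
proof -
  have d: "f differentiable_on S" "\<And>v. smooth_on S (\<lambda>x. frechet_derivative f (at x) v)"
    using assms(1) by (auto elim: smooth_on.cases)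
  show "x \<in> S \<Longrightarrow> (f has_derivative frechet_derivative f (at x)) (at x)"
    using d(1) assms(2) by (metis at_within_open differentiable_on_def frechet_derivative_works)
  show "continuous_on S f" using d(1) differentiable_imp_continuous_on by blast
  have "(\<lambda>x. frechet_derivative f (at x) v) differentiable_on S"
    using d(2)[of v] by (auto elim: smooth_on.cases)
  then show "continuous_on S (\<lambda>x. frechet_derivative f (at x) v)"
    using differentiable_imp_continuous_on by blast
qed

lemma smooth_on_imp_lipschitz:
  fixes f :: "'a::euclidean_space \<Rightarrow> 'b::real_normed_vector"
  assumes f: "smooth_on S f" "open S" and S: "cball y r \<subseteq> S"
  obtains L where "L \<ge> 0" "\<And>u v. u \<in> cball y r \<Longrightarrow> v \<in> cball y r \<Longrightarrow> norm (f u - f v) \<le> L * norm (u - v)"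
proof -
  \<comment> \<open>\<open>smooth_on\<close> gives continuity of the derivative only direction by
    direction, so its operator norm is bounded through the values on a basis.\<close>
  define N where "N x = (\<Sum>b\<in>Basis. norm (frechet_derivative f (at x) b))" for x
  have "continuous_on (cball y r) N" unfolding N_def
    by (intro continuous_intros continuous_on_subset[OF smooth_onD(3)[OF f] S])
  then have "bounded (N ` cball y r)" by (intro compact_imp_bounded compact_continuous_image) auto
  then obtain L where L: "\<And>x. x \<in> cball y r \<Longrightarrow> norm (N x) \<le> L" "L > 0" unfolding bounded_pos by (auto simp del: mem_cball)
  have der: "(f has_derivative frechet_derivative f (at x)) (at x within cball y r)" if "x \<in> cball y r" for x
    using smooth_onD(1)[OF f] that S by (meson has_derivative_at_withinI subsetD)
  have on: "onorm (frechet_derivative f (at x)) \<le> L" if "x \<in> cball y r" for x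
  proof (rule onorm_bound)
    show "0 \<le> L" using L by simp
    fix v
    interpret bounded_linear "frechet_derivative f (at x)"
      using smooth_onD(1)[OF f] that S has_derivative_bounded_linear by blast
    have "norm (frechet_derivative f (at x) v) = norm (\<Sum>b\<in>Basis. (v \<bullet> b) *\<^sub>R frechet_derivative f (at x) b)"
      by (subst euclidean_representation[of v, symmetric]) (simp add: sum scale)
    also have "\<dots> \<le> (\<Sum>b\<in>Basis. \<bar>v \<bullet> b\<bar> * norm (frechet_derivative f (at x) b))"
      by (rule order_trans[OF norm_sum]) simp
    also have "\<dots> \<le> (\<Sum>b\<in>Basis. norm v * norm (frechet_derivative f (at x) b))"
      by (intro sum_mono mult_right_mono) (auto simp: Basis_le_norm)
    also have "\<dots> = norm v * N x" by (simp add: N_def sum_distrib_left)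
    also have "\<dots> \<le> norm v * L" using L(1)[OF that] by (intro mult_left_mono) auto
    finally show "norm (frechet_derivative f (at x) v) \<le> L * norm v" by (simp add: mult.commute)
  qed
  show thesis
    by (rule that[of L]) (use L differentiable_bound[OF convex_cball der on] in auto)
qed

section \<open>Piecewise smooth curves and time reversal\<close>

text \<open>The condition that \<open>pw_curve\<close> puts on one smooth piece, isolated so that
  pieces can be restricted, reparametrised and glued.\<close>

definition curve_piece ::
  "('a, 'n::finite) chart set \<Rightarrow> (('a, 'n) chart \<Rightarrow> real^'n \<Rightarrow> real^'n^'n)
     \<Rightarrow> (('a, 'n) chart \<Rightarrow> real^'n \<Rightarrow> real^'n)
     \<Rightarrow> (real^'n^'n \<Rightarrow> real^'n \<Rightarrow> real^'n \<Rightarrow> bool)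
     \<Rightarrow> (real \<Rightarrow> 'a) \<Rightarrow> real \<Rightarrow> real \<Rightarrow> bool" where
  "curve_piece A g T Q \<gamma> s s' \<longleftrightarrow>
     (\<forall>c\<in>A. \<exists>D. continuous_on {t\<in>{s..s'}. \<gamma> t \<in> fst c} D \<and>
              (\<forall>t\<in>{s..s'}. \<gamma> t \<in> fst c \<longrightarrow>
                 ((snd c \<circ> \<gamma>) has_vector_derivative D t) (at t within {s..s'}) \<and>
                 Q (g c (snd c (\<gamma> t))) (T c (snd c (\<gamma> t))) (D t)))"

text \<open>Covers restriction (\<open>\<sigma> = 1\<close>, \<open>h = 0\<close>), translation and
  reversal (\<open>\<sigma> = -1\<close>) at once; \<open>Q'\<close> and \<open>T'\<close> may
  differ from \<open>Q\<close> and \<open>T\<close> so that reversal can change the time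
  orientation.\<close>

lemma curve_piece_affine:
  assumes p: "curve_piece A g T Q \<gamma> s s'"
    and Q: "\<And>c y v. Q (g c y) (T c y) v \<Longrightarrow> Q' (g c y) (T' c y) (\<sigma> *\<^sub>R v)"
    and sub: "\<And>t. t \<in> {u..u'} \<Longrightarrow> \<sigma> * t + h \<in> {s..s'}"
  shows "curve_piece A g T' Q' (\<lambda>t. \<gamma> (\<sigma> * t + h)) u u'"
  unfolding curve_piece_def
proof
  fix c assume "c \<in> A"
  then obtain D where D: "continuous_on {t\<in>{s..s'}. \<gamma> t \<in> fst c} D"
    "\<And>t. t\<in>{s..s'} \<Longrightarrow> \<gamma> t \<in> fst c \<Longrightarrow> ((snd c \<circ> \<gamma>) has_vector_derivative D t) (at t within {s..s'}) \<and>
                 Q (g c (snd c (\<gamma> t))) (T c (snd c (\<gamma> t))) (D t)"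
    using p unfolding curve_piece_def by blast
  let ?r = "\<lambda>t. \<sigma> * t + h"
  show "\<exists>D. continuous_on {t \<in> {u..u'}. \<gamma> (?r t) \<in> fst c} D \<and>
              (\<forall>t\<in>{u..u'}. \<gamma> (?r t) \<in> fst c \<longrightarrow>
                   (snd c \<circ> (\<lambda>t. \<gamma> (?r t)) has_vector_derivative D t) (at t within {u..u'}) \<and>
                   Q' (g c (snd c (\<gamma> (?r t)))) (T' c (snd c (\<gamma> (?r t)))) (D t))"
  proof (intro exI[of _ "\<lambda>t. \<sigma> *\<^sub>R D (?r t)"] conjI ballI impI)
    show "continuous_on {t \<in> {u..u'}. \<gamma> (?r t) \<in> fst c} (\<lambda>t. \<sigma> *\<^sub>R D (?r t))"
      by (intro continuous_intros continuous_on_compose2[OF D(1)]) (use sub in auto)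
    fix t assume t: "t \<in> {u..u'}" "\<gamma> (?r t) \<in> fst c"
    have 1: "(?r has_vector_derivative \<sigma>) (at t within {u..u'})"
      by (auto intro!: derivative_eq_intros simp: has_real_derivative_iff_has_vector_derivative[symmetric])
    have 2: "((snd c \<circ> \<gamma>) has_vector_derivative D (?r t)) (at (?r t) within ?r ` {u..u'})"
      by (rule has_vector_derivative_within_subset[of _ _ _ "{s..s'}"]) (use D(2) sub t in auto)
    show "(snd c \<circ> (\<lambda>t. \<gamma> (?r t)) has_vector_derivative \<sigma> *\<^sub>R D (?r t)) (at t within {u..u'})"
      using vector_diff_chain_within[OF 1 2] by (simp add: o_def)
    show "Q' (g c (snd c (\<gamma> (?r t)))) (T' c (snd c (\<gamma> (?r t)))) (\<sigma> *\<^sub>R D (?r t))"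
      using D(2) sub t Q by blast
  qed
qed

lemma curve_piece_subset:
  "curve_piece A g T Q \<gamma> s s' \<Longrightarrow> s \<le> u \<Longrightarrow> u' \<le> s' \<Longrightarrow> curve_piece A g T Q \<gamma> u u'"
  using curve_piece_affine[of A g T Q \<gamma> s s' Q T 1 u u' 0] by auto

lemma curve_piece_cong:
  assumes "curve_piece A g T Q \<gamma> s s'" "\<And>t. t \<in> {s..s'} \<Longrightarrow> \<gamma> t = \<gamma>' t"
  shows "curve_piece A g T Q \<gamma>' s s'"
  unfolding curve_piece_def
proof
  fix c assume "c \<in> A"
  then obtain D where D: "continuous_on {t\<in>{s..s'}. \<gamma> t \<in> fst c} D"
    "\<And>t. t\<in>{s..s'} \<Longrightarrow> \<gamma> t \<in> fst c \<Longrightarrow> ((snd c \<circ> \<gamma>) has_vector_derivative D t) (at t within {s..s'}) \<and>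
                 Q (g c (snd c (\<gamma> t))) (T c (snd c (\<gamma> t))) (D t)"
    using assms(1) unfolding curve_piece_def by blast
  show "\<exists>D. continuous_on {t\<in>{s..s'}. \<gamma>' t \<in> fst c} D \<and>
              (\<forall>t\<in>{s..s'}. \<gamma>' t \<in> fst c \<longrightarrow>
                 ((snd c \<circ> \<gamma>') has_vector_derivative D t) (at t within {s..s'}) \<and>
                 Q (g c (snd c (\<gamma>' t))) (T c (snd c (\<gamma>' t))) (D t))"
  proof (intro exI[of _ D] conjI ballI impI)
    have "{t \<in> {s..s'}. \<gamma>' t \<in> fst c} = {t \<in> {s..s'}. \<gamma> t \<in> fst c}" using assms(2) by auto
    then show "continuous_on {t \<in> {s..s'}. \<gamma>' t \<in> fst c} D" using D(1) by simp
    fix t assume t: "t \<in> {s..s'}" "\<gamma>' t \<in> fst c"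
    then show "(snd c \<circ> \<gamma>' has_vector_derivative D t) (at t within {s..s'})"
      using D(2)[of t] assms(2)
      by (auto intro!: has_vector_derivative_transform[of t "{s..s'}" "snd c \<circ> \<gamma>'" "snd c \<circ> \<gamma>" "D t"])
    show "Q (g c (snd c (\<gamma>' t))) (T c (snd c (\<gamma>' t))) (D t)"
      using D(2)[of t] assms(2)[of t] t by auto
  qed
qed

lemma pw_curve_curve_piece:
  "pw_curve X A g T Q \<gamma> a b \<longleftrightarrow> a < b \<and> continuous_map (top_of_set {a..b}) X \<gamma> \<and>
     (\<exists>K. finite K \<and> a \<in> K \<and> b \<in> K \<and> K \<subseteq> {a..b} \<and>
        (\<forall>s\<in>K. \<forall>s'\<in>K. s < s' \<and> {s<..<s'} \<inter> K = {} \<longrightarrow> curve_piece A g T Q \<gamma> s s'))"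
  unfolding pw_curve_def curve_piece_def ..

text \<open>The definition looks at adjacent points of a break set that contains the end points.
  Here every subinterval without a break in its interior is a piece, a condition that passes to
  subintervals and to larger break sets and so suits restriction and concatenation.\<close>

lemma pw_curve_iff:
  "pw_curve X A g T Q \<gamma> a b \<longleftrightarrow> a < b \<and> continuous_map (top_of_set {a..b}) X \<gamma> \<and>
     (\<exists>K. finite K \<and> (\<forall>u u'. a \<le> u \<and> u < u' \<and> u' \<le> b \<and> {u<..<u'} \<inter> K = {} \<longrightarrow> curve_piece A g T Q \<gamma> u u'))"
  (is "?L \<longleftrightarrow> ?R")
proof
  assume L: ?L
  then obtain K where K: "finite K" "a \<in> K" "b \<in> K" "K \<subseteq> {a..b}"
    "\<forall>s\<in>K. \<forall>s'\<in>K. s < s' \<and> {s<..<s'} \<inter> K = {} \<longrightarrow> curve_piece A g T Q \<gamma> s s'"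
    unfolding pw_curve_curve_piece by (elim conjE exE) (rule that)
  have "curve_piece A g T Q \<gamma> u u'" if u: "a \<le> u" "u < u'" "u' \<le> b" "{u<..<u'} \<inter> K = {}" for u u'
  proof -
    \<comment> \<open>The last break up to \<open>u\<close> and the first one from \<open>u'\<close>
      on are adjacent in \<open>K\<close>, since no break lies strictly between \<open>u\<close> and
      \<open>u'\<close>.\<close>
    define s where "s = Max (K \<inter> {..u})"
    define s' where "s' = Min (K \<inter> {u'..})"
    have ne: "K \<inter> {..u} \<noteq> {}" "K \<inter> {u'..} \<noteq> {}" using K(2,3) u by auto
    have s: "s \<in> K \<inter> {..u}" unfolding s_def using ne(1) K(1) by (intro Max_in) auto
    have s': "s' \<in> K \<inter> {u'..}" unfolding s'_def using ne(2) K(1) by (intro Min_in) auto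
    have mx: "x \<le> s" if "x \<in> K \<inter> {..u}" for x unfolding s_def using that K(1) by (intro Max_ge) auto
    have mn: "s' \<le> x" if "x \<in> K \<inter> {u'..}" for x unfolding s'_def using that K(1) by (intro Min_le) auto
    have "{s<..<s'} \<inter> K = {}"
    proof (rule ccontr)
      assume "{s<..<s'} \<inter> K \<noteq> {}"
      then obtain x where x: "x \<in> K" "s < x" "x < s'" by auto
      then have "\<not> x \<le> u" "\<not> u' \<le> x" using mx[of x] mn[of x] by auto
      then have "x \<in> {u<..<u'} \<inter> K" using x(1) by simp
      then show False using u(4) by simp
    qed
    then have "curve_piece A g T Q \<gamma> s s'" using s s' u by (intro K(5)[rule_format]) auto
    then show ?thesis by (rule curve_piece_subset) (use s s' in auto)
  qed
  moreover have "a < b" "continuous_map (top_of_set {a..b}) X \<gamma>" using L by (simp_all add: pw_curve_def)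
  ultimately show ?R using K(1) by blast
next
  assume R: ?R
  then have ab: "a < b" "continuous_map (top_of_set {a..b}) X \<gamma>" by simp_all
  from R obtain K where K: "finite K"
    "\<forall>u u'. a \<le> u \<and> u < u' \<and> u' \<le> b \<and> {u<..<u'} \<inter> K = {} \<longrightarrow> curve_piece A g T Q \<gamma> u u'"
    by (elim conjE exE) (rule that)
  show ?L unfolding pw_curve_curve_piece
  proof (intro conjI exI[of _ "(K \<inter> {a..b}) \<union> {a,b}"] ballI impI)
    fix s s' assume s: "s \<in> K \<inter> {a..b} \<union> {a, b}" "s' \<in> K \<inter> {a..b} \<union> {a, b}"
      "s < s' \<and> {s<..<s'} \<inter> (K \<inter> {a..b} \<union> {a, b}) = {}"
    then show "curve_piece A g T Q \<gamma> s s'" using ab(1) by (intro K(2)[rule_format]) auto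
  qed (use ab K(1) in auto)
qed

lemma pw_curveE:
  assumes "pw_curve X A g T Q \<gamma> a b"
  obtains K where "finite K"
    "\<And>u u'. a \<le> u \<Longrightarrow> u < u' \<Longrightarrow> u' \<le> b \<Longrightarrow> {u<..<u'} \<inter> K = {} \<Longrightarrow> curve_piece A g T Q \<gamma> u u'"
proof -
  obtain K where K: "finite K"
    "\<forall>u u'. a \<le> u \<and> u < u' \<and> u' \<le> b \<and> {u<..<u'} \<inter> K = {} \<longrightarrow> curve_piece A g T Q \<gamma> u u'"
    using assms unfolding pw_curve_iff by (elim conjE exE) (rule that)
  show thesis by (rule that[OF K(1)], rule K(2)[rule_format]) simp
qed

lemma pw_curve_less: "pw_curve X A g T Q \<gamma> a b \<Longrightarrow> a < b"
  and pw_curve_continuous: "pw_curve X A g T Q \<gamma> a b \<Longrightarrow> continuous_map (top_of_set {a..b}) X \<gamma>"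
  by (simp_all add: pw_curve_def)

lemma pw_curve_restrict:
  assumes "pw_curve X A g T Q \<gamma> a b" "a \<le> s" "s < s'" "s' \<le> b"
  shows "pw_curve X A g T Q \<gamma> s s'"
  unfolding pw_curve_iff
proof (intro conjI)
  show "continuous_map (top_of_set {s..s'}) X \<gamma>"
    by (rule continuous_map_from_subtopology_mono[OF pw_curve_continuous[OF assms(1)]]) (use assms in auto)
  obtain K where K: "finite K"
    "\<And>u u'. a \<le> u \<Longrightarrow> u < u' \<Longrightarrow> u' \<le> b \<Longrightarrow> {u<..<u'} \<inter> K = {} \<Longrightarrow> curve_piece A g T Q \<gamma> u u'"
    using assms(1) by (rule pw_curveE) (rule that)
  show "\<exists>K. finite K \<and> (\<forall>u u'. s \<le> u \<and> u < u' \<and> u' \<le> s' \<and> {u<..<u'} \<inter> K = {} \<longrightarrow> curve_piece A g T Q \<gamma> u u')"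
    by (intro exI[of _ K] conjI allI impI K) (use assms in auto)
qed (use assms in auto)

lemma pw_curve_affine:
  assumes p: "pw_curve X A g T Q \<gamma> a b"
    and Q: "\<And>c y v. Q (g c y) (T c y) v \<Longrightarrow> Q' (g c y) (T' c y) (\<sigma> *\<^sub>R v)"
    and \<sigma>: "\<sigma> = 1 \<and> a' + h = a \<and> b' + h = b \<or> \<sigma> = -1 \<and> h - a' = b \<and> h - b' = a"
  shows "pw_curve X A g T' Q' (\<lambda>t. \<gamma> (\<sigma> * t + h)) a' b'"
  unfolding pw_curve_iff
proof (intro conjI)
  obtain K where K: "finite K"
    "\<And>u u'. a \<le> u \<Longrightarrow> u < u' \<Longrightarrow> u' \<le> b \<Longrightarrow> {u<..<u'} \<inter> K = {} \<Longrightarrow> curve_piece A g T Q \<gamma> u u'"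
    using p by (rule pw_curveE) (rule that)
  have ab: "a < b" and c: "continuous_map (top_of_set {a..b}) X \<gamma>" by (rule pw_curve_less[OF p], rule pw_curve_continuous[OF p])
  show "a' < b'" using \<sigma> ab by auto
  have "continuous_map (top_of_set {a'..b'}) (top_of_set {a..b}) (\<lambda>t. \<sigma> * t + h)"
    unfolding continuous_map_subtopology_eu using \<sigma> by (elim disjE) (auto intro!: continuous_intros)
  from continuous_map_compose[OF this c]
  show "continuous_map (top_of_set {a'..b'}) X (\<lambda>t. \<gamma> (\<sigma> * t + h))" unfolding o_def .
  show "\<exists>K. finite K \<and> (\<forall>u u'. a' \<le> u \<and> u < u' \<and> u' \<le> b' \<and> {u<..<u'} \<inter> K = {} \<longrightarrow>
          curve_piece A g T' Q' (\<lambda>t. \<gamma> (\<sigma> * t + h)) u u')"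
  \<comment> \<open>As \<open>\<sigma> * \<sigma> = 1\<close>, this image is the preimage of
    \<open>K\<close> under the reparametrisation.\<close>
  proof (intro exI[of _ "(\<lambda>t. \<sigma> * (t - h)) ` K"] conjI allI impI)
    fix u u' assume u: "a' \<le> u \<and> u < u' \<and> u' \<le> b' \<and> {u<..<u'} \<inter> (\<lambda>t. \<sigma> * (t - h)) ` K = {}"
    have nK: "\<sigma> * (k - h) \<notin> {u<..<u'}" if "k \<in> K" for k using u that by blast
    show "curve_piece A g T' Q' (\<lambda>t. \<gamma> (\<sigma> * t + h)) u u'"
    proof (cases "\<sigma> = 1")
      case True
      have "curve_piece A g T Q \<gamma> (u + h) (u' + h)"
      proof (rule K(2))
        show "{u + h<..<u' + h} \<inter> K = {}"
        proof (intro equals0I)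
          fix k assume "k \<in> {u + h<..<u' + h} \<inter> K"
          then show False using nK[of k] True by simp
        qed
      qed (use u \<sigma> True in linarith)+
      then show ?thesis by (rule curve_piece_affine[of A g T Q \<gamma> _ _ Q' T' \<sigma>, OF _ Q]) (use True in auto)
    next
      case False
      then have s: "\<sigma> = -1" using \<sigma> by auto
      have "curve_piece A g T Q \<gamma> (h - u') (h - u)"
      proof (rule K(2))
        show "{h - u'<..<h - u} \<inter> K = {}"
        proof (intro equals0I)
          fix k assume "k \<in> {h - u'<..<h - u} \<inter> K"
          then show False using nK[of k] s by simp
        qed
      qed (use u \<sigma> s in linarith)+
      then show ?thesis by (rule curve_piece_affine[of A g T Q \<gamma> _ _ Q' T' \<sigma>, OF _ Q]) (use s in auto)
    qed
  qed (use K(1) in auto)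
qed

lemma pw_curve_concat:
  assumes p: "pw_curve X A g T Q \<gamma> a b" and q: "pw_curve X A g T Q \<delta> b c" and eq: "\<gamma> b = \<delta> b"
  shows "pw_curve X A g T Q (\<lambda>t. if t \<le> b then \<gamma> t else \<delta> t) a c"
  unfolding pw_curve_iff
proof (intro conjI)
  let ?f = "\<lambda>t. if t \<le> b then \<gamma> t else \<delta> t"
  obtain K where K: "finite K"
    "\<And>u u'. a \<le> u \<Longrightarrow> u < u' \<Longrightarrow> u' \<le> b \<Longrightarrow> {u<..<u'} \<inter> K = {} \<Longrightarrow> curve_piece A g T Q \<gamma> u u'"
    using p by (rule pw_curveE) (rule that)
  obtain K' where K': "finite K'"
    "\<And>u u'. b \<le> u \<Longrightarrow> u < u' \<Longrightarrow> u' \<le> c \<Longrightarrow> {u<..<u'} \<inter> K' = {} \<Longrightarrow> curve_piece A g T Q \<delta> u u'"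
    using q by (rule pw_curveE) (rule that)
  have ab: "a < b" and c1: "continuous_map (top_of_set {a..b}) X \<gamma>" by (rule pw_curve_less[OF p], rule pw_curve_continuous[OF p])
  have bc: "b < c" and c2: "continuous_map (top_of_set {b..c}) X \<delta>" by (rule pw_curve_less[OF q], rule pw_curve_continuous[OF q])
  show "a < c" using ab bc by simp
  show "continuous_map (top_of_set {a..c}) X ?f"
  proof (rule continuous_map_cases_le)
    have e1: "{a..c} \<inter> {x \<in> topspace (top_of_set {a..c}). x \<le> b} = {a..b}"
      "{a..c} \<inter> {x \<in> topspace (top_of_set {a..c}). b \<le> x} = {b..c}" using ab bc by auto
    show "continuous_map (subtopology (top_of_set {a..c}) {x \<in> topspace (top_of_set {a..c}). x \<le> b}) X \<gamma>"
      unfolding subtopology_subtopology e1 by (rule c1)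
    show "continuous_map (subtopology (top_of_set {a..c}) {x \<in> topspace (top_of_set {a..c}). b \<le> x}) X \<delta>"
      unfolding subtopology_subtopology e1 by (rule c2)
  qed (use eq in \<open>auto\<close>)
  show "\<exists>K. finite K \<and> (\<forall>u u'. a \<le> u \<and> u < u' \<and> u' \<le> c \<and> {u<..<u'} \<inter> K = {} \<longrightarrow> curve_piece A g T Q ?f u u')"
  proof (intro exI[of _ "K \<union> K' \<union> {b}"] conjI allI impI)
    fix u u' assume u: "a \<le> u \<and> u < u' \<and> u' \<le> c \<and> {u<..<u'} \<inter> (K \<union> K' \<union> {b}) = {}"
    then have "b \<notin> {u<..<u'}" by blast
    then consider "u' \<le> b" | "b \<le> u" by fastforce
    then show "curve_piece A g T Q ?f u u'"
    proof cases
      case 1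
      then have "curve_piece A g T Q \<gamma> u u'" using u by (intro K(2)) (simp_all, blast)
      then show ?thesis by (rule curve_piece_cong) (use 1 in auto)
    next
      case 2
      then have "curve_piece A g T Q \<delta> u u'" using u by (intro K'(2)) (simp_all, blast)
      then show ?thesis by (rule curve_piece_cong) (metis 2 eq atLeastAtMost_iff order.antisym order.trans)
    qed
  qed (use K(1) K'(1) in auto)
qed

lemma pw_curve_in_topspace:
  "pw_curve X A g T Q \<gamma> a b \<Longrightarrow> t \<in> {a..b} \<Longrightarrow> \<gamma> t \<in> topspace X"
  using pw_curve_continuous[of X A g T Q \<gamma> a b] by (auto simp: continuous_map_def)

lemma chron_concat:
  assumes "chron X A g T p q" "chron X A g T q r"
  obtains \<gamma> a b t where "pw_curve X A g T future_timelike_vec \<gamma> a b" "t \<in> {a..b}"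
    "\<gamma> a = p" "\<gamma> t = q" "\<gamma> b = r"
proof -
  obtain \<gamma> a b where 1: "pw_curve X A g T future_timelike_vec \<gamma> a b" "\<gamma> a = p" "\<gamma> b = q"
    using assms(1) unfolding chron_def by blast
  obtain \<delta> c d where 2: "pw_curve X A g T future_timelike_vec \<delta> c d" "\<delta> c = q" "\<delta> d = r"
    using assms(2) unfolding chron_def by blast
  have 3: "pw_curve X A g T future_timelike_vec (\<lambda>t. \<delta> (1 * t + (c - b))) b (d - c + b)"
    by (rule pw_curve_affine[OF 2(1)]) auto
  have 4: "pw_curve X A g T future_timelike_vec (\<lambda>t. if t \<le> b then \<gamma> t else \<delta> (1 * t + (c - b))) a (d - c + b)"
    by (rule pw_curve_concat[OF 1(1) 3]) (use 1 2 in simp)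
  have "a < b" "c < d" using 1 2 by (auto dest: pw_curve_less)
  then show thesis
    by (intro that[OF 4, of b]) (use 1 2 in simp_all)
qed

lemma chron_trans: "chron X A g T p q \<Longrightarrow> chron X A g T q r \<Longrightarrow> chron X A g T p r"
  by (erule chron_concat, assumption) (unfold chron_def, blast)

lemma chron_in_topspace: "chron X A g T p q \<Longrightarrow> p \<in> topspace X \<and> q \<in> topspace X"
  unfolding chron_def by (fastforce dest: pw_curve_less intro: pw_curve_in_topspace)

lemma pw_curve_imp_chron:
  assumes "pw_curve X A g T future_timelike_vec \<gamma> a b" "a \<le> s" "s < t" "t \<le> b"
  shows "chron X A g T (\<gamma> s) (\<gamma> t)"
  using pw_curve_restrict[OF assms] unfolding chron_def by blast

section \<open>Reversal of the time orientation\<close>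

lemma pw_curve_time_reversal:
  assumes Q: "\<And>G t v. Q G (- t) (- v) \<longleftrightarrow> Q G t v"
  shows "pw_curve X A g (\<lambda>c y. - T c y) Q \<gamma> a b \<longleftrightarrow> pw_curve X A g T Q (\<lambda>t. \<gamma> (- t)) (- b) (- a)"
proof
  assume *: "pw_curve X A g (\<lambda>c y. - T c y) Q \<gamma> a b"
  have "pw_curve X A g T Q (\<lambda>t. \<gamma> (-1 * t + 0)) (- b) (- a)"
  proof (rule pw_curve_affine[OF *])
    fix c y v assume "Q (g c y) (- T c y) v"
    then show "Q (g c y) (T c y) (-1 *\<^sub>R v)" using Q[of "g c y" "T c y" "- v"] by simp
  qed simp
  then show "pw_curve X A g T Q (\<lambda>t. \<gamma> (- t)) (- b) (- a)" by simp
next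
  assume *: "pw_curve X A g T Q (\<lambda>t. \<gamma> (- t)) (- b) (- a)"
  have "pw_curve X A g (\<lambda>c y. - T c y) Q (\<lambda>t. \<gamma> (- (-1 * t + 0))) a b"
  proof (rule pw_curve_affine[OF *])
    fix c y v assume "Q (g c y) (T c y) v"
    then show "Q (g c y) (- T c y) (-1 *\<^sub>R v)" using Q[of "g c y" "T c y" "v"] by simp
  qed simp
  then show "pw_curve X A g (\<lambda>c y. - T c y) Q \<gamma> a b" by simp
qed

lemma future_timelike_vec_reversal: "future_timelike_vec G (- t) (- v) \<longleftrightarrow> future_timelike_vec G t v"
  and future_causal_vec_reversal: "future_causal_vec G (- t) (- v) \<longleftrightarrow> future_causal_vec G t v"
proof -
  have "G *v (- u) = - (G *v u)" for u
    using matrix_vector_mult_scaleR[of G "-1" u] by simp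
  then show "future_timelike_vec G (- t) (- v) \<longleftrightarrow> future_timelike_vec G t v"
    "future_causal_vec G (- t) (- v) \<longleftrightarrow> future_causal_vec G t v"
    by (simp_all add: future_timelike_vec_def future_causal_vec_def)
qed

lemma chron_time_reversal: "chron X A g (\<lambda>c y. - T c y) p q \<longleftrightarrow> chron X A g T q p"
proof -
  note r = pw_curve_time_reversal[of future_timelike_vec, OF future_timelike_vec_reversal]
  show ?thesis
  proof
    assume "chron X A g (\<lambda>c y. - T c y) p q"
    then obtain \<gamma> a b where \<gamma>: "pw_curve X A g (\<lambda>c y. - T c y) future_timelike_vec \<gamma> a b" "\<gamma> a = p" "\<gamma> b = q"
      unfolding chron_def by blast
    show "chron X A g T q p"
      unfolding chron_def
      by (rule exI[of _ "\<lambda>t. \<gamma> (- t)"], rule exI[of _ "- b"], rule exI[of _ "- a"]) (use iffD1[OF r \<gamma>(1)] \<gamma>(2,3) in simp)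
  next
    assume "chron X A g T q p"
    then obtain \<gamma> a b where \<gamma>: "pw_curve X A g T future_timelike_vec \<gamma> a b" "\<gamma> a = q" "\<gamma> b = p"
      unfolding chron_def by blast
    show "chron X A g (\<lambda>c y. - T c y) p q"
      unfolding chron_def
      by (rule exI[of _ "\<lambda>t. \<gamma> (- t)"], rule exI[of _ "- b"], rule exI[of _ "- a"])
        (use iffD2[OF r, of X A g T "\<lambda>t. \<gamma> (- t)" "- a" "- b"] \<gamma> in simp)
  qed
qed

lemma spacetime_time_reversal:
  assumes "spacetime X A g T" shows "spacetime X A g (\<lambda>c y. - T c y)"
proof -
  have m: "(G::real^'b^'b) *v (- u) = - (G *v u)" for G u
    using matrix_vector_mult_scaleR[of G "-1" u] by simp
  note a = assms[unfolded spacetime_def]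
  note b = a[THEN conjunct2, THEN conjunct2, THEN conjunct1, THEN bspec]
  note c = a[THEN conjunct2, THEN conjunct2, THEN conjunct2, THEN bspec, THEN bspec, THEN bspec]
  show ?thesis unfolding spacetime_def
  proof (intro conjI ballI)
    fix c x assume cx: "c \<in> A" "x \<in> snd c ` fst c"
    show "(- T c x) \<bullet> (g c x *v (- T c x)) < 0"
      using b[OF cx(1), THEN conjunct2, THEN conjunct2, THEN conjunct2, THEN bspec, OF cx(2)] by (simp add: m)
    show "lorentzian_matrix (g c x)"
      by (rule b[OF cx(1), THEN conjunct2, THEN conjunct1, THEN bspec, OF cx(2)])
  next
    fix c assume "c \<in> A"
    note d = b[OF this]
    show "smooth_on (snd c ` fst c) (g c)" by (rule d[THEN conjunct1])
    show "continuous_on (snd c ` fst c) (\<lambda>x. - T c x)"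
      by (rule continuous_on_minus[OF d[THEN conjunct2, THEN conjunct2, THEN conjunct1]])
  next
    fix c d p assume cd: "c \<in> A" "d \<in> A" "p \<in> fst c \<inter> fst d"
    show "g d (snd d p) = transpose (trans_jac c d p) ** g c (snd c p) ** trans_jac c d p"
      by (rule c[OF cd, THEN conjunct1])
    show "- T c (snd c p) = trans_jac c d p *v - T d (snd d p)"
      unfolding m by (rule arg_cong[OF c[OF cd, THEN conjunct2]])
  qed (rule a[THEN conjunct1] a[THEN conjunct2, THEN conjunct1])+
qed

lemma strongly_causal_spacetime_time_reversal:
  assumes "strongly_causal_spacetime X A g T" shows "strongly_causal_spacetime X A g (\<lambda>c y. - T c y)"
  unfolding strongly_causal_spacetime_def
proof (intro conjI ballI allI impI)
  show "spacetime X A g (\<lambda>c y. - T c y)"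
    using assms spacetime_time_reversal unfolding strongly_causal_spacetime_def by blast
  fix p U assume pU: "p \<in> topspace X" "openin X U \<and> p \<in> U"
  from assms[unfolded strongly_causal_spacetime_def, THEN conjunct2, THEN bspec, THEN spec, THEN mp, OF pU]
  obtain V where V: "openin X V" "p \<in> V" "V \<subseteq> U"
    "\<forall>\<gamma> a b. pw_curve X A g T future_causal_vec \<gamma> a b \<longrightarrow> connected {t\<in>{a..b}. \<gamma> t \<in> V}"
    by (elim conjE exE) (rule that)
  have "connected {t\<in>{a..b}. \<gamma> t \<in> V}"
    if "pw_curve X A g (\<lambda>c y. - T c y) future_causal_vec \<gamma> a b" for \<gamma> a b
  proof -
    have "connected {t\<in>{-b..-a}. \<gamma> (- t) \<in> V}"
      using V(4)[rule_format, OF iffD1[OF pw_curve_time_reversal[of future_causal_vec, OF future_causal_vec_reversal] that]] .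
    then have "connected (uminus ` {t\<in>{-b..-a}. \<gamma> (- t) \<in> V})"
      by (intro connected_continuous_image continuous_intros)
    moreover have "uminus ` {t\<in>{-b..-a}. \<gamma> (- t) \<in> V} = {t\<in>{a..b}. \<gamma> t \<in> V}"
    proof (intro equalityI subsetI)
      fix t assume "t \<in> {t\<in>{a..b}. \<gamma> t \<in> V}"
      then show "t \<in> uminus ` {t\<in>{-b..-a}. \<gamma> (- t) \<in> V}" by (intro image_eqI[of _ _ "-t"]) auto
    qed auto
    ultimately show ?thesis by simp
  qed
  then show "\<exists>V. openin X V \<and> p \<in> V \<and> V \<subseteq> U \<and>
           (\<forall>\<gamma> a b. pw_curve X A g (\<lambda>c y. - T c y) future_causal_vec \<gamma> a b \<longrightarrow>
              connected {t\<in>{a..b}. \<gamma> t \<in> V})"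
    using V(1-3) by (intro exI[of _ V] conjI allI impI)
qed

section \<open>Curves in a coordinate chart\<close>

locale spacetime_chart =
  fixes X :: "'a topology" and A :: "('a, 'n::finite) chart set"
    and g :: "('a, 'n) chart \<Rightarrow> real^'n \<Rightarrow> real^'n^'n"
    and T :: "('a, 'n) chart \<Rightarrow> real^'n \<Rightarrow> real^'n"
    and c :: "('a, 'n) chart"
  assumes spacetime: "spacetime X A g T" and chart: "c \<in> A"
begin

definition dom where "dom = fst c"
definition phi where "phi = snd c"
definition psi where "psi = inv_into (fst c) (snd c)"
definition img where "img = snd c ` fst c"

lemma manifold: "smooth_manifold X A"
  using spacetime unfolding spacetime_def by (elim conjE)

lemma manifold_chart:
  assumes "d \<in> A"
  shows "openin X (fst d)" "open (snd d ` fst d)"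
    "homeomorphic_map (subtopology X (fst d)) (top_of_set (snd d ` fst d)) (snd d)"
proof -
  have "\<forall>(U,\<phi>)\<in>A. openin X U \<and> open (\<phi> ` U) \<and> homeomorphic_map (subtopology X U) (top_of_set (\<phi> ` U)) \<phi>"
    using manifold unfolding smooth_manifold_def by (elim conjE)
  from bspec[OF this assms]
  show "openin X (fst d)" "open (snd d ` fst d)"
    "homeomorphic_map (subtopology X (fst d)) (top_of_set (snd d ` fst d)) (snd d)"
    unfolding case_prod_beta by blast+
qed

lemma openin_dom: "openin X dom" and open_img: "open img"
  and homeo: "homeomorphic_map (subtopology X dom) (top_of_set img) phi"
  using manifold_chart[OF chart] unfolding dom_def phi_def img_def .

lemma dom_subset: "dom \<subseteq> topspace X" using openin_dom openin_subset by blast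

lemma inj_phi: "inj_on phi dom"
  using homeo dom_subset by (simp add: homeomorphic_imp_injective_map[OF homeo] homeomorphic_eq_everything_map Int_absorb1)

lemma psi_phi: "p \<in> dom \<Longrightarrow> psi (phi p) = p"
  using inj_phi by (simp add: psi_def phi_def dom_def)

lemma phi_psi: "y \<in> img \<Longrightarrow> phi (psi y) = y" and psi_dom: "y \<in> img \<Longrightarrow> psi y \<in> dom"
  by (auto simp: psi_def phi_def dom_def img_def f_inv_into_f inv_into_into)

lemma phi_img: "p \<in> dom \<Longrightarrow> phi p \<in> img"
  by (auto simp: phi_def dom_def img_def)

lemma continuous_phi: "continuous_map (subtopology X dom) (top_of_set img) phi"
  using homeo by (rule homeomorphic_imp_continuous_map)

lemma continuous_psi: "continuous_map (top_of_set img) X psi"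
proof -
  obtain h where h: "homeomorphic_maps (subtopology X dom) (top_of_set img) phi h"
    using homeo homeomorphic_map_maps by blast
  have "continuous_map (top_of_set img) X h"
    using h by (simp add: homeomorphic_maps_def continuous_map_in_subtopology)
  moreover have "h y = psi y" if y: "y \<in> img" for y
  proof -
    have "h y \<in> dom" "phi (h y) = y"
      using h y by (auto simp: homeomorphic_maps_def continuous_map_def)
    then show ?thesis using psi_phi by metis
  qed
  ultimately show ?thesis by (auto elim!: continuous_map_eq)
qed

lemma openin_phi_preimage: "open W \<Longrightarrow> openin X {p \<in> dom. phi p \<in> W}"
proof -
  assume "open W"
  then have "openin (subtopology X dom) {p \<in> topspace (subtopology X dom). phi p \<in> W \<inter> img}"
    by (intro openin_continuous_map_preimage[OF continuous_phi]) (auto simp: openin_open)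
  then have "openin X {p \<in> topspace (subtopology X dom). phi p \<in> W \<inter> img}"
    using openin_trans_full[OF _ openin_dom] by blast
  moreover have "{p \<in> topspace (subtopology X dom). phi p \<in> W \<inter> img} = {p \<in> dom. phi p \<in> W}"
    using dom_subset phi_img by auto
  ultimately show ?thesis by simp
qed

lemma open_psi_preimage: "openin X V \<Longrightarrow> open {y \<in> img. psi y \<in> V}"
  using openin_continuous_map_preimage[OF continuous_psi, of V] open_img
  by (simp add: openin_open_eq)

lemma limitin_psi:
  assumes "(f \<longlongrightarrow> y) F" "y \<in> img" shows "limitin X (\<lambda>n. psi (f n)) (psi y) F"
  unfolding limitin_def
proof (intro conjI allI impI)
  show "psi y \<in> topspace X" using psi_dom assms dom_subset by blast
  fix V assume "openin X V \<and> psi y \<in> V"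
  then have "eventually (\<lambda>n. f n \<in> {y \<in> img. psi y \<in> V}) F"
    using assms by (intro topological_tendstoD open_psi_preimage) auto
  then show "eventually (\<lambda>n. psi (f n) \<in> V) F" by eventually_elim auto
qed

lemma limitin_phi:
  assumes "limitin X f p F" "p \<in> dom"
  shows "eventually (\<lambda>n. f n \<in> dom) F" "((\<lambda>n. phi (f n)) \<longlongrightarrow> phi p) F"
proof -
  show "eventually (\<lambda>n. f n \<in> dom) F" using assms openin_dom unfolding limitin_def by blast
  show "((\<lambda>n. phi (f n)) \<longlongrightarrow> phi p) F"
  proof (rule topological_tendstoI)
    fix W assume "open W" "phi p \<in> W"
    then have "eventually (\<lambda>n. f n \<in> {p \<in> dom. phi p \<in> W}) F"
      using assms openin_phi_preimage[of W] unfolding limitin_def by blast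
    then show "eventually (\<lambda>n. phi (f n) \<in> W) F" by eventually_elim auto
  qed
qed

abbreviation ftime :: "real^'n \<Rightarrow> real^'n \<Rightarrow> bool" where
  "ftime y v \<equiv> future_timelike_vec (g c y) (T c y) v"

lemma chart_change:
  assumes d: "d \<in> A" and p: "p \<in> fst d \<inter> dom"
  shows "g c (phi p) = transpose (trans_jac d c p) ** g d (snd d p) ** trans_jac d c p"
    "T d (snd d p) = trans_jac d c p *v T c (phi p)"
proof -
  have "g c (snd c p) = transpose (trans_jac d c p) ** g d (snd d p) ** trans_jac d c p \<and>
        T d (snd d p) = trans_jac d c p *v T c (snd c p)"
    using spacetime[unfolded spacetime_def, THEN conjunct2, THEN conjunct2, THEN conjunct2, THEN bspec, THEN bspec, THEN bspec, OF d chart]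
      p unfolding dom_def by blast
  then show "g c (phi p) = transpose (trans_jac d c p) ** g d (snd d p) ** trans_jac d c p"
    "T d (snd d p) = trans_jac d c p *v T c (phi p)" unfolding phi_def by (rule conjunct1, rule conjunct2)
qed

text \<open>Metric and time orientation transform by the same Jacobian as vectors, so the products
  in \<open>future_timelike_vec\<close> are unchanged.\<close>

lemma ftime_chart_change:
  assumes d: "d \<in> A" and p: "p \<in> fst d \<inter> dom" and v: "ftime (phi p) v"
  shows "future_timelike_vec (g d (snd d p)) (T d (snd d p)) (trans_jac d c p *v v)"
proof -
  let ?J = "trans_jac d c p" and ?G = "g d (snd d p)"
  have "(?J *v a) \<bullet> (?G *v (?J *v b)) = a \<bullet> (g c (phi p) *v b)" for a b
    unfolding chart_change(1)[OF d p] by (rule inner_congruence)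
  then show ?thesis using v unfolding future_timelike_vec_def chart_change(2)[OF d p] by simp
qed

lemma smooth_transition:
  assumes "d \<in> A" shows "smooth_on (phi ` (fst d \<inter> dom)) (snd d \<circ> psi)" "open (phi ` (fst d \<inter> dom))"
proof -
  have "\<forall>(U,\<phi>)\<in>A. \<forall>(V,\<psi>)\<in>A. smooth_on (\<psi> ` (U \<inter> V)) (\<phi> \<circ> inv_into V \<psi>)"
    using manifold unfolding smooth_manifold_def by (elim conjE)
  from bspec[OF bspec[OF this assms, unfolded case_prod_beta] chart]
  show "smooth_on (phi ` (fst d \<inter> dom)) (snd d \<circ> psi)" 
    unfolding phi_def dom_def psi_def by (simp add: case_prod_beta)
  have "openin X (fst d)" using manifold_chart[OF assms] by simp
  then have "open {y \<in> img. psi y \<in> fst d}" by (rule open_psi_preimage)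
  also have "{y \<in> img. psi y \<in> fst d} = phi ` (fst d \<inter> dom)"
  proof (intro equalityI subsetI)
    fix y assume "y \<in> {y \<in> img. psi y \<in> fst d}"
    then show "y \<in> phi ` (fst d \<inter> dom)"
      using phi_psi[of y] psi_dom[of y] by (intro image_eqI[of _ _ "psi y"]) auto
  next
    fix y assume "y \<in> phi ` (fst d \<inter> dom)"
    then show "y \<in> {y \<in> img. psi y \<in> fst d}" using phi_img psi_phi by auto
  qed
  finally show "open (phi ` (fst d \<inter> dom))" .
qed

text \<open>A piece must be timelike in every chart \<open>d\<close>. By the chain rule the velocity
  in \<open>d\<close> is the Jacobian applied to \<open>D t\<close>, so checking the single chart
  \<open>c\<close> is enough.\<close>

lemma curve_piece_psi:
  assumes \<sigma>: "\<And>t. t \<in> {a..b} \<Longrightarrow> (\<sigma> has_vector_derivative D t) (at t within {a..b})"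
    and D: "continuous_on {a..b} D"
    and tl: "\<And>t. t \<in> {a..b} \<Longrightarrow> \<sigma> t \<in> img \<and> ftime (\<sigma> t) (D t)"
  shows "curve_piece A g T future_timelike_vec (\<lambda>t. psi (\<sigma> t)) a b"
  unfolding curve_piece_def
proof
  fix d assume d: "d \<in> A"
  let ?f = "snd d \<circ> psi" and ?S = "phi ` (fst d \<inter> dom)"
  note smd = smooth_onD[OF smooth_transition[OF d]]
  have in_S: "\<sigma> t \<in> ?S" if "t \<in> {a..b}" "psi (\<sigma> t) \<in> fst d" for t
    using tl[OF that(1)] that(2) phi_psi psi_dom by (intro image_eqI[of _ _ "psi (\<sigma> t)"]) auto
  have cont: "continuous_on {a..b} \<sigma>"
    using \<sigma> has_vector_derivative_continuous continuous_on_eq_continuous_within by blast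
  \<comment> \<open>Continuity of \<open>E\<close> comes from its expansion in a basis, because
    smoothness controls the derivative only in fixed directions.\<close>
  define E where "E t = frechet_derivative ?f (at (\<sigma> t)) (D t)" for t
  have E: "E t = (\<Sum>i\<in>Basis. (D t \<bullet> i) *\<^sub>R frechet_derivative ?f (at (\<sigma> t)) i)"
    if "t \<in> {a..b}" "psi (\<sigma> t) \<in> fst d" for t
  proof -
    interpret bounded_linear "frechet_derivative ?f (at (\<sigma> t))"
      using smd(1)[OF in_S[OF that]] has_derivative_bounded_linear by blast
    show ?thesis unfolding E_def by (subst euclidean_representation[of "D t", symmetric]) (simp add: sum scale)
  qed
  show "\<exists>D. continuous_on {t \<in> {a..b}. psi (\<sigma> t) \<in> fst d} D \<and>
              (\<forall>t\<in>{a..b}. psi (\<sigma> t) \<in> fst d \<longrightarrow>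
                   (snd d \<circ> (\<lambda>t. psi (\<sigma> t)) has_vector_derivative D t) (at t within {a..b}) \<and>
                   future_timelike_vec (g d (snd d (psi (\<sigma> t)))) (T d (snd d (psi (\<sigma> t)))) (D t))"
  proof (intro exI[of _ E] conjI ballI impI)
    have "continuous_on {t \<in> {a..b}. psi (\<sigma> t) \<in> fst d}
        (\<lambda>t. \<Sum>i\<in>Basis. (D t \<bullet> i) *\<^sub>R frechet_derivative ?f (at (\<sigma> t)) i)"
      by (intro continuous_intros continuous_on_subset[OF D] continuous_on_compose2[OF smd(3)]
           continuous_on_subset[OF cont]) (use in_S in auto)
    then show "continuous_on {t \<in> {a..b}. psi (\<sigma> t) \<in> fst d} E"
      by (rule continuous_on_eq) (use E in auto)
    fix t assume t: "t \<in> {a..b}" "psi (\<sigma> t) \<in> fst d"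
    have f: "(?f has_derivative frechet_derivative ?f (at (\<sigma> t))) (at (\<sigma> t) within \<sigma> ` {a..b})"
      using smd(1)[OF in_S[OF t]] by (rule has_derivative_at_withinI)
    interpret bounded_linear "frechet_derivative ?f (at (\<sigma> t))"
      using f has_derivative_bounded_linear by blast
    have "(?f \<circ> \<sigma> has_derivative frechet_derivative ?f (at (\<sigma> t)) \<circ> (\<lambda>x. x *\<^sub>R D t)) (at t within {a..b})"
      by (rule diff_chain_within[OF \<sigma>[OF t(1), unfolded has_vector_derivative_def] f])
    moreover have "frechet_derivative ?f (at (\<sigma> t)) \<circ> (\<lambda>x. x *\<^sub>R D t) = (\<lambda>x. x *\<^sub>R E t)"
      by (simp add: fun_eq_iff E_def scale)
    moreover have "snd d \<circ> (\<lambda>t. psi (\<sigma> t)) = ?f \<circ> \<sigma>" by (simp add: fun_eq_iff)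
    ultimately show "(snd d \<circ> (\<lambda>t. psi (\<sigma> t)) has_vector_derivative E t) (at t within {a..b})"
      unfolding has_vector_derivative_def by simp
    have ps: "psi (\<sigma> t) \<in> fst d \<inter> dom" "phi (psi (\<sigma> t)) = \<sigma> t"
      using t tl[OF t(1)] psi_dom phi_psi by auto
    have "E t = trans_jac d c (psi (\<sigma> t)) *v D t"
      using ps(2) matrix_works[OF linear_axioms[folded linear_matrix_vector_mul_eq], of "D t"]
      unfolding trans_jac_def E_def phi_def psi_def by simp
    then show "future_timelike_vec (g d (snd d (psi (\<sigma> t)))) (T d (snd d (psi (\<sigma> t)))) (E t)"
      using ftime_chart_change[OF d ps(1), of "D t"] tl[OF t(1)] ps(2) by simp
  qed
qed

lemma chron_psi:
  assumes \<sigma>: "\<And>t. t \<in> {a..b} \<Longrightarrow> (\<sigma> has_vector_derivative D t) (at t within {a..b})"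
    and D: "continuous_on {a..b} D"
    and tl: "\<And>t. t \<in> {a..b} \<Longrightarrow> \<sigma> t \<in> img \<and> ftime (\<sigma> t) (D t)" and ab: "a < b"
  shows "chron X A g T (psi (\<sigma> a)) (psi (\<sigma> b))"
proof -
  have "continuous_on {a..b} \<sigma>"
    using \<sigma> has_vector_derivative_continuous continuous_on_eq_continuous_within by blast
  then have "continuous_map (top_of_set {a..b}) (top_of_set img) \<sigma>"
    unfolding continuous_map_subtopology_eu using tl by blast
  from continuous_map_compose[OF this continuous_psi]
  have "continuous_map (top_of_set {a..b}) X (\<lambda>t. psi (\<sigma> t))" unfolding o_def .
  moreover have "curve_piece A g T future_timelike_vec (\<lambda>t. psi (\<sigma> t)) u u'" if "a \<le> u" "u' \<le> b" for u u'
    using curve_piece_psi[OF \<sigma> D tl] that by (rule curve_piece_subset)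
  ultimately have "pw_curve X A g T future_timelike_vec (\<lambda>t. psi (\<sigma> t)) a b"
    unfolding pw_curve_iff using ab by (intro conjI exI[of _ "{}"]) auto
  then show ?thesis unfolding chron_def by (intro exI conjI) (assumption, simp_all)
qed

lemma chron_segment:
  assumes "\<And>t. t \<in> {0..1} \<Longrightarrow> y + t *\<^sub>R v \<in> img \<and> ftime (y + t *\<^sub>R v) v"
  shows "chron X A g T (psi y) (psi (y + v))"
proof -
  have "chron X A g T (psi (y + 0 *\<^sub>R v)) (psi (y + 1 *\<^sub>R v))"
    by (rule chron_psi[where D = "\<lambda>_. v"]) (use assms in \<open>auto intro!: derivative_eq_intros\<close>)
  then show ?thesis by simp
qed

lemma smooth_metric: "smooth_on img (g c)"
  and lorentz: "y \<in> img \<Longrightarrow> lorentzian_matrix (g c y)"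
  and continuous_T: "continuous_on img (T c)"
  and T_timelike: "y \<in> img \<Longrightarrow> T c y \<bullet> (g c y *v T c y) < 0"
  using spacetime[unfolded spacetime_def, THEN conjunct2, THEN conjunct2, THEN conjunct1, THEN bspec, OF chart]
  unfolding img_def by blast+

lemma ftime_T: "y \<in> img \<Longrightarrow> ftime y (T c y)"
  using T_timelike by (simp add: future_timelike_vec_def)

lemma symmetric_metric: "y \<in> img \<Longrightarrow> transpose (g c y) = g c y"
  using lorentz unfolding lorentzian_matrix_def by blast

lemma continuous_metric: "continuous_on img (g c)"
  using smooth_onD(2)[OF smooth_metric open_img] .

lemma ftime_scaleR: "ftime y v \<Longrightarrow> r > 0 \<Longrightarrow> ftime y (r *\<^sub>R v)"
  by (simp add: future_timelike_vec_def matrix_vector_mult_scaleR mult_less_0_iff zero_less_mult_iff)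

lemma open_ftime:
  assumes "y0 \<in> img" "ftime y0 v0"
  obtains \<epsilon> where "\<epsilon> > 0" "cball y0 \<epsilon> \<subseteq> img" "\<And>y v. dist y0 y \<le> \<epsilon> \<Longrightarrow> dist v0 v \<le> \<epsilon> \<Longrightarrow> ftime y v"
proof -
  have c1: "continuous_on (img \<times> UNIV) (\<lambda>(y,v). max (v \<bullet> (g c y *v v)) (v \<bullet> (g c y *v T c y)))"
    unfolding case_prod_beta
    by (intro continuous_intros continuous_on_compose2[OF continuous_metric] continuous_on_compose2[OF continuous_T]) auto
  have "open {z \<in> img \<times> UNIV. (\<lambda>(y,v). max (v \<bullet> (g c y *v v)) (v \<bullet> (g c y *v T c y))) z \<in> {..<0}}"
    using continuous_openin_preimage_gen[OF c1 open_lessThan[of 0]] open_img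
    by (simp add: openin_open_eq open_Times vimage_def Int_def)
  moreover have "(y0, v0) \<in> {z \<in> img \<times> UNIV. (\<lambda>(y,v). max (v \<bullet> (g c y *v v)) (v \<bullet> (g c y *v T c y))) z \<in> {..<0}}"
    using assms by (simp add: future_timelike_vec_def)
  ultimately obtain B C where BC: "open B" "open C" "y0 \<in> B" "v0 \<in> C"
    "B \<times> C \<subseteq> {z \<in> img \<times> UNIV. (\<lambda>(y,v). max (v \<bullet> (g c y *v v)) (v \<bullet> (g c y *v T c y))) z \<in> {..<0}}"
    by (rule open_prod_elim[elim_format]) auto
  obtain e1 where e1: "e1 > 0" "cball y0 e1 \<subseteq> B" using BC open_contains_cball by metis
  obtain e2 where e2: "e2 > 0" "cball v0 e2 \<subseteq> C" using BC open_contains_cball by metis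
  show thesis
  proof (rule that[of "min e1 e2"])
    show "0 < min e1 e2" using e1 e2 by simp
    show "cball y0 (min e1 e2) \<subseteq> img"
    proof
      fix y assume "y \<in> cball y0 (min e1 e2)"
      then have "(y, v0) \<in> B \<times> C" using e1 BC by auto
      then show "y \<in> img" using BC(5) by auto
    qed
    fix y v assume "dist y0 y \<le> min e1 e2" "dist v0 v \<le> min e1 e2"
    then have "(y, v) \<in> B \<times> C" using e1 e2 by auto
    then show "ftime y v" using BC(5) by (auto simp: future_timelike_vec_def)
  qed
qed

end

section \<open>Openness of chronological futures and pasts\<close>

lemma spacetime_chart_exists:
  assumes "spacetime X A g T" "p \<in> topspace X"
  obtains c where "spacetime_chart X A g T c" "p \<in> fst c"
proof -
  have "(\<Union>c\<in>A. fst c) = topspace X"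
    using assms(1)[unfolded spacetime_def, THEN conjunct2, THEN conjunct1] unfolding smooth_manifold_def by (elim conjE)
  then obtain c where "c \<in> A" "p \<in> fst c" using assms(2) by blast
  then show thesis using that assms(1) unfolding spacetime_chart_def by blast
qed

text \<open>Only the last smooth piece before \<open>q\<close> matters. A point
  \<open>\<gamma> s\<close> slightly before the end sees \<open>q\<close> in nearly the direction
  \<open>D b\<close>, so after moving \<open>q\<close> a little the straight coordinate segment from
  \<open>\<gamma> s\<close> still has a timelike direction.\<close>

lemma openin_chron_future:
  assumes st: "spacetime X A g T"
  shows "openin X {q. chron X A g T p q}"
proof (subst openin_subopen, intro ballI)
  fix q assume "q \<in> {q. chron X A g T p q}"
  then obtain \<gamma> a b where \<gamma>: "pw_curve X A g T future_timelike_vec \<gamma> a b" "\<gamma> a = p" "\<gamma> b = q"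
    unfolding chron_def by blast
  have ab: "a < b" using \<gamma>(1) by (rule pw_curve_less)
  have qX: "q \<in> topspace X" using pw_curve_in_topspace[OF \<gamma>(1), of b] ab \<gamma>(3) by simp
  obtain c where c: "spacetime_chart X A g T c" "q \<in> fst c"
    using spacetime_chart_exists[OF st qX] by blast
  interpret spacetime_chart X A g T c by (rule c(1))
  have q: "q \<in> dom" using c(2) by (simp add: dom_def)
  obtain K where K: "finite K"
    "\<And>u u'. a \<le> u \<Longrightarrow> u < u' \<Longrightarrow> u' \<le> b \<Longrightarrow> {u<..<u'} \<inter> K = {} \<Longrightarrow> curve_piece A g T future_timelike_vec \<gamma> u u'"
    using \<gamma>(1) by (rule pw_curveE) (rule that)
  \<comment> \<open>The last break before \<open>b\<close>, or \<open>a\<close> if that is later, so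
    that the curve is a single piece from \<open>k\<close> to \<open>b\<close>.\<close>
  define k where "k = Max (insert a (K \<inter> {..<b}))"
  have k: "a \<le> k" "k < b" "{k<..<b} \<inter> K = {}"
  proof -
    have fin: "finite (insert a (K \<inter> {..<b}))" using K(1) by simp
    show "a \<le> k" unfolding k_def by (rule Max_ge[OF fin]) simp
    have "k \<in> insert a (K \<inter> {..<b})" unfolding k_def by (rule Max_in[OF fin]) simp
    then show "k < b" using ab by auto
    show "{k<..<b} \<inter> K = {}"
    proof (intro equals0I)
      fix x assume x: "x \<in> {k<..<b} \<inter> K"
      then have "x \<le> k" unfolding k_def by (intro Max_ge[OF fin]) simp
      then show False using x by simp
    qed
  qed
  have "curve_piece A g T future_timelike_vec \<gamma> k b" using k by (intro K(2)) auto
  from this[unfolded curve_piece_def, THEN bspec, OF chart]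
  obtain D where D: "\<And>t. t\<in>{k..b} \<Longrightarrow> \<gamma> t \<in> dom \<Longrightarrow>
      ((phi \<circ> \<gamma>) has_vector_derivative D t) (at t within {k..b}) \<and> ftime (phi (\<gamma> t)) (D t)"
    unfolding dom_def phi_def by blast
  have Db: "((phi \<circ> \<gamma>) has_vector_derivative D b) (at b within {k..b})" "ftime (phi q) (D b)"
    using D[of b] k \<gamma>(3) q by auto
  obtain \<epsilon> where \<epsilon>: "\<epsilon> > 0" "cball (phi q) \<epsilon> \<subseteq> img"
    "\<And>y v. dist (phi q) y \<le> \<epsilon> \<Longrightarrow> dist (D b) v \<le> \<epsilon> \<Longrightarrow> ftime y v"
    using open_ftime[OF phi_img[OF q] Db(2)] by blast
  have nb: "at b within {k..b} \<noteq> bot"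
    using k by (simp add: trivial_limit_within islimpt_Icc)
  have "((phi \<circ> \<gamma>) \<longlongrightarrow> phi q) (at b within {k..b})"
    using has_vector_derivative_continuous[OF Db(1)] \<gamma>(3) by (simp add: continuous_within)
  then have e1: "eventually (\<lambda>t. dist (phi (\<gamma> t)) (phi q) < \<epsilon>) (at b within {k..b})"
    using tendstoD[OF _ \<epsilon>(1)] by fastforce
  obtain d where d: "d > 0" "\<And>t. t \<in> {k..b} \<Longrightarrow> \<bar>t - b\<bar> < d \<Longrightarrow>
      norm (phi (\<gamma> t) - phi q - (t - b) *\<^sub>R D b) \<le> \<epsilon>/2 * \<bar>t - b\<bar>"
  proof -
    have "\<epsilon>/2 > 0" using \<epsilon>(1) by simp
    from Db(1)[unfolded has_vector_derivative_def has_derivative_within_alt, THEN conjunct2, rule_format, OF this]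
    obtain d where "d > 0" and d: "\<And>t. t \<in> {k..b} \<Longrightarrow> norm (t - b) < d \<Longrightarrow>
      norm ((phi \<circ> \<gamma>) t - (phi \<circ> \<gamma>) b - (t - b) *\<^sub>R D b) \<le> \<epsilon>/2 * norm (t - b)" by blast
    from this(1) show thesis
    proof (rule that)
      fix t assume "t \<in> {k..b}" "\<bar>t - b\<bar> < d"
      then show "norm (phi (\<gamma> t) - phi q - (t - b) *\<^sub>R D b) \<le> \<epsilon>/2 * \<bar>t - b\<bar>"
        using d[of t] \<gamma>(3) by simp
    qed
  qed
  have e2: "eventually (\<lambda>t. norm (phi (\<gamma> t) - phi q - (t - b) *\<^sub>R D b) \<le> \<epsilon>/2 * \<bar>t - b\<bar>) (at b within {k..b})"
    unfolding eventually_at using d by (intro exI[of _ d]) (auto simp: dist_real_def)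
  have "continuous_map (top_of_set {k..b}) X \<gamma>"
    using pw_curve_restrict[OF \<gamma>(1) k(1,2)] pw_curve_continuous by blast
  then have "openin (top_of_set {k..b}) {t \<in> {k..b}. \<gamma> t \<in> dom}"
    using openin_continuous_map_preimage[OF _ openin_dom] by fastforce
  then have "\<exists>d>0. \<forall>t. dist b t < d \<and> k \<le> t \<and> t \<le> b \<longrightarrow> \<gamma> t \<in> dom"
    using k \<gamma>(3) q by (auto simp: openin_contains_ball subset_iff)
  then have e3: "eventually (\<lambda>t. \<gamma> t \<in> dom) (at b within {k..b})"
    unfolding eventually_at by (metis atLeastAtMost_iff dist_commute)
  have e4: "eventually (\<lambda>t. t \<in> {k<..<b}) (at b within {k..b})"
    using k by (auto simp: eventually_at dist_real_def intro!: exI[of _ "b - k"])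
  obtain s where s: "dist (phi (\<gamma> s)) (phi q) < \<epsilon>" "norm (phi (\<gamma> s) - phi q - (s - b) *\<^sub>R D b) \<le> \<epsilon>/2 * \<bar>s - b\<bar>"
    "\<gamma> s \<in> dom" "k < s" "s < b"
    using eventually_happens'[OF nb eventually_conj[OF e1 eventually_conj[OF e2 eventually_conj[OF e3 e4]]]] by auto
  \<comment> \<open>The displacement of the end point and the remainder of the derivative each
    contribute at most \<open>\<epsilon> / 2\<close> per unit of \<open>b - s\<close>, so the
    direction stays within \<open>\<epsilon>\<close> of \<open>D b\<close>. The bound by
    \<open>\<epsilon>\<close> keeps the segment in the ball where \<open>ftime\<close> is
    known.\<close>
  define \<delta> where "\<delta> = min \<epsilon> ((b - s) * (\<epsilon>/2))"
  have \<delta>: "\<delta> > 0" using \<epsilon> s by (simp add: \<delta>_def)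
  have pgs: "chron X A g T p (\<gamma> s)"
    using pw_curve_imp_chron[OF \<gamma>(1), of a s] s k \<gamma>(2) by auto
  have near: "chron X A g T (\<gamma> s) r" if r: "r \<in> dom" "phi r \<in> ball (phi q) \<delta>" for r
  proof -
    define u where "u = phi r - phi (\<gamma> s)"
    have tl: "ftime y u" if y: "dist (phi q) y \<le> \<epsilon>" for y
    proof -
      have "norm (u - (b - s) *\<^sub>R D b)
          = norm ((phi r - phi q) - (phi (\<gamma> s) - phi q - (s - b) *\<^sub>R D b))"
        by (simp add: u_def algebra_simps)
      also have "\<dots> \<le> norm (phi r - phi q) + norm (phi (\<gamma> s) - phi q - (s - b) *\<^sub>R D b)"
        by (rule norm_triangle_ineq4)
      also have "\<dots> \<le> (b - s) * (\<epsilon>/2) + \<epsilon>/2 * \<bar>s - b\<bar>"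
        using r(2) s(2) by (intro add_mono) (auto simp: \<delta>_def dist_norm norm_minus_commute)
      also have "\<dots> = \<epsilon> * (b - s)" using s by (simp add: algebra_simps)
      finally have le: "norm (u - (b - s) *\<^sub>R D b) \<le> \<epsilon> * (b - s)" .
      have "u - (b - s) *\<^sub>R D b = (b - s) *\<^sub>R (u /\<^sub>R (b - s) - D b)"
        using s by (simp add: scaleR_diff_right)
      then have "(b - s) * norm (u /\<^sub>R (b - s) - D b) \<le> \<epsilon> * (b - s)"
        using le s by simp
      then have "dist (D b) (u /\<^sub>R (b - s)) \<le> \<epsilon>"
        using s by (simp add: dist_norm norm_minus_commute mult.commute[of "b - s"])
      then have "ftime y (u /\<^sub>R (b - s))" using \<epsilon>(3) y by blast
      from ftime_scaleR[OF this, of "b - s"] show ?thesis using s by simp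
    qed
    have "chron X A g T (psi (phi (\<gamma> s))) (psi (phi (\<gamma> s) + u))"
    proof (rule chron_segment)
      fix t :: real assume t: "t \<in> {0..1}"
      have "phi (\<gamma> s) \<in> cball (phi q) \<epsilon>" "phi r \<in> cball (phi q) \<epsilon>"
        using s(1) r(2) by (auto simp: dist_commute \<delta>_def)
      from convexD_alt[OF convex_cball this, of t] t
      have "phi (\<gamma> s) + t *\<^sub>R u \<in> cball (phi q) \<epsilon>" by (simp add: u_def algebra_simps)
      then show "phi (\<gamma> s) + t *\<^sub>R u \<in> img \<and> ftime (phi (\<gamma> s) + t *\<^sub>R u) u"
        using tl \<epsilon>(2) by auto
    qed
    then show ?thesis using psi_phi s(3) r(1) by (simp add: u_def)
  qed
  show "\<exists>W. openin X W \<and> q \<in> W \<and> W \<subseteq> {q. chron X A g T p q}"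
  proof (intro exI[of _ "{r \<in> dom. phi r \<in> ball (phi q) \<delta>}"] conjI)
    show "openin X {r \<in> dom. phi r \<in> ball (phi q) \<delta>}" by (rule openin_phi_preimage) simp
    show "q \<in> {r \<in> dom. phi r \<in> ball (phi q) \<delta>}" using q \<delta> by simp
    show "{r \<in> dom. phi r \<in> ball (phi q) \<delta>} \<subseteq> {q. chron X A g T p q}"
      using near chron_trans[OF pgs] by blast
  qed
qed

lemma openin_chron_past:
  assumes "spacetime X A g T"
  shows "openin X {q. chron X A g T q p}"
  using openin_chron_future[OF spacetime_time_reversal[OF assms], of p] by (simp add: chron_time_reversal)

section \<open>Perturbation of timelike curves\<close>

text \<open>A displaced curve is built piece by piece, so the relation between displaced points is
  first known only on intervals free of breaks; transitivity carries it across them.\<close>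

lemma finite_breaks_chain:
  fixes R :: "real \<Rightarrow> real \<Rightarrow> bool"
  assumes "finite K" "a < b" and tr: "\<And>x y z. R x y \<Longrightarrow> R y z \<Longrightarrow> R x z"
    and "\<And>u u'. a \<le> u \<Longrightarrow> u < u' \<Longrightarrow> u' \<le> b \<Longrightarrow> {u<..<u'} \<inter> K = {} \<Longrightarrow> R u u'"
  shows "R a b"
  using assms(1,2,4)
proof (induction K arbitrary: a b)
  case empty
  then show ?case by simp
next
  case (insert k K)
  show ?case
  proof (cases "k \<in> {a<..<b}")
    case True
    have "R a k" by (rule insert.IH) (use True insert.prems(2) in auto)
    moreover have "R k b" by (rule insert.IH) (use True insert.prems(2) in auto)
    ultimately show ?thesis by (rule tr)
  next
    case False
    show ?thesis by (rule insert.IH) (use False insert.prems in auto)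
  qed
qed

context spacetime_chart begin

text \<open>Two instances of \<open>lorentzian_cone_bound\<close>, with \<open>t2\<close> the
  central and the local time orientation. The first measures the gain from moving in the direction
  \<open>T c y0\<close>, the second keeps a perturbed vector future directed.\<close>

lemma uniform_cone_ball:
  assumes y0: "y0 \<in> img"
  obtains R \<kappa> L where "R > 0" "\<kappa> > 0" "L \<ge> 0" "cball y0 R \<subseteq> img"
    "\<And>y y'. y \<in> cball y0 R \<Longrightarrow> y' \<in> cball y0 R \<Longrightarrow> norm (g c y - g c y') \<le> L * norm (y - y')"
    "\<And>y y' v. y \<in> cball y0 R \<Longrightarrow> y' \<in> cball y0 R \<Longrightarrow> ftime y v \<Longrightarrow>
       v \<bullet> (g c y' *v T c y0) \<le> - \<kappa> * norm v \<and> v \<bullet> (g c y' *v T c y') \<le> - \<kappa> * norm v"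
    "\<And>y. y \<in> cball y0 R \<Longrightarrow> ftime y (T c y0)"
proof -
  obtain \<epsilon> \<kappa> where \<epsilon>: "\<epsilon> > 0" "\<kappa> > 0" and cone:
    "\<And>G1 t1 G2 t2 v. norm (G1 - g c y0) < \<epsilon> \<Longrightarrow> norm (t1 - T c y0) < \<epsilon> \<Longrightarrow> norm (G2 - g c y0) < \<epsilon> \<Longrightarrow>
       norm (t2 - T c y0) < \<epsilon> \<Longrightarrow> v \<bullet> (G1 *v v) \<le> 0 \<Longrightarrow> v \<bullet> (G1 *v t1) \<le> 0 \<Longrightarrow> v \<bullet> (G2 *v t2) \<le> - \<kappa> * norm v"
    using lorentzian_cone_bound[OF lorentz[OF y0] T_timelike[OF y0]] by metis
  have "continuous (at y0) (g c)" "continuous (at y0) (T c)"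
    using continuous_metric continuous_T open_img y0 continuous_on_eq_continuous_at by blast+
  then obtain d1 d2 where d: "d1 > 0" "\<And>y. dist y y0 < d1 \<Longrightarrow> dist (g c y) (g c y0) < \<epsilon>"
      "d2 > 0" "\<And>y. dist y y0 < d2 \<Longrightarrow> dist (T c y) (T c y0) < \<epsilon>"
    unfolding continuous_at_eps_delta using \<epsilon>(1) by metis
  obtain \<eta> where \<eta>: "\<eta> > 0" "cball y0 \<eta> \<subseteq> img" "\<And>y v. dist y0 y \<le> \<eta> \<Longrightarrow> dist (T c y0) v \<le> \<eta> \<Longrightarrow> ftime y v"
    using open_ftime[OF y0 ftime_T[OF y0]] by metis
  define R where "R = min \<eta> (min (d1/2) (d2/2))"
  have R: "R > 0" "R \<le> \<eta>" "R < d1" "R < d2" using \<eta> d by (auto simp: R_def)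
  have sub: "cball y0 R \<subseteq> img" using \<eta>(2) R(2) by (meson order_trans subset_cball)
  obtain L where L: "L \<ge> 0" "\<And>u v. u \<in> cball y0 R \<Longrightarrow> v \<in> cball y0 R \<Longrightarrow> norm (g c u - g c v) \<le> L * norm (u - v)"
    using smooth_on_imp_lipschitz[OF smooth_metric open_img sub] by metis
  have nr: "norm (g c y - g c y0) < \<epsilon>" "norm (T c y - T c y0) < \<epsilon>" if "y \<in> cball y0 R" for y
    using d(2,4)[of y] R that by (auto simp: dist_norm norm_minus_commute)
  show thesis
  proof (rule that[of R \<kappa> L])
    fix y y' v assume y: "y \<in> cball y0 R" "y' \<in> cball y0 R" and v: "ftime y v"
    then have "v \<bullet> (g c y *v v) \<le> 0" "v \<bullet> (g c y *v T c y) \<le> 0" by (auto simp: future_timelike_vec_def)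
    from cone[OF nr(1,2)[OF y(1)] nr(1)[OF y(2)] _ this] nr(2)[OF y(2)] \<epsilon>(1)
    show "v \<bullet> (g c y' *v T c y0) \<le> - \<kappa> * norm v \<and> v \<bullet> (g c y' *v T c y') \<le> - \<kappa> * norm v" by simp
  next
    fix y assume "y \<in> cball y0 R"
    then show "ftime y (T c y0)" using \<eta>(3)[of y "T c y0"] \<eta>(1) R by auto
  qed (use R \<epsilon> L sub in auto)
qed

text \<open>Moving a timelike curve by \<open>s *\<^sub>R e\<close> changes the metric along it by \<open>O(\<bar>s\<bar>)\<close>;
  if \<open>s\<close> grows at a rate proportional to \<open>\<bar>s\<bar>\<close>, the gain in the direction \<open>e\<close> compensates the change.\<close>
lemma ftime_perturb:
  fixes y0 R L e \<kappa> \<mu> s v y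
  assumes L0: "L \<ge> 0" and \<kappa>: "\<kappa> > 0" and img: "cball y0 R \<subseteq> img" and y0: "y0 \<in> cball y0 R"
    and L: "\<And>y y'. y \<in> cball y0 R \<Longrightarrow> y' \<in> cball y0 R \<Longrightarrow> norm (g c y - g c y') \<le> L * norm (y - y')"
    and cone: "\<And>y y' v. y \<in> cball y0 R \<Longrightarrow> y' \<in> cball y0 R \<Longrightarrow> ftime y v \<Longrightarrow>
       v \<bullet> (g c y' *v e) \<le> - \<kappa> * norm v \<and> v \<bullet> (g c y' *v T c y') \<le> - \<kappa> * norm v"
    and e: "\<And>y. y \<in> cball y0 R \<Longrightarrow> ftime y e"
    and \<mu>: "\<mu> \<ge> 0" "\<mu> * \<kappa>\<^sup>2 = L * norm e"
    and y: "y \<in> cball y0 R" "y + s *\<^sub>R e \<in> cball y0 R" and v: "ftime y v"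
  shows "ftime (y + s *\<^sub>R e) (v + (\<mu> * \<bar>s\<bar> * - (v \<bullet> (g c y0 *v e))) *\<^sub>R e)"
proof -
  \<comment> \<open>The metric in \<open>\<tau>\<close> is frozen at \<open>y0\<close>. This makes
    \<open>\<tau>\<close> a fixed linear functional, so that along a curve its value on the velocity
    is the derivative of its value on the position.\<close>
  define G y' G' \<tau> m N where "G = g c y" and "y' = y + s *\<^sub>R e" and "G' = g c y'"
    and "\<tau> = - (v \<bullet> (g c y0 *v e))" and "m = \<mu> * \<bar>s\<bar> * \<tau>" and "N = norm v"
  have N: "N > 0" using v by (auto simp: N_def future_timelike_vec_def)
  have \<tau>: "\<tau> \<ge> \<kappa> * N" using cone[OF y(1) y0 v] by (simp add: \<tau>_def N_def)
  have m: "m \<ge> \<mu> * \<bar>s\<bar> * (\<kappa> * N)" unfolding m_def using \<tau> \<mu> by (intro mult_left_mono) auto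
  have m0: "m \<ge> 0" using m \<mu> \<kappa> N by (auto intro: order_trans[OF _ m])
  have y': "y' \<in> cball y0 R" using y by (simp add: y'_def)
  have vG: "v \<bullet> (G *v v) < 0" using v by (simp add: future_timelike_vec_def G_def)
  have ve: "v \<bullet> (G' *v e) \<le> - \<kappa> * N" and vT: "v \<bullet> (G' *v T c y') \<le> - \<kappa> * N"
    using cone[OF y(1) y' v] by (auto simp: N_def G'_def)
  have ee: "e \<bullet> (G' *v e) < 0" "e \<bullet> (G' *v T c y') < 0"
    using e[OF y'] by (auto simp: future_timelike_vec_def G'_def)
  have "v \<bullet> (G' *v v) - v \<bullet> (G *v v) = v \<bullet> ((G' - G) *v v)"
    by (simp add: matrix_vector_mult_diff_rdistrib inner_diff_right)
  also have "\<dots> \<le> N * norm (G' - G) * N"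
    using abs_inner_matrix_le[of v "G' - G" v] by (simp add: N_def)
  also have "\<dots> \<le> N * (L * (\<bar>s\<bar> * norm e)) * N"
    using L[OF y' y(1)] N by (intro mult_right_mono mult_left_mono) (auto simp: G_def G'_def y'_def)
  finally have 1: "v \<bullet> (G' *v v) \<le> v \<bullet> (G *v v) + L * norm e * \<bar>s\<bar> * N\<^sup>2"
    by (simp add: power2_eq_square algebra_simps)
  have sym: "e \<bullet> (G' *v v) = v \<bullet> (G' *v e)"
    using symmetric_inner_matrix symmetric_metric y' img unfolding G'_def by blast
  \<comment> \<open>The cross term gains at least
    \<open>2 * L * norm e * \<bar>s\<bar> * N\<^sup>2\<close>, twice what the change of the metric
    can cost; this is the reason for \<open>\<mu> * \<kappa>\<^sup>2 = L * norm e\<close>.\<close>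
  have "(v + m *\<^sub>R e) \<bullet> (G' *v (v + m *\<^sub>R e)) = v \<bullet> (G' *v v) + 2 * m * (v \<bullet> (G' *v e)) + m * m * (e \<bullet> (G' *v e))"
    using sym by (simp add: matrix_vector_right_distrib matrix_vector_mult_scaleR inner_add_left inner_add_right algebra_simps)
  also have "\<dots> \<le> (v \<bullet> (G *v v) + L * norm e * \<bar>s\<bar> * N\<^sup>2) + 2 * (m * (- \<kappa> * N)) + 0"
  proof (intro add_mono 1)
    show "2 * m * (v \<bullet> (G' *v e)) \<le> 2 * (m * (- \<kappa> * N))" using mult_left_mono[OF ve m0] by linarith
    show "m * m * (e \<bullet> (G' *v e)) \<le> 0" using ee by (intro mult_nonneg_nonpos) auto
  qed
  also have "\<dots> \<le> v \<bullet> (G *v v) + L * norm e * \<bar>s\<bar> * N\<^sup>2 - 2 * (\<mu> * \<bar>s\<bar> * (\<kappa> * N) * (\<kappa> * N))"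
    using mult_right_mono[OF m, of "\<kappa> * N"] \<kappa> N by simp
  also have "\<dots> = v \<bullet> (G *v v) - L * norm e * \<bar>s\<bar> * N\<^sup>2"
  proof -
    have "\<mu> * \<bar>s\<bar> * (\<kappa> * N) * (\<kappa> * N) = (\<mu> * \<kappa>\<^sup>2) * \<bar>s\<bar> * N\<^sup>2" by (simp add: power2_eq_square algebra_simps)
    then show ?thesis unfolding \<mu>(2) by linarith
  qed
  also have "\<dots> < 0"
  proof -
    have "L * norm e * \<bar>s\<bar> * N\<^sup>2 \<ge> 0" using L0 by simp
    then show ?thesis using vG by linarith
  qed
  finally have A: "(v + m *\<^sub>R e) \<bullet> (G' *v (v + m *\<^sub>R e)) < 0" .
  have "(v + m *\<^sub>R e) \<bullet> (G' *v T c y') = v \<bullet> (G' *v T c y') + m * (e \<bullet> (G' *v T c y'))"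
    by (simp add: inner_add_left)
  also have "\<dots> \<le> - \<kappa> * N + 0"
    using vT m0 ee by (intro add_mono) (auto intro: mult_nonneg_nonpos)
  also have "\<dots> < 0" using \<kappa> N by simp
  finally show ?thesis using A unfolding future_timelike_vec_def m_def \<tau>_def G'_def y'_def by simp
qed

text \<open>The displacement is \<open>s = \<plusminus> \<delta> exp (\<plusminus> \<mu> (\<tau> - \<tau>\<^sub>0))\<close> with \<open>\<tau>\<close> a time function of the
  coordinate ball, normalised to have absolute value \<open>\<delta>\<close> at one chosen end.\<close>
lemma curve_perturbation:
  assumes y0: "y0 \<in> img"
  obtains r C \<delta>0 e where "\<forall>\<gamma> a b \<delta>. pw_curve X A g T future_timelike_vec \<gamma> a b \<longrightarrow>
       (\<forall>t\<in>{a..b}. \<gamma> t \<in> dom \<and> phi (\<gamma> t) \<in> cball y0 r) \<longrightarrow> 0 < \<delta> \<longrightarrow> C * \<delta> \<le> \<delta>0 \<longrightarrow>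
       (\<exists>\<delta>'. 0 < \<delta>' \<and> \<delta>' \<le> C * \<delta> \<and>
          chron X A g T (psi (phi (\<gamma> a) - \<delta>' *\<^sub>R e)) (psi (phi (\<gamma> b) - \<delta> *\<^sub>R e))) \<and>
       (\<exists>\<delta>'. 0 < \<delta>' \<and> \<delta>' \<le> C * \<delta> \<and>
          chron X A g T (psi (phi (\<gamma> a) + \<delta> *\<^sub>R e)) (psi (phi (\<gamma> b) + \<delta>' *\<^sub>R e)))"
    "\<forall>y \<delta>. y \<in> cball y0 r \<longrightarrow> 0 < \<delta> \<longrightarrow> \<delta> \<le> \<delta>0 \<longrightarrow>
       y + \<delta> *\<^sub>R e \<in> img \<and> y - \<delta> *\<^sub>R e \<in> img \<and>
       chron X A g T (psi y) (psi (y + \<delta> *\<^sub>R e)) \<and> chron X A g T (psi (y - \<delta> *\<^sub>R e)) (psi y)"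
    "r > 0" "C > 0" "\<delta>0 > 0" "cball y0 r \<subseteq> img"
proof -
  define e where "e = T c y0"
  obtain R \<kappa> L where R: "R > 0" and \<kappa>: "\<kappa> > 0" and L0: "L \<ge> 0" and img: "cball y0 R \<subseteq> img"
    and L: "\<And>y y'. y \<in> cball y0 R \<Longrightarrow> y' \<in> cball y0 R \<Longrightarrow> norm (g c y - g c y') \<le> L * norm (y - y')"
    and cone: "\<And>y y' v. y \<in> cball y0 R \<Longrightarrow> y' \<in> cball y0 R \<Longrightarrow> ftime y v \<Longrightarrow>
       v \<bullet> (g c y' *v e) \<le> - \<kappa> * norm v \<and> v \<bullet> (g c y' *v T c y') \<le> - \<kappa> * norm v"
    and e: "\<And>y. y \<in> cball y0 R \<Longrightarrow> ftime y e"
    using uniform_cone_ball[OF y0] unfolding e_def by metis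
  have y0R: "y0 \<in> cball y0 R" using R by simp
  have e0: "norm e > 0" using e[OF y0R] by (auto simp: future_timelike_vec_def)
  define \<mu> where "\<mu> = L * norm e / \<kappa>\<^sup>2"
  have \<mu>: "\<mu> \<ge> 0" "\<mu> * \<kappa>\<^sup>2 = L * norm e" using L0 \<kappa> by (auto simp: \<mu>_def)
  \<comment> \<open>Half of the radius is for the curve and half for the displacement, whence
    \<open>\<delta>0 * norm e = r\<close>.\<close>
  define r where "r = R / 2"
  define \<delta>0 where "\<delta>0 = r / norm e"
  have r: "r > 0" "r \<le> R" using R by (auto simp: r_def)
  have \<delta>0: "\<delta>0 > 0" "\<delta>0 * norm e = r" using r e0 by (auto simp: \<delta>0_def)
  define \<tau> where "\<tau> v = - (v \<bullet> (g c y0 *v e))" for v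
  define M where "M = norm (g c y0) * norm e"
  \<comment> \<open>Points of the ball of radius \<open>r\<close> differ by at most
    \<open>2 * r\<close>, hence \<open>\<tau>\<close> by at most \<open>2 * r * M\<close>; so
    \<open>C\<close> bounds the factor by which the displacement changes along a curve.\<close>
  define C where "C = exp (\<mu> * (2 * r * M))"
  have \<tau>_bound: "\<bar>\<tau> v\<bar> \<le> norm v * M" for v
    using abs_inner_matrix_le[of v "g c y0" e] by (simp add: \<tau>_def M_def mult.assoc)
  have in_R: "y + s *\<^sub>R e \<in> cball y0 R" if "y \<in> cball y0 r" "\<bar>s\<bar> \<le> \<delta>0" for y s
  proof -
    have "\<bar>s\<bar> * norm e \<le> r" using mult_right_mono[OF that(2), of "norm e"] \<delta>0 by simp
    then have "dist y (y + s *\<^sub>R e) \<le> r" by (simp add: dist_norm)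
    then show ?thesis using that(1) dist_triangle[of y0 "y + s *\<^sub>R e" y] by (simp add: r_def)
  qed
  have seg: "chron X A g T (psi y) (psi (y + \<delta> *\<^sub>R e))"
    if "0 < \<delta>" and "\<And>t. t \<in> {0..1} \<Longrightarrow> y + (t * \<delta>) *\<^sub>R e \<in> cball y0 R" for y \<delta>
    by (rule chron_segment) (use that e img in \<open>auto intro!: ftime_scaleR simp del: mem_cball\<close>)
  have seg_up: "chron X A g T (psi y) (psi (y + \<delta> *\<^sub>R e))"
    if y: "y \<in> cball y0 r" and d: "0 < \<delta>" "\<delta> \<le> \<delta>0" for y \<delta>
  proof (rule seg[OF d(1)])
    fix t :: real assume t: "t \<in> {0..1}"
    then have "t * \<delta> \<le> 1 * \<delta>" using d by (intro mult_right_mono) auto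
    moreover have "0 \<le> t * \<delta>" using t d by simp
    ultimately have "\<bar>t * \<delta>\<bar> \<le> \<delta>0" using d by linarith
    then show "y + (t * \<delta>) *\<^sub>R e \<in> cball y0 R" by (rule in_R[OF y])
  qed
  have seg_down: "chron X A g T (psi (y - \<delta> *\<^sub>R e)) (psi y)"
    if y: "y \<in> cball y0 r" and d: "0 < \<delta>" "\<delta> \<le> \<delta>0" for y \<delta>
  proof -
    have "chron X A g T (psi (y - \<delta> *\<^sub>R e)) (psi ((y - \<delta> *\<^sub>R e) + \<delta> *\<^sub>R e))"
    proof (rule seg[OF d(1)])
      fix t :: real assume t: "t \<in> {0..1}"
      then have "(1 - t) * \<delta> \<le> 1 * \<delta>" using d by (intro mult_right_mono) auto
      moreover have "0 \<le> (1 - t) * \<delta>" using t d by simp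
      ultimately have "\<bar>- ((1 - t) * \<delta>)\<bar> \<le> \<delta>0" using d by linarith
      then have "y + (- ((1 - t) * \<delta>)) *\<^sub>R e \<in> cball y0 R" by (rule in_R[OF y])
      then show "y - \<delta> *\<^sub>R e + (t * \<delta>) *\<^sub>R e \<in> cball y0 R" by (simp add: algebra_simps)
    qed
    then show ?thesis by simp
  qed
  have main: "chron X A g T (psi (phi (\<gamma> a) + s a *\<^sub>R e)) (psi (phi (\<gamma> b) + s b *\<^sub>R e))"
    if \<gamma>: "pw_curve X A g T future_timelike_vec \<gamma> a b"
      and in_r: "\<And>t. t \<in> {a..b} \<Longrightarrow> \<gamma> t \<in> dom \<and> phi (\<gamma> t) \<in> cball y0 r"
      and s_def: "s = (\<lambda>t. \<sigma> * \<delta> * exp (\<sigma> * \<mu> * (\<tau> (phi (\<gamma> t)) - \<tau>0)))"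
      and s_le: "\<And>t. t \<in> {a..b} \<Longrightarrow> \<bar>s t\<bar> \<le> \<delta>0" and \<sigma>: "\<sigma> = 1 \<or> \<sigma> = -1" and \<delta>: "0 < \<delta>"
    for \<gamma> a b s \<sigma> \<delta> \<tau>0
  proof -
    let ?R = "\<lambda>u u'. chron X A g T (psi (phi (\<gamma> u) + s u *\<^sub>R e)) (psi (phi (\<gamma> u') + s u' *\<^sub>R e))"
    obtain K where K: "finite K"
      "\<And>u u'. a \<le> u \<Longrightarrow> u < u' \<Longrightarrow> u' \<le> b \<Longrightarrow> {u<..<u'} \<inter> K = {} \<Longrightarrow> curve_piece A g T future_timelike_vec \<gamma> u u'"
      using \<gamma> by (rule pw_curveE) (rule that)
    show "?R a b"
    proof (rule finite_breaks_chain[OF K(1) pw_curve_less[OF \<gamma>]])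
      show "?R x y \<Longrightarrow> ?R y z \<Longrightarrow> ?R x z" for x y z by (rule chron_trans)
      fix u u' assume u: "a \<le> u" "u < u'" "u' \<le> b" "{u<..<u'} \<inter> K = {}"
      have sub: "t \<in> {a..b}" if "t \<in> {u..u'}" for t using u that by auto
      have all: "{t \<in> {u..u'}. \<gamma> t \<in> dom} = {u..u'}" using in_r sub by auto
      obtain D where D: "continuous_on {u..u'} D" "\<And>t. t\<in>{u..u'} \<Longrightarrow>
        ((phi \<circ> \<gamma>) has_vector_derivative D t) (at t within {u..u'}) \<and> ftime (phi (\<gamma> t)) (D t)"
        using K(2)[OF u, unfolded curve_piece_def, THEN bspec, OF chart, folded dom_def phi_def, unfolded all]
          in_r sub by blast
      have s': "(s has_real_derivative \<mu> * \<bar>s t\<bar> * \<tau> (D t)) (at t within {u..u'})" if t: "t \<in> {u..u'}" for t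
      proof -
        have "((\<lambda>t. phi (\<gamma> t)) has_vector_derivative D t) (at t within {u..u'})"
          using D(2)[OF t] by (simp add: o_def)
        then have "((\<lambda>t. \<tau> (phi (\<gamma> t))) has_vector_derivative \<tau> (D t)) (at t within {u..u'})"
          unfolding \<tau>_def by (intro has_vector_derivative_minus bounded_linear.has_vector_derivative[OF bounded_linear_inner_left])
        then have "((\<lambda>t. \<tau> (phi (\<gamma> t))) has_real_derivative \<tau> (D t)) (at t within {u..u'})"
          by (simp add: has_real_derivative_iff_has_vector_derivative)
        then have "(s has_real_derivative \<sigma> * \<delta> * (exp (\<sigma> * \<mu> * (\<tau> (phi (\<gamma> t)) - \<tau>0)) * (\<sigma> * \<mu> * \<tau> (D t)))) (at t within {u..u'})"
          unfolding s_def by (auto intro!: derivative_eq_intros)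
        \<comment> \<open>Both signs solve the same equation, because
          \<open>\<sigma> * \<sigma> = 1\<close> and \<open>\<delta>\<close> is positive.\<close>
        moreover have "\<sigma> * \<delta> * (exp (\<sigma> * \<mu> * (\<tau> (phi (\<gamma> t)) - \<tau>0)) * (\<sigma> * \<mu> * \<tau> (D t))) = \<mu> * \<bar>s t\<bar> * \<tau> (D t)"
          using \<sigma> \<delta> by (auto simp: s_def abs_mult)
        ultimately show ?thesis by simp
      qed
      have cs: "continuous_on {u..u'} s"
        using s' DERIV_continuous continuous_on_eq_continuous_within by blast
      show "?R u u'"
      proof (rule chron_psi[where D = "\<lambda>t. D t + (\<mu> * \<bar>s t\<bar> * \<tau> (D t)) *\<^sub>R e"])
        fix t assume t: "t \<in> {u..u'}"
        have "((\<lambda>t. phi (\<gamma> t)) has_vector_derivative D t) (at t within {u..u'})"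
          using D(2)[OF t] by (simp add: o_def)
        moreover have "((\<lambda>t. s t *\<^sub>R e) has_vector_derivative (\<mu> * \<bar>s t\<bar> * \<tau> (D t)) *\<^sub>R e) (at t within {u..u'})"
          using has_vector_derivative_scaleR[OF s'[OF t] has_vector_derivative_const[of e]] by simp
        ultimately show "((\<lambda>t. phi (\<gamma> t) + s t *\<^sub>R e) has_vector_derivative
            D t + (\<mu> * \<bar>s t\<bar> * \<tau> (D t)) *\<^sub>R e) (at t within {u..u'})"
          by (rule has_vector_derivative_add)
        have yr: "phi (\<gamma> t) \<in> cball y0 r" using in_r sub t by blast
        then have yR: "phi (\<gamma> t) \<in> cball y0 R" using r(2) by auto
        have y'R: "phi (\<gamma> t) + s t *\<^sub>R e \<in> cball y0 R" using in_R[OF yr s_le[OF sub[OF t]]] .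
        show "phi (\<gamma> t) + s t *\<^sub>R e \<in> img \<and> ftime (phi (\<gamma> t) + s t *\<^sub>R e) (D t + (\<mu> * \<bar>s t\<bar> * \<tau> (D t)) *\<^sub>R e)"
        proof
          show "phi (\<gamma> t) + s t *\<^sub>R e \<in> img" using y'R img by blast
          show "ftime (phi (\<gamma> t) + s t *\<^sub>R e) (D t + (\<mu> * \<bar>s t\<bar> * \<tau> (D t)) *\<^sub>R e)"
            unfolding \<tau>_def
            by (rule ftime_perturb[OF L0 \<kappa> img y0R L cone e \<mu> yR y'R conjunct2[OF D(2)[OF t]]])
        qed
      next
        show "continuous_on {u..u'} (\<lambda>t. D t + (\<mu> * \<bar>s t\<bar> * \<tau> (D t)) *\<^sub>R e)"
          unfolding \<tau>_def
          by (rule continuous_on_add[OF D(1) continuous_on_scaleR[OF continuous_on_mult[OF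
            continuous_on_mult[OF continuous_on_const continuous_on_rabs[OF cs]]
            continuous_on_minus[OF continuous_on_inner[OF D(1) continuous_on_const]]] continuous_on_const]])
      qed (rule u)
    qed
  qed
  show thesis
  proof (rule that[of r C \<delta>0 e])
    show "C > 0" by (simp add: C_def)
    show "cball y0 r \<subseteq> img" using img r by (meson order_trans subset_cball)
  next
    show "\<forall>y \<delta>. y \<in> cball y0 r \<longrightarrow> 0 < \<delta> \<longrightarrow> \<delta> \<le> \<delta>0 \<longrightarrow>
       y + \<delta> *\<^sub>R e \<in> img \<and> y - \<delta> *\<^sub>R e \<in> img \<and>
       chron X A g T (psi y) (psi (y + \<delta> *\<^sub>R e)) \<and> chron X A g T (psi (y - \<delta> *\<^sub>R e)) (psi y)"
    proof (intro allI impI)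
    fix y \<delta> assume y: "y \<in> cball y0 r" "0 < \<delta>" "\<delta> \<le> \<delta>0"
    have "y + \<delta> *\<^sub>R e \<in> img" "y + (- \<delta>) *\<^sub>R e \<in> img"
      using in_R[OF y(1), of \<delta>] in_R[OF y(1), of "- \<delta>"] y img by (auto simp del: mem_cball)
    then show "y + \<delta> *\<^sub>R e \<in> img \<and> y - \<delta> *\<^sub>R e \<in> img \<and>
       chron X A g T (psi y) (psi (y + \<delta> *\<^sub>R e)) \<and> chron X A g T (psi (y - \<delta> *\<^sub>R e)) (psi y)"
      using seg_up[OF y] seg_down[OF y] by simp
    qed
  next
    show "\<forall>\<gamma> a b \<delta>. pw_curve X A g T future_timelike_vec \<gamma> a b \<longrightarrow>
       (\<forall>t\<in>{a..b}. \<gamma> t \<in> dom \<and> phi (\<gamma> t) \<in> cball y0 r) \<longrightarrow> 0 < \<delta> \<longrightarrow> C * \<delta> \<le> \<delta>0 \<longrightarrow>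
       (\<exists>\<delta>'. 0 < \<delta>' \<and> \<delta>' \<le> C * \<delta> \<and>
          chron X A g T (psi (phi (\<gamma> a) - \<delta>' *\<^sub>R e)) (psi (phi (\<gamma> b) - \<delta> *\<^sub>R e))) \<and>
       (\<exists>\<delta>'. 0 < \<delta>' \<and> \<delta>' \<le> C * \<delta> \<and>
          chron X A g T (psi (phi (\<gamma> a) + \<delta> *\<^sub>R e)) (psi (phi (\<gamma> b) + \<delta>' *\<^sub>R e)))"
    proof (intro allI impI)
    fix \<gamma> a b \<delta> assume \<gamma>: "pw_curve X A g T future_timelike_vec \<gamma> a b"
      and "\<forall>t\<in>{a..b}. \<gamma> t \<in> dom \<and> phi (\<gamma> t) \<in> cball y0 r" and \<delta>: "0 < \<delta>" "C * \<delta> \<le> \<delta>0"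
    then have in_r: "\<And>t. t \<in> {a..b} \<Longrightarrow> \<gamma> t \<in> dom \<and> phi (\<gamma> t) \<in> cball y0 r" by blast
    have ab: "a < b" using \<gamma> by (rule pw_curve_less)
    have ex: "exp (\<sigma> * \<mu> * (\<tau> (phi (\<gamma> t)) - \<tau> (phi (\<gamma> t')))) \<le> C"
      if "t \<in> {a..b}" "t' \<in> {a..b}" "\<sigma> = 1 \<or> \<sigma> = -1" for t t' \<sigma>
    proof -
      have "norm (phi (\<gamma> t) - phi (\<gamma> t')) \<le> 2 * r"
        using in_r[OF that(1)] in_r[OF that(2)] dist_triangle_le[of "phi (\<gamma> t)" y0 "phi (\<gamma> t')" "2 * r"]
        by (auto simp: dist_norm norm_minus_commute)
      moreover have "M \<ge> 0" by (simp add: M_def)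
      ultimately have "\<bar>\<tau> (phi (\<gamma> t) - phi (\<gamma> t'))\<bar> \<le> 2 * r * M"
        using \<tau>_bound[of "phi (\<gamma> t) - phi (\<gamma> t')"] mult_right_mono order_trans by blast
      then have "\<sigma> * (\<tau> (phi (\<gamma> t)) - \<tau> (phi (\<gamma> t'))) \<le> 2 * r * M"
        using that(3) by (auto simp: \<tau>_def inner_diff_left)
      from mult_left_mono[OF this \<mu>(1)] show ?thesis by (simp add: C_def algebra_simps)
    qed
    show "(\<exists>\<delta>'. 0 < \<delta>' \<and> \<delta>' \<le> C * \<delta> \<and>
          chron X A g T (psi (phi (\<gamma> a) - \<delta>' *\<^sub>R e)) (psi (phi (\<gamma> b) - \<delta> *\<^sub>R e))) \<and>
       (\<exists>\<delta>'. 0 < \<delta>' \<and> \<delta>' \<le> C * \<delta> \<and>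
          chron X A g T (psi (phi (\<gamma> a) + \<delta> *\<^sub>R e)) (psi (phi (\<gamma> b) + \<delta>' *\<^sub>R e)))"
    proof (rule conjI)
      \<comment> \<open>The prescribed end is the one whose displaced position will be compared with
        a given point; at the other end a bound suffices. Hence normalisation at \<open>b\<close>
        for backward and at \<open>a\<close> for forward displacements.\<close>
      define s where "s t = (-1) * \<delta> * exp ((-1) * \<mu> * (\<tau> (phi (\<gamma> t)) - \<tau> (phi (\<gamma> b))))" for t
      have s: "\<bar>s t\<bar> \<le> C * \<delta>" if "t \<in> {a..b}" for t
        using mult_left_mono[OF ex[OF that, of b "-1"], of \<delta>] ab \<delta> by (simp add: s_def abs_mult mult.commute)
      have "chron X A g T (psi (phi (\<gamma> a) + s a *\<^sub>R e)) (psi (phi (\<gamma> b) + s b *\<^sub>R e))"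
        by (rule main[OF \<gamma> in_r ext[OF s_def] order_trans[OF s \<delta>(2)] _ \<delta>(1)]) simp_all
      moreover have "s b = - \<delta>" "s a < 0" "- s a \<le> C * \<delta>" using s[of a] ab \<delta> by (auto simp: s_def)
      ultimately show "\<exists>\<delta>'. 0 < \<delta>' \<and> \<delta>' \<le> C * \<delta> \<and>
          chron X A g T (psi (phi (\<gamma> a) - \<delta>' *\<^sub>R e)) (psi (phi (\<gamma> b) - \<delta> *\<^sub>R e))"
        by (intro exI[of _ "- s a"]) simp
    next
      define s where "s t = 1 * \<delta> * exp (1 * \<mu> * (\<tau> (phi (\<gamma> t)) - \<tau> (phi (\<gamma> a))))" for t
      have s: "\<bar>s t\<bar> \<le> C * \<delta>" if "t \<in> {a..b}" for t
        using mult_left_mono[OF ex[OF that, of a 1], of \<delta>] ab \<delta> by (simp add: s_def abs_mult mult.commute)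
      have "chron X A g T (psi (phi (\<gamma> a) + s a *\<^sub>R e)) (psi (phi (\<gamma> b) + s b *\<^sub>R e))"
        by (rule main[OF \<gamma> in_r ext[OF s_def] order_trans[OF s \<delta>(2)] _ \<delta>(1)]) simp_all
      moreover have "s a = \<delta>" "s b > 0" "s b \<le> C * \<delta>" using s[of b] ab \<delta> by (auto simp: s_def)
      ultimately show "\<exists>\<delta>'. 0 < \<delta>' \<and> \<delta>' \<le> C * \<delta> \<and>
          chron X A g T (psi (phi (\<gamma> a) + \<delta> *\<^sub>R e)) (psi (phi (\<gamma> b) + \<delta>' *\<^sub>R e))"
        by (intro exI[of _ "s b"]) simp
    qed
    qed
  qed (use r \<delta>0 in auto)
qed

end

section \<open>Local causality\<close>

lemma (in spacetime_chart) coordinate_ball: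
  assumes "openin X V" "q \<in> dom" "q \<in> V"
  obtains \<rho> where "\<rho> > 0" "cball (phi q) \<rho> \<subseteq> {y \<in> img. psi y \<in> V}"
proof -
  have "phi q \<in> {y \<in> img. psi y \<in> V}" using assms psi_phi phi_img by simp
  then show thesis
    using open_contains_cball[THEN iffD1, OF open_psi_preimage[OF assms(1)], THEN bspec] that by blast
qed

lemma small_displacement:
  assumes "(C::real) > 0" "\<delta>0 > 0" "\<rho> > 0"
  obtains \<delta> where "0 < \<delta>" "\<delta> \<le> \<delta>0" "C * \<delta> \<le> \<delta>0" "C * \<delta> * norm e < \<rho>"
proof -
  \<comment> \<open>\<open>norm e + 1\<close> avoids a division by zero, and the factor 2 makes the
    last bound strict.\<close>
  define \<delta> where "\<delta> = min \<delta>0 (min (\<delta>0 / C) (\<rho> / (2 * C * (norm e + 1))))"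
  have ne: "norm e + 1 > 0" by (simp add: add_nonneg_pos)
  show thesis
  proof (rule that[of \<delta>])
    show pos: "0 < \<delta>" using assms ne by (simp add: \<delta>_def)
    have "\<delta> \<le> \<delta>0 / C" by (simp add: \<delta>_def)
    then show "C * \<delta> \<le> \<delta>0" using assms by (simp add: field_simps)
    have "\<delta> \<le> \<rho> / (2 * C * (norm e + 1))" by (simp add: \<delta>_def)
    then have "\<delta> * (2 * C * (norm e + 1)) \<le> \<rho>"
      using assms ne by (subst pos_le_divide_eq[symmetric]) auto
    then have "C * \<delta> * (norm e + 1) \<le> \<rho> / 2" by (simp add: algebra_simps)
    moreover have "C * \<delta> * norm e \<le> C * \<delta> * (norm e + 1)" using assms pos by (intro mult_left_mono) auto
    ultimately show "C * \<delta> * norm e < \<rho>" using assms by linarith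
  qed (simp add: \<delta>_def)
qed

text \<open>The exit parameter is the infimum of the closed set of parameters outside
  \<open>U\<close>. Before it the curve is in \<open>U\<close>, so the closed set \<open>K\<close>
  contains the curve up to and including that parameter.\<close>

lemma pw_curve_first_exit:
  assumes \<gamma>: "pw_curve X A g T Q \<gamma> a b" and U: "openin X U" and K: "closedin X K" "U \<subseteq> K"
    and "\<gamma> a \<in> U" "\<gamma> b \<notin> U"
  obtains t where "a < t" "t \<le> b" "\<gamma> t \<in> K - U" "\<And>s. s \<in> {a..t} \<Longrightarrow> \<gamma> s \<in> K"
proof -
  have ab: "a < b" using \<gamma> by (rule pw_curve_less)
  have cont: "continuous_map (top_of_set {a..b}) X \<gamma>" using \<gamma> by (rule pw_curve_continuous)
  define S where "S = {s \<in> {a..b}. \<gamma> s \<notin> U}"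
  define F where "F = {s \<in> {a..b}. \<gamma> s \<in> K}"
  have "closedin (top_of_set {a..b}) {s \<in> topspace (top_of_set {a..b}). \<gamma> s \<in> topspace X - U}"
    by (rule closedin_continuous_map_preimage[OF cont closedin_diff[OF closedin_topspace U]])
  moreover have "{s \<in> topspace (top_of_set {a..b}). \<gamma> s \<in> topspace X - U} = S"
    using pw_curve_in_topspace[OF \<gamma>] by (auto simp: S_def)
  ultimately have S: "closed S" using closed_atLeastAtMost closedin_closed_eq by metis
  have "closedin (top_of_set {a..b}) {s \<in> topspace (top_of_set {a..b}). \<gamma> s \<in> K}"
    by (rule closedin_continuous_map_preimage[OF cont K(1)])
  then have F: "closed F" unfolding F_def using closed_atLeastAtMost closedin_closed_eq by fastforce
  have bS: "b \<in> S" using assms ab by (simp add: S_def)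
  have bdd: "bdd_below S" by (intro bdd_belowI[of _ a]) (simp add: S_def)
  define t where "t = Inf S"
  have tS: "t \<in> S" unfolding t_def using bS bdd S by (intro closed_contains_Inf) auto
  have before: "\<gamma> s \<in> U" if "a \<le> s" "s < t" for s
  proof (rule ccontr)
    assume "\<gamma> s \<notin> U"
    then have "s \<in> S" using that tS by (simp add: S_def)
    then have "t \<le> s" unfolding t_def using bdd by (rule cInf_lower)
    then show False using that by simp
  qed
  have at: "a < t" using tS assms(5) by (auto simp: S_def order_less_le)
  have "{a..<t} \<subseteq> F" using before K(2) tS by (auto simp: F_def S_def)
  then have "closure {a..<t} \<subseteq> F" using F by (rule closure_minimal)
  then have "{a..t} \<subseteq> F" using at by simp
  then show thesis using that[OF at] tS at by (auto simp: S_def F_def subset_iff)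
qed

lemma chron_approach_past:
  assumes st: "spacetime X A g T" and p: "p \<in> topspace X"
  shows "\<exists>a. limitin X a p sequentially \<and> (\<forall>n. chron X A g T (a n) p)"
proof -
  obtain c where c: "spacetime_chart X A g T c" "p \<in> fst c"
    using spacetime_chart_exists[OF st p] by blast
  interpret spacetime_chart X A g T c by (rule c(1))
  have pd: "p \<in> dom" using c(2) by (simp add: dom_def)
  obtain r C \<delta>0 e where pert: "\<forall>\<gamma> a b \<delta>. pw_curve X A g T future_timelike_vec \<gamma> a b \<longrightarrow>
       (\<forall>t\<in>{a..b}. \<gamma> t \<in> dom \<and> phi (\<gamma> t) \<in> cball (phi p) r) \<longrightarrow> 0 < \<delta> \<longrightarrow> C * \<delta> \<le> \<delta>0 \<longrightarrow>
       (\<exists>\<delta>'. 0 < \<delta>' \<and> \<delta>' \<le> C * \<delta> \<and>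
          chron X A g T (psi (phi (\<gamma> a) - \<delta>' *\<^sub>R e)) (psi (phi (\<gamma> b) - \<delta> *\<^sub>R e))) \<and>
       (\<exists>\<delta>'. 0 < \<delta>' \<and> \<delta>' \<le> C * \<delta> \<and>
          chron X A g T (psi (phi (\<gamma> a) + \<delta> *\<^sub>R e)) (psi (phi (\<gamma> b) + \<delta>' *\<^sub>R e)))"
    and shift: "\<forall>y \<delta>. y \<in> cball (phi p) r \<longrightarrow> 0 < \<delta> \<longrightarrow> \<delta> \<le> \<delta>0 \<longrightarrow>
       y + \<delta> *\<^sub>R e \<in> img \<and> y - \<delta> *\<^sub>R e \<in> img \<and>
       chron X A g T (psi y) (psi (y + \<delta> *\<^sub>R e)) \<and> chron X A g T (psi (y - \<delta> *\<^sub>R e)) (psi y)"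
    and r: "r > 0" "C > 0" "\<delta>0 > 0" "cball (phi p) r \<subseteq> img"
    by (rule curve_perturbation[OF phi_img[OF pd]]) (rule that)
  have "(\<lambda>n. phi p - (\<delta>0 * inverse (real (Suc n))) *\<^sub>R e) \<longlonglongrightarrow> phi p - (\<delta>0 * 0) *\<^sub>R e"
    by (intro tendsto_intros LIMSEQ_inverse_real_of_nat)
  then have "limitin X (\<lambda>n. psi (phi p - (\<delta>0 * inverse (real (Suc n))) *\<^sub>R e)) (psi (phi p)) sequentially"
    using phi_img[OF pd] by (intro limitin_psi) auto
  moreover have "chron X A g T (psi (phi p - (\<delta>0 * inverse (real (Suc n))) *\<^sub>R e)) p" for n
  proof -
    have "inverse (real (Suc n)) \<le> 1" by (simp add: field_simps)
    then have "\<delta>0 * inverse (real (Suc n)) \<le> \<delta>0" using r(3) mult_left_mono[of _ 1 \<delta>0] by simp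
    then show ?thesis using shift[rule_format, of "phi p" "\<delta>0 * inverse (real (Suc n))"] r psi_phi[OF pd] by simp
  qed
  ultimately show ?thesis unfolding psi_phi[OF pd]
    by (intro exI[of _ "\<lambda>n. psi (phi p - (\<delta>0 * inverse (real (Suc n))) *\<^sub>R e)"] conjI allI)
qed

lemma chron_approach_future:
  assumes "spacetime X A g T" and "p \<in> topspace X"
  shows "\<exists>a. limitin X a p sequentially \<and> (\<forall>n. chron X A g T p (a n))"
  using chron_approach_past[OF spacetime_time_reversal[OF assms(1)] assms(2)] by (simp add: chron_time_reversal)

text \<open>The parameters at which the curve is in \<open>V\<close> form a connected set of reals
  containing both ends, hence the whole interval. Timelike curves qualify because they are
  causal.\<close>

lemma strongly_causal_convex_nbhd:
  assumes sc: "strongly_causal_spacetime X A g T" and U: "openin X U" "p \<in> U"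
  obtains V where "openin X V" "p \<in> V" "V \<subseteq> U"
    "\<And>\<gamma> a b t. pw_curve X A g T future_timelike_vec \<gamma> a b \<Longrightarrow> \<gamma> a \<in> V \<Longrightarrow> \<gamma> b \<in> V \<Longrightarrow> t \<in> {a..b} \<Longrightarrow> \<gamma> t \<in> V"
proof -
  have "p \<in> topspace X" using U openin_subset by blast
  with U sc[unfolded strongly_causal_spacetime_def, THEN conjunct2, THEN bspec, THEN spec, THEN mp]
  obtain V where V: "openin X V" "p \<in> V" "V \<subseteq> U"
    "\<And>\<gamma> a b. pw_curve X A g T future_causal_vec \<gamma> a b \<Longrightarrow> connected {t\<in>{a..b}. \<gamma> t \<in> V}"
    by metis
  show thesis
  proof (rule that[OF V(1-3)])
    fix \<gamma> a b t assume \<gamma>: "pw_curve X A g T future_timelike_vec \<gamma> a b" "\<gamma> a \<in> V" "\<gamma> b \<in> V" "t \<in> {a..b}"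
    have "pw_curve X A g T future_causal_vec (\<lambda>t. \<gamma> (1 * t + 0)) a b"
    proof (rule pw_curve_affine[OF \<gamma>(1)])
      fix c y v assume "future_timelike_vec (g c y) (T c y) v"
      then show "future_causal_vec (g c y) (T c y) (1 *\<^sub>R v)"
        by (auto simp: future_timelike_vec_def future_causal_vec_def)
    qed simp
    then have "connected {t\<in>{a..b}. \<gamma> t \<in> V}" using V(4) by simp
    moreover have "a \<in> {t\<in>{a..b}. \<gamma> t \<in> V}" "b \<in> {t\<in>{a..b}. \<gamma> t \<in> V}" using \<gamma> by auto
    ultimately show "\<gamma> t \<in> V"
      using \<gamma>(4) connected_contains_Icc[of "{t\<in>{a..b}. \<gamma> t \<in> V}" a b] by blast
  qed
qed

text \<open>Take \<open>q\<close> and \<open>r\<close> in a neighbourhood that timelike curves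
  cannot leave and re-enter: a curve from \<open>q\<close> through \<open>s\<close> to
  \<open>r\<close> stays in it.\<close>

lemma chron_diamond_nbhd:
  assumes sc: "strongly_causal_spacetime X A g T" and U: "openin X U" "p \<in> U"
  shows "\<exists>q r. chron X A g T q p \<and> chron X A g T p r \<and> (\<forall>s. chron X A g T q s \<longrightarrow> chron X A g T s r \<longrightarrow> s \<in> U)"
proof -
  have st: "spacetime X A g T" using sc unfolding strongly_causal_spacetime_def by blast
  obtain V where V: "openin X V" "p \<in> V" "V \<subseteq> U"
    "\<And>\<gamma> a b t. pw_curve X A g T future_timelike_vec \<gamma> a b \<Longrightarrow> \<gamma> a \<in> V \<Longrightarrow> \<gamma> b \<in> V \<Longrightarrow> t \<in> {a..b} \<Longrightarrow> \<gamma> t \<in> V"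
    using strongly_causal_convex_nbhd[OF sc U] by metis
  have p: "p \<in> topspace X" using U openin_subset by blast
  obtain a where a: "limitin X a p sequentially" "\<And>n. chron X A g T (a n) p"
    using chron_approach_past[OF st p] by blast
  obtain b where b: "limitin X b p sequentially" "\<And>n. chron X A g T p (b n)"
    using chron_approach_future[OF st p] by blast
  obtain m where m: "a m \<in> V" using a(1) V unfolding limitin_def eventually_sequentially by blast
  obtain n where n: "b n \<in> V" using b(1) V unfolding limitin_def eventually_sequentially by blast
  have "s \<in> U" if s: "chron X A g T (a m) s" "chron X A g T s (b n)" for s
  proof -
    obtain \<gamma> x y t where \<gamma>: "pw_curve X A g T future_timelike_vec \<gamma> x y" "t \<in> {x..y}"
      "\<gamma> x = a m" "\<gamma> t = s" "\<gamma> y = b n"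
      by (rule chron_concat[OF s])
    have "\<gamma> t \<in> V" by (rule V(4)[OF \<gamma>(1) _ _ \<gamma>(2)]) (use \<gamma> m n in simp_all)
    then show ?thesis using V(3) \<gamma>(4) by blast
  qed
  then show ?thesis using a(2) b(2) by blast
qed

text \<open>A local push-up property in which the causal relation is replaced by a limit of
  chronological ones. Strong causality confines a curve from \<open>a\<close> near \<open>p\<close>
  to \<open>b\<close> to the coordinate ball. Displaced forward, it starts in the future of
  \<open>p\<close> and ends close enough to \<open>b\<close> to precede \<open>z\<close>.\<close>

lemma chron_push_future:
  assumes sc: "strongly_causal_spacetime X A g T" and p: "p \<in> topspace X"
  shows "\<exists>U. openin X U \<and> p \<in> U \<and>
    (\<forall>b z. b \<in> U \<longrightarrow> p \<in> X closure_of {a. chron X A g T a b} \<longrightarrow> chron X A g T b z \<longrightarrow> chron X A g T p z)"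
proof -
  have st: "spacetime X A g T" using sc unfolding strongly_causal_spacetime_def by blast
  obtain c where c: "spacetime_chart X A g T c" "p \<in> fst c"
    using spacetime_chart_exists[OF st p] by blast
  interpret spacetime_chart X A g T c by (rule c(1))
  have pd: "p \<in> dom" using c(2) by (simp add: dom_def)
  obtain r C \<delta>0 e where pert: "\<forall>\<gamma> a b \<delta>. pw_curve X A g T future_timelike_vec \<gamma> a b \<longrightarrow>
       (\<forall>t\<in>{a..b}. \<gamma> t \<in> dom \<and> phi (\<gamma> t) \<in> cball (phi p) r) \<longrightarrow> 0 < \<delta> \<longrightarrow> C * \<delta> \<le> \<delta>0 \<longrightarrow>
       (\<exists>\<delta>'. 0 < \<delta>' \<and> \<delta>' \<le> C * \<delta> \<and>
          chron X A g T (psi (phi (\<gamma> a) - \<delta>' *\<^sub>R e)) (psi (phi (\<gamma> b) - \<delta> *\<^sub>R e))) \<and>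
       (\<exists>\<delta>'. 0 < \<delta>' \<and> \<delta>' \<le> C * \<delta> \<and>
          chron X A g T (psi (phi (\<gamma> a) + \<delta> *\<^sub>R e)) (psi (phi (\<gamma> b) + \<delta>' *\<^sub>R e)))"
    and shift: "\<forall>y \<delta>. y \<in> cball (phi p) r \<longrightarrow> 0 < \<delta> \<longrightarrow> \<delta> \<le> \<delta>0 \<longrightarrow>
       y + \<delta> *\<^sub>R e \<in> img \<and> y - \<delta> *\<^sub>R e \<in> img \<and>
       chron X A g T (psi y) (psi (y + \<delta> *\<^sub>R e)) \<and> chron X A g T (psi (y - \<delta> *\<^sub>R e)) (psi y)"
    and r: "r > 0" "C > 0" "\<delta>0 > 0" "cball (phi p) r \<subseteq> img"
    by (rule curve_perturbation[OF phi_img[OF pd]]) (rule that)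
  define B where "B = {q \<in> dom. phi q \<in> ball (phi p) r}"
  have B: "openin X B" "p \<in> B"
  proof -
    show "openin X B" unfolding B_def by (rule openin_phi_preimage[OF open_ball])
    show "p \<in> B" using pd r by (simp add: B_def)
  qed
  obtain V where V: "openin X V" "p \<in> V" "V \<subseteq> B"
    "\<And>\<gamma> a b t. pw_curve X A g T future_timelike_vec \<gamma> a b \<Longrightarrow> \<gamma> a \<in> V \<Longrightarrow> \<gamma> b \<in> V \<Longrightarrow> t \<in> {a..b} \<Longrightarrow> \<gamma> t \<in> V"
    using strongly_causal_convex_nbhd[OF sc B] by metis
  have "chron X A g T p z"
    if b: "b \<in> V" and cl: "p \<in> X closure_of {a. chron X A g T a b}" and z: "chron X A g T b z" for b z
  proof -
    have bd: "b \<in> dom" using b V(3) by (auto simp: B_def)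
    obtain \<rho> where \<rho>: "\<rho> > 0" "cball (phi b) \<rho> \<subseteq> {y \<in> img. psi y \<in> {q. chron X A g T q z}}"
      using coordinate_ball[OF openin_chron_past[OF st, of z] bd] z by auto
    obtain \<delta> where \<delta>: "0 < \<delta>" "\<delta> \<le> \<delta>0" "C * \<delta> \<le> \<delta>0" and \<delta>\<rho>: "C * \<delta> * norm e < \<rho>"
      by (rule small_displacement[OF r(2,3) \<rho>(1)])
    \<comment> \<open>Displacing \<open>p\<close> by \<open>\<delta> *\<^sub>R e\<close> gives a
      point of its open future; \<open>N\<close> collects the points of \<open>V\<close> whose
      displaced position still lies in it.\<close>
    define N where "N = {q \<in> dom. phi q \<in> (\<lambda>y. y + \<delta> *\<^sub>R e) -` {y \<in> img. psi y \<in> {q. chron X A g T p q}}} \<inter> V"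
    have "openin X N" unfolding N_def
      by (intro openin_Int V(1) openin_phi_preimage open_vimage continuous_intros open_psi_preimage openin_chron_future st)
    moreover have "p \<in> N" unfolding N_def using pd V(2) shift[rule_format, of "phi p" \<delta>] \<delta> r psi_phi[OF pd] by simp
    ultimately obtain a where a: "a \<in> N" "chron X A g T a b"
      using cl unfolding in_closure_of by blast
    obtain \<gamma> s t where \<gamma>: "pw_curve X A g T future_timelike_vec \<gamma> s t" "\<gamma> s = a" "\<gamma> t = b"
      using a(2) unfolding chron_def by blast
    have "\<gamma> x \<in> dom \<and> phi (\<gamma> x) \<in> cball (phi p) r" if "x \<in> {s..t}" for x
      using V(4)[OF \<gamma>(1) _ _ that] \<gamma>(2,3) a(1) b V(3) by (auto simp: N_def B_def)
    from pert[rule_format, OF \<gamma>(1) this \<delta>(1,3), THEN conjunct2] \<gamma>(2,3)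
    obtain \<delta>' where \<delta>': "0 < \<delta>'" "\<delta>' \<le> C * \<delta>" "chron X A g T (psi (phi a + \<delta> *\<^sub>R e)) (psi (phi b + \<delta>' *\<^sub>R e))"
      by auto
    have 1: "chron X A g T p (psi (phi a + \<delta> *\<^sub>R e))" using a(1) by (simp add: N_def)
    have 2: "chron X A g T (psi (phi b + \<delta>' *\<^sub>R e)) z"
    proof -
      have "\<delta>' * norm e \<le> C * \<delta> * norm e" using \<delta>' by (intro mult_right_mono) auto
      then have "phi b + \<delta>' *\<^sub>R e \<in> cball (phi b) \<rho>" using \<delta>\<rho> \<delta>' by (simp add: dist_norm)
      then show ?thesis using \<rho>(2) by blast
    qed
    show ?thesis by (rule chron_trans[OF 1 chron_trans[OF \<delta>'(3) 2]])
  qed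
  then show ?thesis using V(1,2) by blast
qed

lemma chron_push_past:
  assumes "strongly_causal_spacetime X A g T" and "p \<in> topspace X"
  shows "\<exists>U. openin X U \<and> p \<in> U \<and>
    (\<forall>b z. b \<in> U \<longrightarrow> p \<in> X closure_of {a. chron X A g T b a} \<longrightarrow> chron X A g T z b \<longrightarrow> chron X A g T z p)"
  using chron_push_future[OF strongly_causal_spacetime_time_reversal[OF assms(1)] assms(2)]
  by (simp only: chron_time_reversal)

text \<open>Each curve is cut where it first leaves a coordinate ball, so the perturbation applies
  without any causality condition. The exit points lie on the sphere, which is compact and misses
  \<open>p\<close>. That \<open>z\<close> inherits the past of \<open>p\<close> comes from
  displacing the cut curves backward; that points before \<open>z\<close> are often before
  \<open>b n\<close> comes from openness of futures.\<close>

lemma chron_exit_future: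
  assumes st: "spacetime X A g T" and W: "openin X W" "p \<in> W"
  shows "\<exists>U K. openin X U \<and> compactin X K \<and> p \<in> U \<and> U \<subseteq> K \<and> K \<subseteq> W \<and>
    (\<forall>a b. limitin X a p sequentially \<longrightarrow> (\<forall>n. chron X A g T (a n) (b n) \<and> b n \<notin> U) \<longrightarrow>
      (\<exists>z\<in>topspace X. z \<noteq> p \<and> (\<forall>u. chron X A g T u p \<longrightarrow> chron X A g T u z) \<and>
        (\<forall>u. chron X A g T u z \<longrightarrow> frequently (\<lambda>n. chron X A g T u (b n)) sequentially)))"
proof -
  have p: "p \<in> topspace X" using W openin_subset by blast
  obtain c where c: "spacetime_chart X A g T c" "p \<in> fst c"
    using spacetime_chart_exists[OF st p] by blast
  interpret spacetime_chart X A g T c by (rule c(1))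
  have pd: "p \<in> dom" using c(2) by (simp add: dom_def)
  obtain r C \<delta>0 e where pert: "\<forall>\<gamma> a b \<delta>. pw_curve X A g T future_timelike_vec \<gamma> a b \<longrightarrow>
       (\<forall>t\<in>{a..b}. \<gamma> t \<in> dom \<and> phi (\<gamma> t) \<in> cball (phi p) r) \<longrightarrow> 0 < \<delta> \<longrightarrow> C * \<delta> \<le> \<delta>0 \<longrightarrow>
       (\<exists>\<delta>'. 0 < \<delta>' \<and> \<delta>' \<le> C * \<delta> \<and>
          chron X A g T (psi (phi (\<gamma> a) - \<delta>' *\<^sub>R e)) (psi (phi (\<gamma> b) - \<delta> *\<^sub>R e))) \<and>
       (\<exists>\<delta>'. 0 < \<delta>' \<and> \<delta>' \<le> C * \<delta> \<and>
          chron X A g T (psi (phi (\<gamma> a) + \<delta> *\<^sub>R e)) (psi (phi (\<gamma> b) + \<delta>' *\<^sub>R e)))"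
    and shift: "\<forall>y \<delta>. y \<in> cball (phi p) r \<longrightarrow> 0 < \<delta> \<longrightarrow> \<delta> \<le> \<delta>0 \<longrightarrow>
       y + \<delta> *\<^sub>R e \<in> img \<and> y - \<delta> *\<^sub>R e \<in> img \<and>
       chron X A g T (psi y) (psi (y + \<delta> *\<^sub>R e)) \<and> chron X A g T (psi (y - \<delta> *\<^sub>R e)) (psi y)"
    and r: "r > 0" "C > 0" "\<delta>0 > 0" "cball (phi p) r \<subseteq> img"
    by (rule curve_perturbation[OF phi_img[OF pd]]) (rule that)
  obtain r1 where r1: "r1 > 0" "cball (phi p) r1 \<subseteq> {y \<in> img. psi y \<in> W}"
    using coordinate_ball[OF W(1) pd W(2)] by blast
  define r' where "r' = min r r1"
  have r': "r' > 0" "r' \<le> r" "cball (phi p) r' \<subseteq> img" "psi ` cball (phi p) r' \<subseteq> W"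
    using r r1 by (auto simp: r'_def)
  define U where "U = {q \<in> dom. phi q \<in> ball (phi p) r'}"
  define K where "K = psi ` cball (phi p) r'"
  have U: "openin X U" unfolding U_def by (rule openin_phi_preimage) simp
  have pU: "p \<in> U" using pd r' by (simp add: U_def)
  have UK: "U \<subseteq> K"
  proof
    fix q assume "q \<in> U"
    then show "q \<in> K" unfolding K_def using psi_phi[of q] by (intro image_eqI[of _ _ "phi q"]) (auto simp: U_def)
  qed
  have K: "compactin X K" unfolding K_def
    by (rule image_compactin[OF _ continuous_psi]) (use r'(3) in \<open>simp add: compactin_subtopology\<close>)
  have haus: "Hausdorff_space X" using manifold unfolding smooth_manifold_def by (elim conjE)
  have clK: "closedin X K" by (rule compactin_imp_closedin[OF haus K])
  have Kd: "q \<in> dom" "phi q \<in> cball (phi p) r'" if "q \<in> K" for q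
    using that r'(3) phi_psi psi_dom unfolding K_def by (auto simp: subset_iff)
  have "\<exists>z\<in>topspace X. z \<noteq> p \<and> (\<forall>u. chron X A g T u p \<longrightarrow> chron X A g T u z) \<and>
        (\<forall>u. chron X A g T u z \<longrightarrow> frequently (\<lambda>n. chron X A g T u (b n)) sequentially)"
    if a: "limitin X a p sequentially" and ab: "\<And>n. chron X A g T (a n) (b n)" and bU: "\<And>n. b n \<notin> U" for a b
  proof -
    obtain n0 where n0: "\<And>n. n \<ge> n0 \<Longrightarrow> a n \<in> U"
      using a U pU unfolding limitin_def eventually_sequentially by blast
    have "\<exists>\<zeta>. \<zeta> \<in> K - U \<and> (\<zeta> = b n \<or> chron X A g T \<zeta> (b n)) \<and>
        (\<exists>\<gamma> s t. pw_curve X A g T future_timelike_vec \<gamma> s t \<and> \<gamma> s = a n \<and> \<gamma> t = \<zeta> \<and> (\<forall>x\<in>{s..t}. \<gamma> x \<in> K))"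
      if "n \<ge> n0" for n
    proof -
      obtain \<gamma> s t where \<gamma>: "pw_curve X A g T future_timelike_vec \<gamma> s t" "\<gamma> s = a n" "\<gamma> t = b n"
        using ab[of n] unfolding chron_def by blast
      have s: "\<gamma> s \<in> U" "\<gamma> t \<notin> U" using n0[OF that] bU \<gamma> by simp_all
      obtain x where x: "s < x" "x \<le> t" "\<gamma> x \<in> K - U" "\<And>y. y \<in> {s..x} \<Longrightarrow> \<gamma> y \<in> K"
        by (rule pw_curve_first_exit[OF \<gamma>(1) U clK UK s]) (rule that)
      have "\<gamma> x = b n \<or> chron X A g T (\<gamma> x) (b n)"
        using pw_curve_imp_chron[OF \<gamma>(1), of x t] x \<gamma>(3) by (cases "x = t") auto
      moreover have "pw_curve X A g T future_timelike_vec \<gamma> s x"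
        using pw_curve_restrict[OF \<gamma>(1)] x by simp
      ultimately show ?thesis using x(3,4) \<gamma>(2)
        by (intro exI[of _ "\<gamma> x"] conjI exI[of _ \<gamma>] exI[of _ s] exI[of _ x] ballI) simp_all
    qed
    then obtain \<zeta> where \<zeta>: "\<And>n. n \<ge> n0 \<Longrightarrow> \<zeta> n \<in> K - U"
        "\<And>n. n \<ge> n0 \<Longrightarrow> \<zeta> n = b n \<or> chron X A g T (\<zeta> n) (b n)"
        "\<And>n. n \<ge> n0 \<Longrightarrow> \<exists>\<gamma> s t. pw_curve X A g T future_timelike_vec \<gamma> s t \<and> \<gamma> s = a n \<and> \<gamma> t = \<zeta> n \<and> (\<forall>x\<in>{s..t}. \<gamma> x \<in> K)"
      by metis
    define S where "S = cball (phi p) r' - ball (phi p) r'"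
    have "compact S" unfolding S_def by (intro compact_diff) auto
    moreover have "\<forall>n. phi (\<zeta> (n0 + n)) \<in> S"
    proof
      fix n show "phi (\<zeta> (n0 + n)) \<in> S"
        using \<zeta>(1)[of "n0 + n"] Kd[of "\<zeta> (n0 + n)"] by (auto simp: S_def U_def)
    qed
    ultimately obtain y \<sigma> where y: "y \<in> S" and \<sigma>: "strict_mono \<sigma>"
      and lim: "((\<lambda>n. phi (\<zeta> (n0 + n))) \<circ> \<sigma>) \<longlonglongrightarrow> y"
      unfolding compact_eq_seq_compact_metric seq_compact_def by metis
    define N where "N k = n0 + \<sigma> k" for k
    have N: "strict_mono N" using \<sigma> by (auto simp: N_def strict_mono_def)
    have N0: "N k \<ge> n0" for k by (simp add: N_def)
    have lim: "(\<lambda>k. phi (\<zeta> (N k))) \<longlonglongrightarrow> y" using lim by (simp add: N_def o_def)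
    have yi: "y \<in> img" "y \<in> cball (phi p) r" using y r' by (auto simp: S_def)
    define z where "z = psi y"
    have zd: "z \<in> dom" "phi z = y" using psi_dom phi_psi yi by (auto simp: z_def)
    have "limitin X (\<lambda>k. psi (phi (\<zeta> (N k)))) z sequentially"
      unfolding z_def by (rule limitin_psi[OF lim yi(1)])
    moreover have "psi (phi (\<zeta> (N k))) = \<zeta> (N k)" for k
      using psi_phi Kd \<zeta>(1)[OF N0] by blast
    ultimately have zlim: "limitin X (\<lambda>k. \<zeta> (N k)) z sequentially" by simp
    have aN: "limitin X (\<lambda>k. a (N k)) p sequentially"
      using limitin_subsequence[OF N a] by (simp add: o_def)
    show ?thesis
    proof (intro bexI conjI allI impI)
      show "z \<in> topspace X" using zd dom_subset by blast
      have "y \<noteq> phi p" using y r'(1) by (auto simp: S_def)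
      then show "z \<noteq> p" using zd by auto
    next
      fix u assume u: "chron X A g T u z"
      have "eventually (\<lambda>k. chron X A g T u (\<zeta> (N k))) sequentially"
        using limitinD[OF zlim openin_chron_future[OF st, of u]] u by simp
      then have "eventually (\<lambda>k. chron X A g T u (b (N k))) sequentially"
      proof eventually_elim
        case (elim k)
        then show ?case
          using \<zeta>(2)[OF N0[of k]] chron_trans[of X A g T u "\<zeta> (N k)" "b (N k)"] by auto
      qed
      then obtain k0 where k0: "\<And>k. k \<ge> k0 \<Longrightarrow> chron X A g T u (b (N k))"
        unfolding eventually_sequentially by blast
      show "frequently (\<lambda>n. chron X A g T u (b n)) sequentially"
        unfolding frequently_sequentially
      proof
        fix m
        have "m \<le> N (max m k0)" using seq_suble[OF N, of "max m k0"] by simp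
        then show "\<exists>n\<ge>m. chron X A g T u (b n)" using k0[of "max m k0"] by auto
      qed
    next
      fix u assume u: "chron X A g T u p"
      obtain \<rho> where \<rho>: "\<rho> > 0" "cball (phi p) \<rho> \<subseteq> {y \<in> img. psi y \<in> {q. chron X A g T u q}}"
        using coordinate_ball[OF openin_chron_future[OF st, of u] pd] u by auto
      \<comment> \<open>One half of \<open>\<rho>\<close> is for the distance of
        \<open>a (N k)\<close> from \<open>p\<close>, the other for the displacement of that
        end.\<close>
      obtain \<delta> where \<delta>: "0 < \<delta>" "\<delta> \<le> \<delta>0" "C * \<delta> \<le> \<delta>0" "C * \<delta> * norm e < \<rho> / 2"
        by (rule small_displacement[OF r(2,3), of "\<rho> / 2" e]) (use \<rho> in auto)
      have zd': "y - \<delta> *\<^sub>R e \<in> img" "chron X A g T (psi (y - \<delta> *\<^sub>R e)) z"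
        using shift[rule_format, OF yi(2) \<delta>(1,2)] by (auto simp: z_def)
      have "(\<lambda>k. phi (\<zeta> (N k)) - \<delta> *\<^sub>R e) \<longlonglongrightarrow> y - \<delta> *\<^sub>R e" by (intro tendsto_intros lim)
      from limitinD[OF limitin_psi[OF this zd'(1)] openin_chron_past[OF st, of z]] zd'(2)
      have e1: "eventually (\<lambda>k. chron X A g T (psi (phi (\<zeta> (N k)) - \<delta> *\<^sub>R e)) z) sequentially"
        by simp
      have e2: "eventually (\<lambda>k. dist (phi (a (N k))) (phi p) < \<rho> / 2) sequentially"
        using tendstoD[OF limitin_phi(2)[OF aN pd], of "\<rho> / 2"] \<rho> by simp
      obtain k where k: "chron X A g T (psi (phi (\<zeta> (N k)) - \<delta> *\<^sub>R e)) z" "dist (phi (a (N k))) (phi p) < \<rho> / 2"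
        using eventually_happens[OF eventually_conj[OF e1 e2]] by auto
      obtain \<gamma> s t where \<gamma>: "pw_curve X A g T future_timelike_vec \<gamma> s t" "\<gamma> s = a (N k)" "\<gamma> t = \<zeta> (N k)"
          "\<And>x. x \<in> {s..t} \<Longrightarrow> \<gamma> x \<in> K"
        using \<zeta>(3)[OF N0] by blast
      have "\<gamma> x \<in> dom \<and> phi (\<gamma> x) \<in> cball (phi p) r" if "x \<in> {s..t}" for x
        using Kd[OF \<gamma>(4)[OF that]] r'(2) by auto
      from pert[rule_format, OF \<gamma>(1) this \<delta>(1,3), THEN conjunct1] \<gamma>(2,3)
      obtain \<delta>' where \<delta>': "0 < \<delta>'" "\<delta>' \<le> C * \<delta>"
        "chron X A g T (psi (phi (a (N k)) - \<delta>' *\<^sub>R e)) (psi (phi (\<zeta> (N k)) - \<delta> *\<^sub>R e))" by auto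
      have 1: "chron X A g T u (psi (phi (a (N k)) - \<delta>' *\<^sub>R e))"
      proof -
        have "\<delta>' * norm e \<le> C * \<delta> * norm e" using \<delta>' by (intro mult_right_mono) auto
        then have "dist (phi (a (N k))) (phi (a (N k)) - \<delta>' *\<^sub>R e) < \<rho> / 2" using \<delta>(4) \<delta>' by (simp add: dist_norm)
        then have "phi (a (N k)) - \<delta>' *\<^sub>R e \<in> cball (phi p) \<rho>"
          using k(2) dist_triangle_half_l[of "phi p" "phi (a (N k))" \<rho> "phi (a (N k)) - \<delta>' *\<^sub>R e"]
          by (simp add: dist_commute)
        then show ?thesis using \<rho>(2) by blast
      qed
      show "chron X A g T u z" by (rule chron_trans[OF 1 chron_trans[OF \<delta>'(3) k(1)]])
    qed
  qed
  moreover have "K \<subseteq> W" using r'(4) by (simp add: K_def)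
  ultimately show ?thesis using U K pU UK by (intro exI[of _ U] exI[of _ K] conjI allI impI) simp_all
qed

lemma chron_exit_past:
  assumes "spacetime X A g T" and "openin X W" "p \<in> W"
  shows "\<exists>U K. openin X U \<and> compactin X K \<and> p \<in> U \<and> U \<subseteq> K \<and> K \<subseteq> W \<and>
    (\<forall>a b. limitin X a p sequentially \<longrightarrow> (\<forall>n. chron X A g T (b n) (a n) \<and> b n \<notin> U) \<longrightarrow>
      (\<exists>z\<in>topspace X. z \<noteq> p \<and> (\<forall>u. chron X A g T p u \<longrightarrow> chron X A g T z u) \<and>
        (\<forall>u. chron X A g T z u \<longrightarrow> frequently (\<lambda>n. chron X A g T (b n) u) sequentially)))"
  using chron_exit_future[OF spacetime_time_reversal[OF assms(1)] assms(2,3)]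
  by (simp only: chron_time_reversal)

section \<open>Indecomposable past sets\<close>

text \<open>What the argument uses of a strongly causal spacetime. The assumptions are invariant under
  reversing \<open>chr\<close>, so every result comes with its time dual. In \<open>exit_future\<close>, \<open>z\<close> is an accumulation
  point of the points where timelike curves from \<open>a n\<close> to \<open>b n\<close> leave \<open>U\<close>.\<close>
locale causal_space =
  fixes X :: "'a topology" and chr :: "'a \<Rightarrow> 'a \<Rightarrow> bool"
  assumes Hausdorff: "Hausdorff_space X" and second_countable: "second_countable X"
    and chr_in: "chr p q \<Longrightarrow> p \<in> topspace X \<and> q \<in> topspace X"
    and chr_trans: "chr p q \<Longrightarrow> chr q r \<Longrightarrow> chr p r"
    and open_future: "openin X {q. chr p q}" and open_past: "openin X {q. chr q p}"
    and approach_past: "p \<in> topspace X \<Longrightarrow> \<exists>a. limitin X a p sequentially \<and> (\<forall>n. chr (a n) p)"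
    and approach_future: "p \<in> topspace X \<Longrightarrow> \<exists>a. limitin X a p sequentially \<and> (\<forall>n. chr p (a n))"
    and diamond: "openin X U \<Longrightarrow> p \<in> U \<Longrightarrow> \<exists>q r. chr q p \<and> chr p r \<and> (\<forall>s. chr q s \<longrightarrow> chr s r \<longrightarrow> s \<in> U)"
    and push_future: "p \<in> topspace X \<Longrightarrow> \<exists>U. openin X U \<and> p \<in> U \<and>
      (\<forall>b z. b \<in> U \<longrightarrow> p \<in> X closure_of {a. chr a b} \<longrightarrow> chr b z \<longrightarrow> chr p z)"
    and push_past: "p \<in> topspace X \<Longrightarrow> \<exists>U. openin X U \<and> p \<in> U \<and>
      (\<forall>b z. b \<in> U \<longrightarrow> p \<in> X closure_of {a. chr b a} \<longrightarrow> chr z b \<longrightarrow> chr z p)"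
    and exit_future: "openin X W \<Longrightarrow> p \<in> W \<Longrightarrow>
      \<exists>U K. openin X U \<and> compactin X K \<and> p \<in> U \<and> U \<subseteq> K \<and> K \<subseteq> W \<and>
        (\<forall>a b. limitin X a p sequentially \<longrightarrow> (\<forall>n. chr (a n) (b n) \<and> b n \<notin> U) \<longrightarrow>
          (\<exists>z\<in>topspace X. z \<noteq> p \<and> (\<forall>u. chr u p \<longrightarrow> chr u z) \<and>
            (\<forall>u. chr u z \<longrightarrow> frequently (\<lambda>n. chr u (b n)) sequentially)))"
    and exit_past: "openin X W \<Longrightarrow> p \<in> W \<Longrightarrow>
      \<exists>U K. openin X U \<and> compactin X K \<and> p \<in> U \<and> U \<subseteq> K \<and> K \<subseteq> W \<and>
        (\<forall>a b. limitin X a p sequentially \<longrightarrow> (\<forall>n. chr (b n) (a n) \<and> b n \<notin> U) \<longrightarrow>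
          (\<exists>z\<in>topspace X. z \<noteq> p \<and> (\<forall>u. chr p u \<longrightarrow> chr z u) \<and>
            (\<forall>u. chr z u \<longrightarrow> frequently (\<lambda>n. chr (b n) u) sequentially)))"
begin

lemma causal_space_dual: "causal_space X (\<lambda>p q. chr q p)"
proof (rule causal_space.intro)
  show "(\<lambda>p q. chr q p) p q \<Longrightarrow> (\<lambda>p q. chr q p) q r \<Longrightarrow> (\<lambda>p q. chr q p) p r" for p q r
    using chr_trans by blast
  show "\<exists>q r. chr p q \<and> chr r p \<and> (\<forall>s. chr s q \<longrightarrow> chr r s \<longrightarrow> s \<in> U)" if "openin X U" "p \<in> U" for U p
    using diamond[OF that] by blast
qed (fact Hausdorff second_countable open_future open_past approach_past approach_future push_past push_future
      exit_past exit_future | use chr_in in blast)+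

abbreviation M where "M \<equiv> topspace X"

lemma past_inhabited:
  assumes "openin X V" "p \<in> V" obtains q where "q \<in> V" "chr q p"
proof -
  have "p \<in> M" using assms openin_subset by blast
  then obtain a where a: "limitin X a p sequentially" "\<And>n. chr (a n) p" using approach_past by blast
  then have "eventually (\<lambda>n. a n \<in> V) sequentially" using assms limitinD by metis
  then obtain n where "a n \<in> V" unfolding eventually_sequentially by blast
  then show thesis using that a(2) by blast
qed

lemma chr_dense: "chr p r \<Longrightarrow> \<exists>q. chr p q \<and> chr q r"
  using past_inhabited[OF open_future[of p], of r] by blast

lemma in_Ipast: "y \<in> Ipast M chr {p} \<longleftrightarrow> chr y p"
  using chr_in by (auto simp: Ipast_def)

lemma in_Ifut: "y \<in> Ifut M chr {p} \<longleftrightarrow> chr p y"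
  using chr_in by (auto simp: Ifut_def)

text \<open>As points can be interpolated, a past-set is generated by itself; membership is thus a
  closure condition together with the absence of maximal points.\<close>

lemma past_set_iff: "past_set M chr P \<longleftrightarrow> P \<subseteq> M \<and> (\<forall>y. y \<in> P \<longleftrightarrow> (\<exists>s\<in>P. chr y s))"
proof
  assume "past_set M chr P"
  then obtain S where S: "S \<subseteq> M" "P = Ipast M chr S" unfolding past_set_def by blast
  have P: "y \<in> P \<longleftrightarrow> (\<exists>s\<in>S. chr y s)" for y using S chr_in by (auto simp: Ipast_def)
  have "P \<subseteq> M" using S by (auto simp: Ipast_def)
  moreover have "y \<in> P \<longleftrightarrow> (\<exists>s\<in>P. chr y s)" for y
  proof
    assume "y \<in> P"
    then obtain s where "s \<in> S" "chr y s" using P by blast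
    then obtain q where "chr y q" "chr q s" using chr_dense by blast
    then show "\<exists>s\<in>P. chr y s" using P \<open>s \<in> S\<close> by blast
  next
    assume "\<exists>s\<in>P. chr y s"
    then obtain q s where "chr y q" "chr q s" "s \<in> S" using P by blast
    then show "y \<in> P" using P chr_trans[of y q s] by blast
  qed
  ultimately show "P \<subseteq> M \<and> (\<forall>y. y \<in> P \<longleftrightarrow> (\<exists>s\<in>P. chr y s))" by blast
next
  assume P: "P \<subseteq> M \<and> (\<forall>y. y \<in> P \<longleftrightarrow> (\<exists>s\<in>P. chr y s))"
  have "P = Ipast M chr P"
  proof (rule set_eqI)
    fix y show "y \<in> P \<longleftrightarrow> y \<in> Ipast M chr P"
      using P[THEN conjunct2, THEN spec, of y] chr_in unfolding Ipast_def by auto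
  qed
  then show "past_set M chr P" unfolding past_set_def using P[THEN conjunct1] by (intro exI[of _ P]) simp
qed

lemma past_setD:
  assumes "past_set M chr P"
  shows "P \<subseteq> M" "y \<in> P \<Longrightarrow> \<exists>s\<in>P. chr y s" "chr y s \<Longrightarrow> s \<in> P \<Longrightarrow> y \<in> P"
  using assms unfolding past_set_iff by blast+

text \<open>Indecomposable means directed. For \<open>a\<close> in \<open>P\<close>, the points of
  \<open>P\<close> above \<open>a\<close> and the remaining ones generate two past-sets with union
  \<open>P\<close>; the second misses \<open>a\<close>, so the first is all of \<open>P\<close> and
  contains \<open>b\<close>. Conversely, an upper bound of a point missed by \<open>B\<close> and a
  point missed by \<open>D\<close> is missed by both.\<close>

lemma IP_iff: "IP M chr P \<longleftrightarrow> P \<noteq> {} \<and> past_set M chr P \<and> (\<forall>a\<in>P. \<forall>b\<in>P. \<exists>d\<in>P. chr a d \<and> chr b d)"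
proof
  assume P: "IP M chr P"
  then have ps: "past_set M chr P" "P \<noteq> {}" by (auto simp: IP_def)
  note ps' = past_setD[OF ps(1)]
  have "\<exists>d\<in>P. chr a d \<and> chr b d" if a: "a \<in> P" and b: "b \<in> P" for a b
  proof -
    define B where "B = Ipast M chr (P \<inter> {d. chr a d})"
    define D where "D = Ipast M chr (P - {d. chr a d})"
    have "P \<inter> {d. chr a d} \<subseteq> M" "P - {d. chr a d} \<subseteq> M" using ps'(1) by auto
    then have BD: "past_set M chr B" "past_set M chr D" unfolding past_set_def B_def D_def by blast+
    have un: "P = B \<union> D"
    proof (intro equalityI subsetI)
      fix y assume y: "y \<in> P"
      then obtain s where "s \<in> P" "chr y s" using ps'(2) by blast
      then show "y \<in> B \<union> D" using y ps'(1) by (auto simp: B_def D_def Ipast_def)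
    next
      fix y assume "y \<in> B \<union> D"
      then show "y \<in> P" using ps'(3) by (auto simp: B_def D_def Ipast_def)
    qed
    have "a \<notin> D" by (auto simp: D_def Ipast_def)
    then have "D \<subset> P" using un a by blast
    moreover have "\<not> (B \<subset> P \<and> D \<subset> P)" using P BD un unfolding IP_def by blast
    ultimately have "P = B" using un by blast
    then show ?thesis using b by (auto simp: B_def Ipast_def)
  qed
  then show "P \<noteq> {} \<and> past_set M chr P \<and> (\<forall>a\<in>P. \<forall>b\<in>P. \<exists>d\<in>P. chr a d \<and> chr b d)" using ps by blast
next
  assume P: "P \<noteq> {} \<and> past_set M chr P \<and> (\<forall>a\<in>P. \<forall>b\<in>P. \<exists>d\<in>P. chr a d \<and> chr b d)"
  have False if B: "past_set M chr B" "past_set M chr D" "B \<subset> P" "D \<subset> P" "P = B \<union> D" for B D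
  proof -
    obtain b d where b: "b \<in> P" "b \<notin> B" and d: "d \<in> P" "d \<notin> D" using B by blast
    obtain u where u: "u \<in> P" "chr b u" "chr d u" using P b d by blast
    have "u \<notin> B" "u \<notin> D" using B(1,2) b d u unfolding past_set_iff by blast+
    then show False using u B(5) by blast
  qed
  then show "IP M chr P" unfolding IP_def using P by blast
qed

lemma past_set_Ipast: "p \<in> M \<Longrightarrow> past_set M chr (Ipast M chr {p})"
  unfolding past_set_def by blast

lemma IP_Ipast:
  assumes p: "p \<in> M" shows "IP M chr (Ipast M chr {p})"
  unfolding IP_iff
proof (intro conjI ballI past_set_Ipast p)
  show "Ipast M chr {p} \<noteq> {}" using approach_past[OF p] in_Ipast by blast
  fix a b assume "a \<in> Ipast M chr {p}" "b \<in> Ipast M chr {p}"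
  then have "openin X ({d. chr a d} \<inter> {d. chr b d})" "p \<in> {d. chr a d} \<inter> {d. chr b d}"
    by (auto simp: in_Ipast intro: openin_Int open_future)
  then obtain d where "chr a d" "chr b d" "chr d p" using past_inhabited by blast
  then show "\<exists>d\<in>Ipast M chr {p}. chr a d \<and> chr b d" by (auto simp: in_Ipast)
qed

text \<open>Every neighbourhood of \<open>z\<close> contains some \<open>s\<close> after
  \<open>q\<close> and before \<open>z\<close>. As \<open>s\<close> also precedes \<open>p\<close>,
  it lies between \<open>q\<close> and \<open>r\<close>, hence near \<open>p\<close>; so
  \<open>z\<close> and \<open>p\<close> cannot be separated.\<close>

lemma distinguishing:
  assumes p: "p \<in> M" and z: "z \<in> M"
    and 1: "\<And>u. chr u p \<Longrightarrow> chr u z" and 2: "\<And>u. chr u z \<Longrightarrow> chr u p"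
  shows "z = p"
proof (rule ccontr)
  assume "z \<noteq> p"
  then obtain U V where UV: "openin X U" "openin X V" "p \<in> U" "z \<in> V" "disjnt U V"
    using Hausdorff p z unfolding Hausdorff_space_def by metis
  obtain q r where q: "chr q p" "chr p r" "\<And>s. chr q s \<Longrightarrow> chr s r \<Longrightarrow> s \<in> U" using diamond[OF UV(1,3)] by blast
  have "openin X (V \<inter> {d. chr q d})" "z \<in> V \<inter> {d. chr q d}" using UV open_future 1 q(1) by auto
  then obtain s where s: "s \<in> V" "chr q s" "chr s z" using past_inhabited by blast
  then have "s \<in> U" using 2 q chr_trans by blast
  then show False using s UV(5) by (auto simp: disjnt_iff)
qed

section \<open>Time duality of the causal notions\<close>

lemma dual_simps:
  "Ipast M (\<lambda>p q. chr q p) = Ifut M chr" "Ifut M (\<lambda>p q. chr q p) = Ipast M chr"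
  "past_set M (\<lambda>p q. chr q p) = future_set M chr" "future_set M (\<lambda>p q. chr q p) = past_set M chr"
  "IP M (\<lambda>p q. chr q p) = IF M chr" "IF M (\<lambda>p q. chr q p) = IP M chr"
  "fP M (\<lambda>p q. chr q p) = pF M chr" "pF M (\<lambda>p q. chr q p) = fP M chr"
  "lim_past M (\<lambda>p q. chr q p) = lim_fut M chr"
proof -
  show 1: "Ipast M (\<lambda>p q. chr q p) = Ifut M chr" "Ifut M (\<lambda>p q. chr q p) = Ipast M chr"
    by (auto simp: Ipast_def Ifut_def fun_eq_iff)
  show 2: "past_set M (\<lambda>p q. chr q p) = future_set M chr" "future_set M (\<lambda>p q. chr q p) = past_set M chr"
    by (auto simp: past_set_def future_set_def fun_eq_iff 1)
  show "IP M (\<lambda>p q. chr q p) = IF M chr" "IF M (\<lambda>p q. chr q p) = IP M chr"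
    unfolding IP_def IF_def fun_eq_iff 2 by auto
  show "fP M (\<lambda>p q. chr q p) = pF M chr" "pF M (\<lambda>p q. chr q p) = fP M chr"
    unfolding fP_def pF_def fun_eq_iff 1 by auto
  show "lim_past M (\<lambda>p q. chr q p) = lim_fut M chr"
    unfolding lim_past_def lim_fut_def fun_eq_iff 1 by auto
qed

lemma Rpf_dual: "(Q, P) \<in> Rpf M (\<lambda>p q. chr q p) \<longleftrightarrow> (P, Q) \<in> Rpf M chr"
  unfolding Rpf_def dual_simps by auto

lemma future_set_iff: "future_set M chr P \<longleftrightarrow> P \<subseteq> M \<and> (\<forall>y. y \<in> P \<longleftrightarrow> (\<exists>s\<in>P. chr s y))"
  using causal_space.past_set_iff[OF causal_space_dual, of P] unfolding dual_simps .

lemma IF_iff: "IF M chr P \<longleftrightarrow> P \<noteq> {} \<and> future_set M chr P \<and> (\<forall>a\<in>P. \<forall>b\<in>P. \<exists>d\<in>P. chr d a \<and> chr d b)"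
  using causal_space.IP_iff[OF causal_space_dual, of P] unfolding dual_simps .

lemma IF_Ifut: "p \<in> M \<Longrightarrow> IF M chr (Ifut M chr {p})"
  using causal_space.IP_Ipast[OF causal_space_dual, of p] unfolding dual_simps .

lemma in_fP: "y \<in> fP M chr P \<longleftrightarrow> (\<exists>x\<in>M. P \<subseteq> Ipast M chr {x} \<and> chr x y)"
  unfolding fP_def Ifut_def using chr_in by blast

lemma in_pF: "y \<in> pF M chr Q \<longleftrightarrow> (\<exists>x\<in>M. Q \<subseteq> Ifut M chr {x} \<and> chr y x)"
  unfolding pF_def Ipast_def using chr_in by blast

section \<open>Pairs that contain the past of a point\<close>

lemma closure_of_past: "p \<in> M \<Longrightarrow> p \<in> X closure_of {a. chr a p}"
  unfolding in_closure_of using past_inhabited by blast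

lemma Ifut_subset_fP: "p \<in> M \<Longrightarrow> Ifut M chr {p} \<subseteq> fP M chr (Ipast M chr {p})"
  using in_fP in_Ifut by blast

text \<open>Directedness drives \<open>F\<close> down towards \<open>p\<close>: a common lower bound
  \<open>b\<close> in \<open>F\<close> of \<open>r\<close> and \<open>z\<close> has I^-(p) in its
  past, in particular \<open>q\<close>, so it lies in the diamond between \<open>q\<close> and
  \<open>r\<close>. There \<open>push_future\<close> applies to \<open>b\<close> and
  \<open>z\<close>.\<close>

lemma Ifut_maximal:
  assumes p: "p \<in> M" and F: "IF M chr F" "F \<subseteq> fP M chr (Ipast M chr {p})" "Ifut M chr {p} \<subseteq> F"
  shows "F \<subseteq> Ifut M chr {p}"
proof
  fix z assume z: "z \<in> F"
  obtain U where U: "openin X U" "p \<in> U"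
    "\<And>b z. b \<in> U \<Longrightarrow> p \<in> X closure_of {a. chr a b} \<Longrightarrow> chr b z \<Longrightarrow> chr p z" using push_future[OF p] by blast
  obtain q r where q: "chr q p" "chr p r" "\<And>s. chr q s \<Longrightarrow> chr s r \<Longrightarrow> s \<in> U" using diamond[OF U(1,2)] by blast
  have "r \<in> F" using F(3) q(2) in_Ifut by blast
  then obtain b where b: "b \<in> F" "chr b r" "chr b z" using F(1) z unfolding IF_iff by blast
  then obtain x where x: "Ipast M chr {p} \<subseteq> Ipast M chr {x}" "chr x b" using F(2) in_fP by blast
  have sub: "{a. chr a p} \<subseteq> {a. chr a b}" using x chr_trans in_Ipast by blast
  then have "b \<in> U" using q b(2) by blast
  moreover have "p \<in> X closure_of {a. chr a b}" using closure_of_past[OF p] closure_of_mono[OF sub] by blast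
  ultimately have "chr p z" using U(3) b(3) by blast
  then show "z \<in> Ifut M chr {p}" by (simp add: in_Ifut)
qed

lemma Phi_in_Rpf:
  assumes p: "p \<in> M" shows "Phi M chr p \<in> Rpf M chr"
proof -
  note d = causal_space.Ifut_subset_fP[OF causal_space_dual, unfolded dual_simps, OF p]
    causal_space.Ifut_maximal[OF causal_space_dual, unfolded dual_simps, OF p]
  have "\<not> (\<exists>Q'. IF M chr Q' \<and> Q' \<subseteq> fP M chr (Ipast M chr {p}) \<and> Ifut M chr {p} \<subset> Q')"
    using Ifut_maximal[OF p] by (meson less_le_not_le psubset_imp_subset)
  moreover have "\<not> (\<exists>P'. IP M chr P' \<and> P' \<subseteq> pF M chr (Ifut M chr {p}) \<and> Ipast M chr {p} \<subset> P')"
    using d(2) by (meson less_le_not_le psubset_imp_subset)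
  ultimately show ?thesis unfolding Rpf_def Phi_def
    using IP_Ipast[OF p] IF_Ifut[OF p] Ifut_subset_fP[OF p] d(1) by simp
qed

text \<open>The exit property speaks of sequences, so a directed set has to be replaced by one.
  Second countability gives countably many points of \<open>F\<close> whose futures cover
  \<open>F\<close>, and directedness a descending sequence below all of them.\<close>

lemma IF_chain:
  assumes F: "IF M chr F"
  obtains s where "\<And>n. s n \<in> F" "\<And>q. q \<in> F \<Longrightarrow> eventually (\<lambda>n. chr (s n) q) sequentially"
proof -
  have fs: "F \<noteq> {}" "F \<subseteq> M" "\<And>y. y \<in> F \<longleftrightarrow> (\<exists>s\<in>F. chr s y)" "\<And>a b. a \<in> F \<Longrightarrow> b \<in> F \<Longrightarrow> \<exists>d\<in>F. chr d a \<and> chr d b"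
    using F[unfolded IF_iff future_set_iff] by blast+
  have "second_countable (subtopology X F)" using second_countable by (rule second_countable_subtopology)
  then have "Lindelof_space (subtopology X F)" by (rule second_countable_imp_Lindelof_space)
  moreover have "\<And>U. U \<in> (\<lambda>s. {q. chr s q}) ` F \<Longrightarrow> openin X U" using open_future by blast
  moreover have "F \<subseteq> \<Union> ((\<lambda>s. {q. chr s q}) ` F)" using fs(3) by blast
  ultimately obtain V where V: "countable V" "V \<subseteq> (\<lambda>s. {q. chr s q}) ` F" "F \<subseteq> \<Union> V"
    unfolding Lindelof_space_subtopology_subset[OF fs(2)] by metis
  obtain B where B: "countable B" "B \<subseteq> F" "V = (\<lambda>s. {q. chr s q}) ` B"
    using countable_subset_image[of V "\<lambda>s. {q. chr s q}" F] V by metis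
  have "B \<noteq> {}" using B(3) V(3) fs(1) by auto
  from range_from_nat_into[OF this B(1)] obtain b :: "nat \<Rightarrow> 'a" where b: "range b = B" by (rule that)
  have bF: "b n \<in> F" for n using b B(2) by blast
  \<comment> \<open>The next term lies below the current one and below \<open>b n\<close>, so
    \<open>b n\<close> is passed only at index \<open>Suc n\<close>.\<close>
  define s where "s = rec_nat (b 0) (\<lambda>n x. SOME d. d \<in> F \<and> chr d x \<and> chr d (b n))"
  have step: "\<exists>d. d \<in> F \<and> chr d x \<and> chr d (b n)" if "x \<in> F" for x n using fs(4)[OF that bF] by blast
  have sF: "s n \<in> F" for n
  proof (induction n)
    case 0 then show ?case by (simp add: s_def bF)
  next
    case (Suc n) then show ?case using someI_ex[OF step[OF Suc, of n]] by (simp add: s_def)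
  qed
  have sS: "chr (s (Suc n)) (s n)" "chr (s (Suc n)) (b n)" for n
    using someI_ex[OF step[OF sF[of n], of n]] by (simp_all add: s_def)
  have dec: "chr (s (Suc (n + k))) (b n)" for n k
  proof (induction k)
    case 0 then show ?case using sS(2) by simp
  next
    case (Suc k) then show ?case using chr_trans[OF sS(1)] by simp
  qed
  show thesis
  proof (rule that[OF sF])
    fix q assume "q \<in> F"
    then obtain n where n: "chr (b n) q" using V(3) B(3) b by blast
    have "chr (s m) q" if "m \<ge> Suc n" for m
    proof -
      obtain k where "m = Suc (n + k)" using \<open>m \<ge> Suc n\<close> by (metis add_Suc le_Suc_ex)
      then show ?thesis using dec[of n k] n chr_trans by blast
    qed
    then show "eventually (\<lambda>n. chr (s n) q) sequentially" unfolding eventually_sequentially by blast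
  qed
qed

text \<open>A sequence descending through \<open>Q\<close> must converge to \<open>w\<close>.
  Otherwise the exit property gives \<open>z \<noteq> w\<close> with I^-(w) \<subseteq> I^-(z) and
  I^-(z) before all of \<open>Q\<close>; maximality of I^-(w) then makes the two pasts equal,
  against \<open>distinguishing\<close>. Near \<open>w\<close>, \<open>push_future\<close> gives Q
  \<subseteq> I^+(w), and maximality of \<open>Q\<close> gives equality.\<close>

lemma Rpf_Ipast_unique:
  assumes w: "w \<in> M" and R: "(Ipast M chr {w}, Q) \<in> Rpf M chr"
  shows "Q = Ifut M chr {w}"
proof -
  have Q: "IF M chr Q" "Q \<subseteq> fP M chr (Ipast M chr {w})" "Ipast M chr {w} \<subseteq> pF M chr Q"
    and Qmax: "\<And>Q'. IF M chr Q' \<Longrightarrow> Q' \<subseteq> fP M chr (Ipast M chr {w}) \<Longrightarrow> \<not> Q \<subset> Q'"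
    and Pmax: "\<And>P'. IP M chr P' \<Longrightarrow> P' \<subseteq> pF M chr Q \<Longrightarrow> \<not> Ipast M chr {w} \<subset> P'"
    using R unfolding Rpf_def by blast+
  have wQ: "chr u q" if "chr u w" "q \<in> Q" for u q
    using Q(2) that in_fP chr_trans in_Ipast by (meson subsetD)
  obtain s where s: "\<And>n. s n \<in> Q" "\<And>q. q \<in> Q \<Longrightarrow> eventually (\<lambda>n. chr (s n) q) sequentially"
    using IF_chain[OF Q(1)] by blast
  \<comment> \<open>Only the points of I^-(w), not yet \<open>w\<close> itself, are known to precede
    the \<open>s n\<close>; the curves therefore start at points \<open>a n\<close> tending to
    \<open>w\<close>.\<close>
  obtain a where a: "limitin X a w sequentially" "\<And>n. chr (a n) w" using approach_past[OF w] by blast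
  have ev: "eventually (\<lambda>n. s n \<in> W) sequentially" if W: "openin X W" "w \<in> W" for W
  proof (rule ccontr)
    assume notev: "\<not> eventually (\<lambda>n. s n \<in> W) sequentially"
    obtain U K where UK0: "openin X U" and UK1: "compactin X K" and UK2: "w \<in> U" and UK3: "U \<subseteq> K" "K \<subseteq> W" and exit:
      "\<forall>a b. limitin X a w sequentially \<longrightarrow> (\<forall>n. chr (a n) (b n) \<and> b n \<notin> U) \<longrightarrow>
          (\<exists>z\<in>M. z \<noteq> w \<and> (\<forall>u. chr u w \<longrightarrow> chr u z) \<and>
            (\<forall>u. chr u z \<longrightarrow> frequently (\<lambda>n. chr u (b n)) sequentially))"
      using exit_future[OF W] by (elim exE conjE) (rule that)
    have "\<forall>n. \<exists>m\<ge>n. s m \<notin> W" using notev unfolding eventually_sequentially by blast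
    then obtain N where N: "\<And>n. N n \<ge> n" "\<And>n. s (N n) \<notin> W" by metis
    have "\<forall>n. chr (a n) (s (N n)) \<and> s (N n) \<notin> U" using wQ a(2) s(1) N(2) UK3 by blast
    from exit[THEN spec, THEN spec, THEN mp, OF a(1), THEN mp, OF this] obtain z where z: "z \<in> M" "z \<noteq> w" "\<And>u. chr u w \<Longrightarrow> chr u z"
      "\<And>u. chr u z \<Longrightarrow> frequently (\<lambda>n. chr u (s (N n))) sequentially" by blast
    have Nlim: "filterlim N sequentially sequentially"
      using N(1) filterlim_at_top_mono[OF filterlim_ident, of N] by (auto intro: always_eventually)
    have zQ: "chr u q" if "chr u z" "q \<in> Q" for u q
    proof -
      have "eventually (\<lambda>n. chr (s (N n)) q) sequentially"
        using eventually_compose_filterlim[OF s(2)[OF that(2)] Nlim] .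
      from frequently_eventually_conj[OF z(4)[OF that(1)] this]
      obtain n where "chr (s (N n)) q" "chr u (s (N n))" by (auto dest!: frequently_ex)
      then show ?thesis using chr_trans by blast
    qed
    have "Ipast M chr {z} \<subseteq> pF M chr Q"
    proof
      fix u assume "u \<in> Ipast M chr {z}"
      \<comment> \<open>\<open>z\<close> itself need not precede the points of \<open>Q\<close>, so
        the witness for \<open>pF\<close> is taken strictly between \<open>u\<close> and
        \<open>z\<close>.\<close>
      then obtain v where v: "chr u v" "chr v z" using chr_dense in_Ipast by blast
      then have "Q \<subseteq> Ifut M chr {v}" using zQ in_Ifut by blast
      then show "u \<in> pF M chr Q" using in_pF v chr_in by blast
    qed
    then have "\<not> Ipast M chr {w} \<subset> Ipast M chr {z}" using Pmax IP_Ipast[OF z(1)] by blast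
    moreover have "Ipast M chr {w} \<subseteq> Ipast M chr {z}" using z(3) in_Ipast by blast
    ultimately have "Ipast M chr {w} = Ipast M chr {z}" by blast
    then have "\<And>u. chr u w \<longleftrightarrow> chr u z" using in_Ipast by blast
    then show False using distinguishing[OF w z(1)] z(2) by blast
  qed
  obtain U where U: "openin X U" "w \<in> U"
    "\<And>b z. b \<in> U \<Longrightarrow> w \<in> X closure_of {a. chr a b} \<Longrightarrow> chr b z \<Longrightarrow> chr w z" using push_future[OF w] by blast
  have "Q \<subseteq> Ifut M chr {w}"
  proof
    fix q assume q: "q \<in> Q"
    obtain n where n: "s n \<in> U" "chr (s n) q"
      using eventually_happens[OF eventually_conj[OF ev[OF U(1,2)] s(2)[OF q]]] by auto
    have "{a. chr a w} \<subseteq> {a. chr a (s n)}" using wQ s(1) by blast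
    then have "w \<in> X closure_of {a. chr a (s n)}" using closure_of_past[OF w] closure_of_mono by blast
    then show "q \<in> Ifut M chr {w}" using U(3) n in_Ifut by blast
  qed
  then show ?thesis using Qmax[OF IF_Ifut[OF w] Ifut_subset_fP[OF w]] by blast
qed

text \<open>By directedness the closures of the tails of \<open>P\<close> have the finite
  intersection property, so they share a point \<open>w\<close> of \<open>K\<close>. As every tail
  comes near \<open>w\<close>, \<open>push_past\<close> gives P \<subseteq> I^-(w), and openness of
  futures gives the converse.\<close>

lemma IP_in_compact:
  assumes P: "IP M chr P" and r: "r \<in> P" and K: "compactin X K" and tail: "\<And>b. b \<in> P \<Longrightarrow> chr r b \<Longrightarrow> b \<in> K"
  obtains w where "w \<in> K" "P = Ipast M chr {w}"
proof -
  have ps: "P \<noteq> {}" "P \<subseteq> M" "\<And>y. y \<in> P \<longleftrightarrow> (\<exists>s\<in>P. chr y s)" "\<And>a b. a \<in> P \<Longrightarrow> b \<in> P \<Longrightarrow> \<exists>d\<in>P. chr a d \<and> chr b d"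
    using P[unfolded IP_iff past_set_iff] by blast+
  have Kc: "closedin X K" by (rule compactin_imp_closedin[OF Hausdorff K])
  \<comment> \<open>The condition \<open>chr r d\<close> confines every tail to
    \<open>K\<close>.\<close>
  define C where "C b = X closure_of {d \<in> P. chr b d \<and> chr r d}" for b
  have CK: "C b \<subseteq> K" for b unfolding C_def by (rule closure_of_minimal[OF _ Kc]) (use tail in blast)
  have "K \<inter> \<Inter> (C ` P) \<noteq> {}"
  proof (rule compactin_fip[THEN iffD1, OF K, THEN conjunct2, rule_format], intro conjI ballI allI impI)
    fix D assume "D \<in> C ` P" then show "closedin X D" unfolding C_def by auto
  next
    fix \<F> assume F: "finite \<F> \<and> \<F> \<subseteq> C ` P"
    then obtain B where B: "finite B" "B \<subseteq> P" "\<F> = C ` B" using finite_subset_image by metis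
    have "\<exists>d\<in>P. chr r d \<and> (\<forall>b\<in>B. chr b d)" using B(1,2)
    proof (induction B)
      case empty then show ?case using ps(4)[OF r r] by blast
    next
      case (insert b B)
      then obtain d where d: "d \<in> P" "chr r d" "\<forall>b\<in>B. chr b d" by blast
      obtain d' where "d' \<in> P" "chr d d'" "chr b d'" using ps(4)[OF d(1), of b] insert by blast
      then show ?case using d chr_trans by blast
    qed
    then obtain d where d: "d \<in> P" "chr r d" "\<forall>b\<in>B. chr b d" by blast
    have "d \<in> C b" if "b \<in> B" for b unfolding C_def
      by (rule subsetD[OF closure_of_subset]) (use that d ps(2) in auto)
    moreover have "d \<in> K" using tail d by blast
    ultimately show "K \<inter> \<Inter> \<F> \<noteq> {}" using B(3) by blast
  qed
  then obtain w where w: "w \<in> K" "\<And>b. b \<in> P \<Longrightarrow> w \<in> C b" by blast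
  have wM: "w \<in> M" using w(1) K compactin_subset_topspace by blast
  have meets: "\<exists>d\<in>P. chr b d \<and> d \<in> V" if "b \<in> P" "openin X V" "w \<in> V" for b V
    using w(2)[OF that(1)] that unfolding C_def in_closure_of by blast
  have "P \<subseteq> Ipast M chr {w}"
  proof
    fix b assume b: "b \<in> P"
    obtain U where U: "openin X U" "w \<in> U"
      "\<And>b z. b \<in> U \<Longrightarrow> w \<in> X closure_of {a. chr b a} \<Longrightarrow> chr z b \<Longrightarrow> chr z w" using push_past[OF wM] by blast
    obtain d where d: "d \<in> P" "chr b d" "d \<in> U" using meets[OF b U(1,2)] by blast
    have "{d' \<in> P. chr d d' \<and> chr r d'} \<subseteq> {a. chr d a}" by blast
    then have "w \<in> X closure_of {a. chr d a}" using w(2)[OF d(1)] closure_of_mono unfolding C_def by blast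
    then show "b \<in> Ipast M chr {w}" using U(3) d in_Ipast by blast
  qed
  moreover have "Ipast M chr {w} \<subseteq> P"
  proof
    fix u assume "u \<in> Ipast M chr {w}"
    then have "w \<in> {d. chr u d}" by (simp add: in_Ipast)
    then obtain d where "d \<in> P" "chr u d" using meets[OF r open_future] by blast
    then show "u \<in> P" using ps(3) by blast
  qed
  ultimately show thesis using that w(1) by blast
qed

text \<open>The exit neighbourhood of \<open>x\<close> is taken inside I^-(y), so that any
  \<open>w\<close> in \<open>K\<close> has \<open>y\<close> in its future. Some
  \<open>fst (R n)\<close> must have a tail in \<open>U\<close>: otherwise the first clause of the
  limit supplies curves leaving \<open>U\<close>, and the second clause bounds the past of the
  resulting \<open>z\<close> by I^-(x).\<close>

lemma limit_partner:
  assumes x: "x \<in> M" and R: "\<And>n. R n \<in> Mbar M chr" and ne: "\<And>n. snd (R n) \<noteq> {}"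
    and lim: "lim_past M chr (\<lambda>n. fst (R n)) (Ipast M chr {x})" and y: "chr x y"
  shows "\<exists>n. y \<in> snd (R n)"
proof -
  have lim1: "eventually (\<lambda>n. u \<in> fst (R n)) sequentially" if "chr u x" for u
    using lim that in_Ipast unfolding lim_past_def by blast
  have lim2: "Ipast M chr {u} \<subseteq> Ipast M chr {x}"
    if "u \<in> M" "frequently (\<lambda>n. Ipast M chr {u} \<subseteq> fst (R n)) sequentially" for u
    using lim that unfolding lim_past_def frequently_def by blast
  have "openin X {q. chr q y}" "x \<in> {q. chr q y}" using open_past y by auto
  from exit_future[OF this]
  obtain U K where UK0: "openin X U" and UK1: "compactin X K" and UK2: "x \<in> U" and UK3: "U \<subseteq> K" "K \<subseteq> {q. chr q y}" and exit:
      "\<forall>a b. limitin X a x sequentially \<longrightarrow> (\<forall>n. chr (a n) (b n) \<and> b n \<notin> U) \<longrightarrow>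
          (\<exists>z\<in>M. z \<noteq> x \<and> (\<forall>u. chr u x \<longrightarrow> chr u z) \<and>
            (\<forall>u. chr u z \<longrightarrow> frequently (\<lambda>n. chr u (b n)) sequentially))"
      by (elim exE conjE) (rule that)
  obtain a where a: "limitin X a x sequentially" "\<And>n. chr (a n) x" using approach_past[OF x] by blast
  \<comment> \<open>With both components nonempty, an element of \<open>Mbar\<close> is of neither
    unpaired kind.\<close>
  have IPR: "IP M chr (fst (R n)) \<and> R n \<in> Rpf M chr" if "fst (R n) \<noteq> {}" for n
  proof -
    have "R n \<in> Rpf M chr" using R[of n] ne[of n] that unfolding Mbar_def Un_iff mem_Collect_eq case_prod_beta by blast
    moreover have "IP M chr (fst P)" if "P \<in> Rpf M chr" for P
      using that unfolding Rpf_def mem_Collect_eq case_prod_beta by (elim conjE)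
    ultimately show ?thesis by blast
  qed
  have down: "u \<in> fst (R n)" if "chr u v" "v \<in> fst (R n)" for u v n
  proof -
    have "IP M chr (fst (R n))" using IPR that by blast
    then have "past_set M chr (fst (R n))" by (simp add: IP_iff)
    then show ?thesis using that unfolding past_set_iff by blast
  qed
  have "\<exists>n. \<exists>r\<in>fst (R n). \<forall>b\<in>fst (R n). chr r b \<longrightarrow> b \<in> U"
  proof (rule ccontr)
    assume "\<not> ?thesis"
    then have no: "\<exists>b\<in>fst (R n). chr r b \<and> b \<notin> U" if "r \<in> fst (R n)" for r n using that by blast
    \<comment> \<open>\<open>a j\<close> is known to belong to \<open>fst (R n)\<close> only for
      large \<open>n\<close>, depending on \<open>j\<close>; hence the reindexing by
      \<open>N\<close>.\<close>
    have "\<exists>n\<ge>j. a j \<in> fst (R n)" for j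
      using lim1[OF a(2)[of j]] unfolding eventually_sequentially by (meson linear)
    then obtain N where N: "\<And>j. N j \<ge> j" "\<And>j. a j \<in> fst (R (N j))" by metis
    have "\<forall>j. \<exists>b. b \<in> fst (R (N j)) \<and> chr (a j) b \<and> b \<notin> U" using no[OF N(2)] by blast
    then obtain b where b: "\<And>j. b j \<in> fst (R (N j))" "\<And>j. chr (a j) (b j)" "\<And>j. b j \<notin> U" by metis
    then have "\<forall>j. chr (a j) (b j) \<and> b j \<notin> U" by blast
    from exit[THEN spec, THEN spec, THEN mp, OF a(1), THEN mp, OF this] obtain z where z: "z \<in> M" "z \<noteq> x" "\<And>u. chr u x \<Longrightarrow> chr u z"
      "\<And>u. chr u z \<Longrightarrow> frequently (\<lambda>n. chr u (b n)) sequentially" by blast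
    have "chr u x" if u: "chr u z" for u
    proof -
      \<comment> \<open>The second clause of the limit concerns whole pasts contained in
        \<open>fst (R n)\<close>, so it is applied to a point \<open>v\<close> between
        \<open>u\<close> and \<open>z\<close>.\<close>
      obtain v where v: "chr u v" "chr v z" using chr_dense[OF u] by blast
      have "frequently (\<lambda>n. Ipast M chr {v} \<subseteq> fst (R n)) sequentially"
        unfolding frequently_sequentially
      proof
        fix m
        obtain j where j: "j \<ge> m" "chr v (b j)" using z(4)[OF v(2)] unfolding frequently_sequentially by blast
        have "Ipast M chr {v} \<subseteq> fst (R (N j))"
        proof
          fix u assume "u \<in> Ipast M chr {v}"
          then have "chr u (b j)" using j(2) in_Ipast chr_trans by blast
          then show "u \<in> fst (R (N j))" using down b(1) by blast
        qed
        then show "\<exists>n\<ge>m. Ipast M chr {v} \<subseteq> fst (R n)" using N(1)[of j] j(1) by (meson order_trans)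
      qed
      then have "Ipast M chr {v} \<subseteq> Ipast M chr {x}" using lim2 v chr_in by blast
      then show ?thesis using v(1) in_Ipast by blast
    qed
    then show False using distinguishing[OF x z(1)] z(2,3) by blast
  qed
  then obtain n r where r: "r \<in> fst (R n)" "\<And>b. b \<in> fst (R n) \<Longrightarrow> chr r b \<Longrightarrow> b \<in> U" by blast
  then have RR: "IP M chr (fst (R n))" "R n \<in> Rpf M chr" using IPR by blast+
  obtain w where w: "w \<in> K" "fst (R n) = Ipast M chr {w}"
    using IP_in_compact[OF RR(1) r(1) UK1] r(2) UK3(1) by blast
  have wM: "w \<in> M" using w(1) UK1 compactin_subset_topspace by blast
  have "(Ipast M chr {w}, snd (R n)) \<in> Rpf M chr" using RR(2) w(2) by (metis prod.collapse)
  then have "snd (R n) = Ifut M chr {w}" by (rule Rpf_Ipast_unique[OF wM])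
  then have "y \<in> snd (R n)" using w(1) UK3(2) in_Ifut by blast
  then show ?thesis by blast
qed

end

section \<open>Convergence\<close>

context causal_space begin

lemma Mbar_dual: "(Q, P) \<in> Mbar M (\<lambda>p q. chr q p) \<longleftrightarrow> (P, Q) \<in> Mbar M chr"
  unfolding Mbar_def Un_iff mem_Collect_eq case_prod_conv Rpf_dual dual_simps by blast

lemma limit_partner':
  assumes x: "x \<in> M" and R: "\<And>n. R n \<in> Mbar M chr" and ne: "\<And>n. fst (R n) \<noteq> {}"
    and lim: "lim_fut M chr (\<lambda>n. snd (R n)) (Ifut M chr {x})" and y: "chr y x"
  shows "\<exists>n. y \<in> fst (R n)"
proof -
  have R': "(snd (R n), fst (R n)) \<in> Mbar M (\<lambda>p q. chr q p)" for n
    unfolding Mbar_dual using R by simp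
  show ?thesis
    using causal_space.limit_partner[OF causal_space_dual x, where R = "\<lambda>n. (snd (R n), fst (R n))" and y = y]
      R' ne lim y by (simp add: dual_simps)
qed

lemma Phi_Mbar: "x \<in> M \<Longrightarrow> Phi M chr x \<in> Mbar M chr"
  using Phi_in_Rpf by (simp add: Mbar_def)

lemma Phi_sets: "fst (Phi M chr x) = Ipast M chr {x}" "snd (Phi M chr x) = Ifut M chr {x}"
  by (simp_all add: Phi_def)

lemma Phi_nonempty: "x \<in> M \<Longrightarrow> Ipast M chr {x} \<noteq> {}" "x \<in> M \<Longrightarrow> Ifut M chr {x} \<noteq> {}"
  using approach_past approach_future in_Ipast in_Ifut by blast+

text \<open>The first claim mixes a limit of pasts with a condition on futures and needs
  \<open>limit_partner\<close>. The second stays on the past side and follows from the first clause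
  of the limit.\<close>

lemma Phi_Cl_plus:
  assumes x: "x \<in> M" and cl: "Phi M chr x \<in> Cl_plus M chr D"
  shows "D \<subseteq> L_IF M chr S \<Longrightarrow> Phi M chr x \<in> L_IF M chr S"
    and "D \<subseteq> L_IP M chr S \<Longrightarrow> Phi M chr x \<in> L_IP M chr S"
proof -
  have "Phi M chr x \<in> D \<or> (\<exists>R. (\<forall>n. R n \<in> D) \<and> lim_past M chr (\<lambda>n. fst (R n)) (Ipast M chr {x}))"
    using cl unfolding Cl_plus_def Un_iff mem_Collect_eq Phi_sets by (elim disjE conjE disjI1) (rule disjI2)
  then consider "Phi M chr x \<in> D"
    | R where "\<forall>n. R n \<in> D" "lim_past M chr (\<lambda>n. fst (R n)) (Ipast M chr {x})"
    by (elim disjE exE conjE)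
  note cases = this
  show "Phi M chr x \<in> L_IF M chr S" if D: "D \<subseteq> L_IF M chr S"
    using cases
  proof cases
    case 1
    then show ?thesis using D by blast
  next
    case 2
    have R: "R n \<in> Mbar M chr" "snd (R n) \<noteq> {}" "snd (R n) \<subseteq> (\<Union>R\<in>S. snd R)" for n
      using 2(1)[THEN spec, of n] D by (auto simp: L_IF_def)
    have "Ifut M chr {x} \<subseteq> (\<Union>R\<in>S. snd R)"
    proof
      fix y assume "y \<in> Ifut M chr {x}"
      then obtain n where "y \<in> snd (R n)" using limit_partner[OF x R(1,2) 2(2)] in_Ifut by blast
      then show "y \<in> (\<Union>R\<in>S. snd R)" using R(3)[of n] by (rule subsetD[rotated])
    qed
    then show ?thesis using Phi_Mbar[OF x] Phi_nonempty(2)[OF x] unfolding L_IF_def mem_Collect_eq Phi_sets by blast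
  qed
  show "Phi M chr x \<in> L_IP M chr S" if D: "D \<subseteq> L_IP M chr S"
    using cases
  proof cases
    case 1
    then show ?thesis using D by blast
  next
    case 2
    have R: "fst (R n) \<subseteq> (\<Union>R\<in>S. fst R)" for n
      using 2(1)[THEN spec, of n] D by (auto simp: L_IP_def)
    have "Ipast M chr {x} \<subseteq> (\<Union>R\<in>S. fst R)"
    proof
      fix y assume "y \<in> Ipast M chr {x}"
      then obtain n where "y \<in> fst (R n)"
        using 2(2) unfolding lim_past_def eventually_sequentially by blast
      then show "y \<in> (\<Union>R\<in>S. fst R)" using R[of n] by (rule subsetD[rotated])
    qed
    then show ?thesis using Phi_Mbar[OF x] Phi_nonempty(1)[OF x] unfolding L_IP_def mem_Collect_eq Phi_sets by blast
  qed
qed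

lemma Phi_Cl_minus:
  assumes x: "x \<in> M" and cl: "Phi M chr x \<in> Cl_minus M chr D"
  shows "D \<subseteq> L_IP M chr S \<Longrightarrow> Phi M chr x \<in> L_IP M chr S"
    and "D \<subseteq> L_IF M chr S \<Longrightarrow> Phi M chr x \<in> L_IF M chr S"
proof -
  have "Phi M chr x \<in> D \<or> (\<exists>R. (\<forall>n. R n \<in> D) \<and> lim_fut M chr (\<lambda>n. snd (R n)) (Ifut M chr {x}))"
    using cl unfolding Cl_minus_def Un_iff mem_Collect_eq Phi_sets by (elim disjE conjE disjI1) (rule disjI2)
  then consider "Phi M chr x \<in> D"
    | R where "\<forall>n. R n \<in> D" "lim_fut M chr (\<lambda>n. snd (R n)) (Ifut M chr {x})"
    by (elim disjE exE conjE)
  note cases = this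
  show "Phi M chr x \<in> L_IP M chr S" if D: "D \<subseteq> L_IP M chr S"
    using cases
  proof cases
    case 1
    then show ?thesis using D by blast
  next
    case 2
    have R: "R n \<in> Mbar M chr" "fst (R n) \<noteq> {}" "fst (R n) \<subseteq> (\<Union>R\<in>S. fst R)" for n
      using 2(1)[THEN spec, of n] D by (auto simp: L_IP_def)
    have "Ipast M chr {x} \<subseteq> (\<Union>R\<in>S. fst R)"
    proof
      fix y assume "y \<in> Ipast M chr {x}"
      then obtain n where "y \<in> fst (R n)" using limit_partner'[OF x R(1,2) 2(2)] in_Ipast by blast
      then show "y \<in> (\<Union>R\<in>S. fst R)" using R(3)[of n] by (rule subsetD[rotated])
    qed
    then show ?thesis using Phi_Mbar[OF x] Phi_nonempty(1)[OF x] unfolding L_IP_def mem_Collect_eq Phi_sets by blast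
  qed
  show "Phi M chr x \<in> L_IF M chr S" if D: "D \<subseteq> L_IF M chr S"
    using cases
  proof cases
    case 1
    then show ?thesis using D by blast
  next
    case 2
    have R: "snd (R n) \<subseteq> (\<Union>R\<in>S. snd R)" for n
      using 2(1)[THEN spec, of n] D by (auto simp: L_IF_def)
    have "Ifut M chr {x} \<subseteq> (\<Union>R\<in>S. snd R)"
    proof
      fix y assume "y \<in> Ifut M chr {x}"
      then obtain n where "y \<in> snd (R n)"
        using 2(2) unfolding lim_fut_def eventually_sequentially by blast
      then show "y \<in> (\<Union>R\<in>S. snd R)" using R[of n] by (rule subsetD[rotated])
    qed
    then show ?thesis using Phi_Mbar[OF x] Phi_nonempty(2)[OF x] unfolding L_IF_def mem_Collect_eq Phi_sets by blast
  qed
qed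

section \<open>Limits of the embedded sequence\<close>

lemma lim_past_compose:
  "lim_past M chr P Q \<Longrightarrow> filterlim N sequentially sequentially \<Longrightarrow> lim_past M chr (\<lambda>k. P (N k)) Q"
  unfolding lim_past_def using eventually_compose_filterlim[where f = N] by blast

lemma lim_fut_compose:
  "lim_fut M chr P Q \<Longrightarrow> filterlim N sequentially sequentially \<Longrightarrow> lim_fut M chr (\<lambda>k. P (N k)) Q"
  unfolding lim_fut_def using eventually_compose_filterlim[where f = N] by blast

text \<open>\<open>N\<close> need not be increasing: tending to infinity is all that limits along it
  require.\<close>

lemma frequently_subsequence:
  assumes "frequently P sequentially"
  obtains N where "filterlim N sequentially sequentially" "\<And>k. P (N k)"
proof -
  obtain N where N: "\<And>k. N k \<ge> k" "\<And>k. P (N k)"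
    using assms unfolding frequently_sequentially by metis
  have "filterlim N sequentially sequentially"
    using N(1) filterlim_at_top_mono[OF filterlim_ident, of N] by (auto intro: always_eventually)
  then show thesis using that N(2) by blast
qed

text \<open>\<open>P\<close> may be a boundary element whose second component is empty, so only its
  past is used. Being a limit puts \<open>P\<close> into \<open>Cl_plus\<close> of any set met
  infinitely often, and into \<open>L_IP\<close> without any closure.\<close>

lemma limit_past_closed:
  assumes P: "P \<in> Mbar M chr" "fst P \<noteq> {}" and lim: "lim_past M chr (\<lambda>n. Ipast M chr {x n}) (fst P)"
  shows "frequently (\<lambda>n. Phi M chr (x n) \<in> D) sequentially \<Longrightarrow> P \<in> Cl_plus M chr D"
    and "frequently (\<lambda>n. Phi M chr (x n) \<in> L_IP M chr S) sequentially \<Longrightarrow> P \<in> L_IP M chr S"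
proof -
  assume "frequently (\<lambda>n. Phi M chr (x n) \<in> D) sequentially"
  then obtain N where N: "filterlim N sequentially sequentially" "\<And>k. Phi M chr (x (N k)) \<in> D"
    by (rule frequently_subsequence) (rule that)
  have "lim_past M chr (\<lambda>k. fst (Phi M chr (x (N k)))) (fst P)"
    unfolding Phi_sets by (rule lim_past_compose[OF lim N(1)])
  then have "\<exists>R. (\<forall>n. R n \<in> D) \<and> lim_past M chr (\<lambda>n. fst (R n)) (fst P)"
    using N(2) by (intro exI[of _ "\<lambda>k. Phi M chr (x (N k))"]) simp
  then show "P \<in> Cl_plus M chr D" unfolding Cl_plus_def using P by blast
next
  assume fr: "frequently (\<lambda>n. Phi M chr (x n) \<in> L_IP M chr S) sequentially"
  have "fst P \<subseteq> (\<Union>R\<in>S. fst R)"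
  proof
    fix y assume "y \<in> fst P"
    then have "eventually (\<lambda>n. y \<in> Ipast M chr {x n}) sequentially" using lim unfolding lim_past_def by blast
    from frequently_eventually_conj[OF fr this]
    obtain n where "y \<in> fst (Phi M chr (x n))" "Phi M chr (x n) \<in> L_IP M chr S"
      unfolding Phi_sets by (auto dest!: frequently_ex)
    then show "y \<in> (\<Union>R\<in>S. fst R)" unfolding L_IP_def by blast
  qed
  then show "P \<in> L_IP M chr S" unfolding L_IP_def using P by blast
qed

lemma limit_future_closed:
  assumes P: "P \<in> Mbar M chr" "snd P \<noteq> {}" and lim: "lim_fut M chr (\<lambda>n. Ifut M chr {x n}) (snd P)"
  shows "frequently (\<lambda>n. Phi M chr (x n) \<in> D) sequentially \<Longrightarrow> P \<in> Cl_minus M chr D"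
    and "frequently (\<lambda>n. Phi M chr (x n) \<in> L_IF M chr S) sequentially \<Longrightarrow> P \<in> L_IF M chr S"
proof -
  assume "frequently (\<lambda>n. Phi M chr (x n) \<in> D) sequentially"
  then obtain N where N: "filterlim N sequentially sequentially" "\<And>k. Phi M chr (x (N k)) \<in> D"
    by (rule frequently_subsequence) (rule that)
  have "lim_fut M chr (\<lambda>k. snd (Phi M chr (x (N k)))) (snd P)"
    unfolding Phi_sets by (rule lim_fut_compose[OF lim N(1)])
  then have "\<exists>R. (\<forall>n. R n \<in> D) \<and> lim_fut M chr (\<lambda>n. snd (R n)) (snd P)"
    using N(2) by (intro exI[of _ "\<lambda>k. Phi M chr (x (N k))"]) simp
  then show "P \<in> Cl_minus M chr D" unfolding Cl_minus_def using P by blast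
next
  assume fr: "frequently (\<lambda>n. Phi M chr (x n) \<in> L_IF M chr S) sequentially"
  have "snd P \<subseteq> (\<Union>R\<in>S. snd R)"
  proof
    fix y assume "y \<in> snd P"
    then have "eventually (\<lambda>n. y \<in> Ifut M chr {x n}) sequentially" using lim unfolding lim_fut_def by blast
    from frequently_eventually_conj[OF fr this]
    obtain n where "y \<in> snd (Phi M chr (x n))" "Phi M chr (x n) \<in> L_IF M chr S"
      unfolding Phi_sets by (auto dest!: frequently_ex)
    then show "y \<in> (\<Union>R\<in>S. snd R)" unfolding L_IF_def by blast
  qed
  then show "P \<in> L_IF M chr S" unfolding L_IF_def using P by blast
qed

lemma Cl_superset: "D \<subseteq> Cl_plus M chr D" "D \<subseteq> Cl_minus M chr D"
  by (auto simp: Cl_plus_def Cl_minus_def)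

lemma Phi_closed_sets:
  assumes x: "x \<in> M"
  shows "Phi M chr x \<in> L_plus_alt M chr S \<Longrightarrow> Phi M chr x \<in> L_IF M chr S"
    and "Phi M chr x \<in> L_minus_alt M chr S \<Longrightarrow> Phi M chr x \<in> L_IP M chr S"
    and "Phi M chr x \<in> L_alt M chr S1 S2 \<Longrightarrow> Phi M chr x \<in> L_IP M chr S1 \<inter> L_IF M chr S2"
proof -
  show "Phi M chr x \<in> L_plus_alt M chr S \<Longrightarrow> Phi M chr x \<in> L_IF M chr S"
    unfolding L_plus_alt_def by (rule Phi_Cl_plus(1)[OF x]) auto
  show "Phi M chr x \<in> L_minus_alt M chr S \<Longrightarrow> Phi M chr x \<in> L_IP M chr S"
    unfolding L_minus_alt_def by (rule Phi_Cl_minus(1)[OF x]) auto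
  assume "Phi M chr x \<in> L_alt M chr S1 S2"
  then consider "Phi M chr x \<in> Cl_plus M chr (L_IP M chr S1 \<inter> L_IF M chr S2)"
    | "Phi M chr x \<in> Cl_minus M chr (L_IP M chr S1 \<inter> L_IF M chr S2)" unfolding L_alt_def by blast
  then show "Phi M chr x \<in> L_IP M chr S1 \<inter> L_IF M chr S2"
    using Phi_Cl_plus[OF x] Phi_Cl_minus[OF x] by cases auto
qed

text \<open>In \<open>L_plus_alt\<close> the closure absorbs past limits, while future limits of
  points of \<open>L_IF\<close> are already in \<open>L_IF\<close>; dually for
  \<open>L_minus_alt\<close>. For the intersection, each kind of limit secures only one of the two
  conditions, which is why \<open>L_alt\<close> contains both closures.\<close>

lemma Phi_limit_closed:
  assumes x: "\<And>n. x n \<in> M" and P: "P \<in> Mbar M chr"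
    and lim: "fst P \<noteq> {} \<and> lim_past M chr (\<lambda>n. Ipast M chr {x n}) (fst P) \<or>
              snd P \<noteq> {} \<and> lim_fut M chr (\<lambda>n. Ifut M chr {x n}) (snd P)"
    and C: "C = L_plus_alt M chr S \<or> C = L_minus_alt M chr S \<or> C = L_alt M chr S S'"
    and fr: "frequently (\<lambda>n. Phi M chr (x n) \<in> C) sequentially"
  shows "P \<in> C"
proof -
  consider "C = L_plus_alt M chr S" "frequently (\<lambda>n. Phi M chr (x n) \<in> L_IF M chr S) sequentially"
    | "C = L_minus_alt M chr S" "frequently (\<lambda>n. Phi M chr (x n) \<in> L_IP M chr S) sequentially"
    | "C = L_alt M chr S S'" "frequently (\<lambda>n. Phi M chr (x n) \<in> L_IP M chr S \<inter> L_IF M chr S') sequentially"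
  proof -
    have *: "frequently (\<lambda>n. Phi M chr (x n) \<in> D) sequentially" if "\<And>n. Phi M chr (x n) \<in> C \<Longrightarrow> Phi M chr (x n) \<in> D" for D
      by (rule frequently_elim1[OF fr that])
    from C show thesis
    proof (elim disjE)
      assume "C = L_plus_alt M chr S" then show thesis using that(1) * Phi_closed_sets(1)[OF x] by simp
    next
      assume "C = L_minus_alt M chr S" then show thesis using that(2) * Phi_closed_sets(2)[OF x] by simp
    next
      assume "C = L_alt M chr S S'" then show thesis using that(3) *[of "L_IP M chr S \<inter> L_IF M chr S'"] Phi_closed_sets(3)[OF x] by simp
    qed
  qed
  then show ?thesis
  proof cases
    case 1
    then show ?thesis unfolding 1(1) L_plus_alt_def
      using lim limit_past_closed(1)[OF P] limit_future_closed(2)[OF P] Cl_superset(1) by blast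
  next
    case 2
    then show ?thesis unfolding 2(1) L_minus_alt_def
      using lim limit_past_closed(2)[OF P] limit_future_closed(1)[OF P] Cl_superset(2) by blast
  next
    case 3
    then show ?thesis unfolding 3(1) L_alt_def
      using lim limit_past_closed(1)[OF P] limit_future_closed(1)[OF P] by blast
  qed
qed

end

text \<open>Eventually containing the sequence passes from generating sets to finite intersections
  and arbitrary unions. The underlying set of the topology is \<open>\<Union> B\<close>, so
  \<open>l\<close> has to be placed there separately.\<close>

lemma limitin_topology_generated_by:
  assumes "l \<in> \<Union> B" and basis: "\<And>U. U \<in> B \<Longrightarrow> l \<in> U \<Longrightarrow> eventually (\<lambda>n. f n \<in> U) F"
  shows "limitin (topology_generated_by B) f l F"
  unfolding limitin_def
proof (intro conjI allI impI)
  show "l \<in> topspace (topology_generated_by B)" using assms(1) by simp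
  fix U assume "openin (topology_generated_by B) U \<and> l \<in> U"
  then have "generate_topology_on B U" "l \<in> U" by (auto simp: openin_topology_generated_by_iff)
  then show "eventually (\<lambda>n. f n \<in> U) F"
  proof (induction rule: generate_topology_on.induct)
    case Empty
    then show ?case by simp
  next
    case (Int a b)
    then show ?case by (auto simp: eventually_conj_iff)
  next
    case (UN K)
    then obtain k where "k \<in> K" "l \<in> k" by blast
    then have "eventually (\<lambda>n. f n \<in> k) F" using UN.IH by blast
    then show ?case by eventually_elim (use \<open>k \<in> K\<close> in blast)
  next
    case (Basis s)
    then show ?case using basis by blast
  qed
qed

lemma strongly_causal_spacetime_causal_space:
  assumes sc: "strongly_causal_spacetime X A g T"
  shows "causal_space X (chron X A g T)"
proof -
  have st: "spacetime X A g T" using sc unfolding strongly_causal_spacetime_def by (elim conjE)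
  have sm: "smooth_manifold X A" using st unfolding spacetime_def by (elim conjE)
  show ?thesis
  proof (rule causal_space.intro)
    show "Hausdorff_space X" using sm unfolding smooth_manifold_def by (elim conjE)
    show "second_countable X" using sm unfolding smooth_manifold_def by (elim conjE)
  qed (fact chron_in_topspace chron_trans openin_chron_future[OF st] openin_chron_past[OF st]
      chron_approach_past[OF st] chron_approach_future[OF st] chron_diamond_nbhd[OF sc]
      chron_push_future[OF sc] chron_push_past[OF sc] chron_exit_future[OF st] chron_exit_past[OF st])+
qed

theorem theorem16:
  fixes X :: "'a topology" and A :: "('a, 'n::finite) chart set"
    and g :: "('a, 'n) chart \<Rightarrow> real^'n \<Rightarrow> real^'n^'n"
    and T :: "('a, 'n) chart \<Rightarrow> real^'n \<Rightarrow> real^'n"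
    and Pbar :: "'a set \<times> 'a set" and x :: "nat \<Rightarrow> 'a"
  assumes sc: "strongly_causal_spacetime X A g T"
    and Pbar: "Pbar \<in> Mbar (topspace X) (chron X A g T)"
    and x: "\<And>n. x n \<in> topspace X"
    and lim: "(fst Pbar \<noteq> {} \<and>
               lim_past (topspace X) (chron X A g T)
                 (\<lambda>n. Ipast (topspace X) (chron X A g T) {x n}) (fst Pbar))
            \<or> (snd Pbar \<noteq> {} \<and>
               lim_fut (topspace X) (chron X A g T)
                 (\<lambda>n. Ifut (topspace X) (chron X A g T) {x n}) (snd Pbar))"
  shows "limitin (T_alt (topspace X) (chron X A g T))
           (\<lambda>n. Phi (topspace X) (chron X A g T) (x n)) Pbar sequentially"
proof -
  interpret causal_space X "chron X A g T"
    by (rule strongly_causal_spacetime_causal_space[OF sc])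
  have ev: "eventually (\<lambda>n. Phi M (chron X A g T) (x n) \<in> Mbar M (chron X A g T) - C) sequentially"
    if "C = L_plus_alt M (chron X A g T) S \<or> C = L_minus_alt M (chron X A g T) S \<or> C = L_alt M (chron X A g T) S S'"
      and "Pbar \<in> Mbar M (chron X A g T) - C" for C S S'
  proof -
    have "\<not> frequently (\<lambda>n. Phi M (chron X A g T) (x n) \<in> C) sequentially"
      using Phi_limit_closed[OF x Pbar lim that(1)] that(2) by blast
    then show ?thesis using Phi_Mbar[OF x] by (simp add: not_frequently)
  qed
  show ?thesis unfolding T_alt_def
  proof (rule limitin_topology_generated_by)
    \<comment> \<open>For the empty set nothing is removed, so \<open>Mbar\<close> itself is a
      generating set and \<open>Pbar\<close> belongs to the space.\<close>
    have "L_plus_alt M (chron X A g T) {} = {}"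
      by (simp add: L_plus_alt_def Cl_plus_def L_IF_def)
    then show "Pbar \<in> \<Union> ({Mbar M (chron X A g T) - L_plus_alt M (chron X A g T) S |S. S \<subseteq> Mbar M (chron X A g T)} \<union>
       {Mbar M (chron X A g T) - L_minus_alt M (chron X A g T) S |S. S \<subseteq> Mbar M (chron X A g T)} \<union>
       {Mbar M (chron X A g T) - L_alt M (chron X A g T) S1 S2 |S1 S2.
         S1 \<subseteq> Mbar M (chron X A g T) \<and> S2 \<subseteq> Mbar M (chron X A g T)})"
      using Pbar by (intro UnionI[of "Mbar M (chron X A g T) - L_plus_alt M (chron X A g T) {}"]) blast+
  qed (use ev in blast)
qed

end
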